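(* Let $n,d\ge 1$, let $\mathcal{G}=\{G_1,\dots,G_m\}\subseteq\mathcal{S}_n(\mathbb{R}[X])$ be a finite set, and let $G\subseteq\mathbb{R}[X]$ be a finite set such that $\mathbf{K}_{\mathcal{G}}=K_G$, $(M_G)^n\subseteq\mathcal{M}_{\mathcal{G}}$ and $(T_G)^n\subseteq\mathcal{T}_{\mathcal{G}}$. Let $\mathbf{F}\in\mathcal{S}_n(\mathbb{R}[X])$. Assume: (1) $\mathbf{K}_{\mathcal{G}}$ is compact (resp. $M_G$ is Archimedean); (2) $\mathbf{F}\succcurlyeq\mathbf{0}$ on $\mathbf{K}_{\mathcal{G}}$; (3) for each $\mathbf{x}\in\mathbb{R}^n\setminus\{0\}$, $\mathbf{x}^T\mathbf{F}\mathbf{x}$ has only finitely many zeros in $\mathbf{K}_{\mathcal{G}}$ and each zero lies in the interior of $\mathbf{K}_{\mathcal{G}}$; (4) for each $\mathbf{x}\in\mathbb{R}^n\setminus\{0\}$ and for each zero $p$ of $\mathbf{x}^T\mathbf{F}\mathbf{x}$ in $\mathbf{K}_{\mathcal{G}}$, the Hessian $D^2(\mathbf{x}^T\mathbf{F}\mathbf{x})(p)$ is positive definite. Then: (i) there exists a matrix $\mathbf{X}_-\in\mathcal{M}_n(\mathbb{R}[X])$ such that $\mathbf{X}_-\mathbf{F}\mathbf{X}_-^T\in(T_G)^n\subseteq\mathcal{T}_{\mathcal{G}}$ (resp. $\mathbf{X}_-\mathbf{F}\mathbf{X}_-^T\in(M_G)^n\subseteq\mathcal{M}_{\mathcal{G}}$);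 (ii) there exists a non-zero polynomial $b\in\mathbb{R}[X]$ such that $b^2\mathbf{F}\in(T_G)^n\subseteq\mathcal{T}_{\mathcal{G}}$ (resp. $b^2\mathbf{F}\in(M_G)^n\subseteq\mathcal{M}_{\mathcal{G}}$).
   Context: $\mathbb{R}[X]=\mathbb{R}[x_1,\dots,x_d]$. For a commutative unital ring $R$, $\mathcal{M}_n(R)$ is the ring of $n\times n$ matrices over $R$, $\mathcal{S}_n(R)$ its subset of symmetric matrices, $\mathbf{I}_n$ the identity matrix. A quadratic module in $\mathcal{M}_n(R)$ is a set $\mathcal{M}\subseteq\mathcal{S}_n(R)$ with $\mathbf{I}_n\in\mathcal{M}$, $\mathcal{M}+\mathcal{M}\subseteq\mathcal{M}$, and $A^T\mathcal{M}A\subseteq\mathcal{M}$ for all $A\in\mathcal{M}_n(R)$. A preordering in $\mathcal{M}_n(R)$ is a quadratic module $\mathcal{T}$ such that $\mathcal{T}\cap(R\cdot\mathbf{I}_n)$ is closed under multiplication. $\mathcal{M}_{\mathcal{G}}$ and $\mathcal{T}_{\mathcal{G}}$ denote the smallest quadratic module and the smallest preordering in $\mathcal{M}_n(\mathbb{R}[X])$ containing $\mathcal{G}$. For $G\subseteq\mathbb{R}[X]$, $M_G$ and $T_G$ denote the smallest quadratic module and the smallest preordering of $\mathbb{R}[X]$ containing $G$ (that is, quadratic modules and preorderings in $\mathcal{M}_1(\mathbb{R}[X])=\mathbb{R}[X]$; explicitly, a quadratic module of $\mathbb{R}[X]$ contains $1$ and is closed under addition and multiplication by squares, a preordering is closed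 under addition and multiplication and contains all squares). $M_G$ is Archimedean if for each $a\in\mathbb{R}[X]$ there is $k\in\mathbb{N}$ with $k-a^2\in M_G$. For a quadratic module $M\subseteq\mathbb{R}[X]$, $M^n$ denotes the set of all finite sums $\sum_i m_iA_i^TA_i$ with $m_i\in M$, $A_i\in\mathcal{M}_n(\mathbb{R}[X])$. $\mathbf{K}_{\mathcal{G}}=\{x\in\mathbb{R}^d : \mathbf{G}(x)\succcurlyeq\mathbf{0}\ \forall\,\mathbf{G}\in\mathcal{G}\}$ and $K_G=\{x\in\mathbb{R}^d: g(x)\ge 0\ \forall g\in G\}$. "$\succcurlyeq\mathbf 0$ on a set" means positive semidefinite at each point of the set. For constant $\mathbf{x}\in\mathbb{R}^n$, $\mathbf{x}^T\mathbf{F}\mathbf{x}$ is regarded as a polynomial in $\mathbb{R}[X]$; $D^2f(p)$ is the Hessian matrix of $f$ at $p$. The statement has two versions: the one without the parenthetical "(resp. ...)" parts and the one with them. *)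

theory Defs
  imports "HOL-Analysis.Analysis" "HOL-Library.Poly_Mapping"
begin

text \<open>
  Real polynomials in finitely many variables, indexed by a finite type \<open>'d\<close>: finitely supported
  maps from exponent vectors to coefficients, with the convolution product.
\<close>

type_synonym 'd rpoly = "('d \<Rightarrow>\<^sub>0 nat) \<Rightarrow>\<^sub>0 real"

definition pconst :: "real \<Rightarrow> 'd rpoly" where
  "pconst c = Poly_Mapping.single 0 c"

definition peval :: "('d::finite) rpoly \<Rightarrow> real ^ 'd \<Rightarrow> real" where
  "peval p x = (\<Sum>\<alpha>\<in>Poly_Mapping.keys p.
     Poly_Mapping.lookup p \<alpha> * (\<Prod>i\<in>UNIV. (x $ i) ^ Poly_Mapping.lookup \<alpha> i))"

definition meval :: "('d::finite) rpoly ^ 'n ^ 'n \<Rightarrow> real ^ 'd \<Rightarrow> real ^ 'n ^ 'n" where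
  "meval F x = map_matrix (\<lambda>p. peval p x) F"

definition sym_matrices :: "('a ^ 'n ^ 'n) set" where
  "sym_matrices = {A. transpose A = A}"

definition mscale :: "'a::times \<Rightarrow> 'a ^ 'n ^ 'm \<Rightarrow> 'a ^ 'n ^ 'm" where
  "mscale c A = map_matrix (\<lambda>a. c * a) A"

definition possemidef :: "real ^ 'n ^ 'n \<Rightarrow> bool" where
  "possemidef A \<longleftrightarrow> transpose A = A \<and> (\<forall>v. 0 \<le> v \<bullet> (A *v v))"

definition posdef :: "real ^ 'n ^ 'n \<Rightarrow> bool" where
  "posdef A \<longleftrightarrow> transpose A = A \<and> (\<forall>v. v \<noteq> 0 \<longrightarrow> 0 < v \<bullet> (A *v v))"

definition quad_form :: "('d::finite) rpoly ^ 'n ^ 'n \<Rightarrow> real ^ 'n \<Rightarrow> 'd rpoly" where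
  "quad_form F v = (\<Sum>i\<in>UNIV. \<Sum>j\<in>UNIV. pconst (v $ i) * F $ i $ j * pconst (v $ j))"

definition partial_deriv :: "'d \<Rightarrow> (real ^ ('d::finite) \<Rightarrow> real) \<Rightarrow> real ^ 'd \<Rightarrow> real" where
  "partial_deriv i f p = deriv (\<lambda>t. f (p + t *\<^sub>R axis i 1)) 0"

definition hessian :: "(real ^ ('d::finite) \<Rightarrow> real) \<Rightarrow> real ^ 'd \<Rightarrow> real ^ 'd ^ 'd" where
  "hessian f p = (\<chi> i j. partial_deriv i (partial_deriv j f) p)"

definition quadratic_module :: "('a::comm_ring_1) set \<Rightarrow> bool" where
  "quadratic_module M \<longleftrightarrow> 1 \<in> M \<and> (\<forall>p\<in>M. \<forall>q\<in>M. p + q \<in> M) \<and> (\<forall>a. \<forall>p\<in>M. a\<^sup>2 * p \<in> M)"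

definition ring_preordering :: "('a::comm_ring_1) set \<Rightarrow> bool" where
  "ring_preordering T \<longleftrightarrow>
     (\<forall>p\<in>T. \<forall>q\<in>T. p + q \<in> T) \<and> (\<forall>p\<in>T. \<forall>q\<in>T. p * q \<in> T) \<and> (\<forall>a. a\<^sup>2 \<in> T)"

definition mat_quadratic_module :: "(('a::comm_ring_1) ^ 'n ^ 'n) set \<Rightarrow> bool" where
  "mat_quadratic_module M \<longleftrightarrow>
     M \<subseteq> sym_matrices \<and> mat 1 \<in> M \<and> (\<forall>P\<in>M. \<forall>Q\<in>M. P + Q \<in> M) \<and>
     (\<forall>A. \<forall>P\<in>M. transpose A ** P ** A \<in> M)"

text \<open>Here \<open>range mat\<close> is the set of scalar multiples of the identity matrix.\<close>

definition mat_preordering :: "(('a::comm_ring_1) ^ 'n ^ 'n) set \<Rightarrow> bool" where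
  "mat_preordering T \<longleftrightarrow>
     mat_quadratic_module T \<and> (\<forall>P \<in> T \<inter> range mat. \<forall>Q \<in> T \<inter> range mat. P ** Q \<in> T \<inter> range mat)"

text \<open>
  The smallest quadratic module and preordering containing a set are written with \<^const>\<open>hull\<close>,
  i.e. as intersections; the next lemmas say that these intersections are again of the same kind.
  In the matrix case this needs the generators to be symmetric, since otherwise the intersection
  is over the empty family.
\<close>

lemma quadratic_module_hull: "quadratic_module (quadratic_module hull G)"
  by (rule hull_in) (auto simp: quadratic_module_def)

lemma ring_preordering_hull: "ring_preordering (ring_preordering hull G)"
  by (rule hull_in) (auto simp: ring_preordering_def)

lemma mat_preordering_sym_matrices:
  "mat_preordering (sym_matrices :: (('a::comm_ring_1) ^ 'n ^ 'n) set)"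
proof -
  have add: "transpose (A + B) = transpose A + transpose B" for A B :: "'a ^ 'n ^ 'n"
    by (simp add: transpose_def vec_eq_iff)
  have scalar: "mat a ** mat b = (mat (a * b) :: 'a ^ 'n ^ 'n)" for a b
  proof -
    have "(if i = k then a else 0) * (if k = j then b else 0) =
        (if k = i then (if i = j then a * b else 0) else 0)" for i j k :: 'n
      by auto
    then show ?thesis
      by (simp add: vec_eq_iff matrix_matrix_mult_def mat_def)
  qed
  have qm: "mat_quadratic_module (sym_matrices :: ('a ^ 'n ^ 'n) set)"
    by (simp add: mat_quadratic_module_def sym_matrices_def add matrix_transpose_mul
        matrix_mul_assoc)
  have "P ** Q \<in> sym_matrices \<inter> range mat" if PQ: "P \<in> range mat" "Q \<in> range mat"
    for P Q :: "'a ^ 'n ^ 'n"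
  proof -
    obtain a b where "P = mat a" "Q = mat b" using PQ by blast
    then have "P ** Q = mat (a * b)" by (simp add: scalar)
    then show ?thesis by (simp add: sym_matrices_def)
  qed
  with qm show ?thesis
    unfolding mat_preordering_def by blast
qed

lemma mat_quadratic_module_Inter:
  assumes "\<And>T. T \<in> \<T> \<Longrightarrow> mat_quadratic_module T" and "\<T> \<noteq> {}"
  shows "mat_quadratic_module (\<Inter>\<T>)"
  unfolding mat_quadratic_module_def
proof (intro conjI ballI allI)
  show "\<Inter>\<T> \<subseteq> sym_matrices" "mat 1 \<in> \<Inter>\<T>"
    using assms unfolding mat_quadratic_module_def by fast+
  show "P + Q \<in> \<Inter>\<T>" if "P \<in> \<Inter>\<T>" "Q \<in> \<Inter>\<T>" for P Q
    using that assms(1) by (simp add: mat_quadratic_module_def)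
  show "transpose A ** P ** A \<in> \<Inter>\<T>" if "P \<in> \<Inter>\<T>" for A P
    using that assms(1) by (simp add: mat_quadratic_module_def)
qed

lemma mat_quadratic_module_hull:
  assumes "\<G> \<subseteq> sym_matrices"
  shows "mat_quadratic_module (mat_quadratic_module hull \<G>)"
  unfolding hull_def using assms mat_preordering_sym_matrices
  by (intro mat_quadratic_module_Inter) (auto simp: mat_preordering_def)

lemma mat_preordering_hull:
  assumes "\<G> \<subseteq> sym_matrices"
  shows "mat_preordering (mat_preordering hull \<G>)"
  unfolding mat_preordering_def[of "mat_preordering hull \<G>"]
proof (intro conjI ballI)
  let ?\<T> = "{T. mat_preordering T \<and> \<G> \<subseteq> T}"
  have sym: "sym_matrices \<in> ?\<T>"
    using assms mat_preordering_sym_matrices by blast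
  then show "mat_quadratic_module (mat_preordering hull \<G>)"
    unfolding hull_def by (intro mat_quadratic_module_Inter) (auto simp: mat_preordering_def)
  fix P Q
  assume P: "P \<in> (mat_preordering hull \<G>) \<inter> range mat"
    and Q: "Q \<in> (mat_preordering hull \<G>) \<inter> range mat"
  have "P ** Q \<in> T \<inter> range mat" if T: "T \<in> ?\<T>" for T
  proof -
    have "P \<in> T \<inter> range mat" "Q \<in> T \<inter> range mat"
      using P Q T unfolding hull_def by blast+
    then show ?thesis
      using T unfolding mat_preordering_def by blast
  qed
  then show "P ** Q \<in> (mat_preordering hull \<G>) \<inter> range mat"
    using sym unfolding hull_def by blast
qed

definition archimedean :: "('a::comm_ring_1) set \<Rightarrow> bool" where
  "archimedean M \<longleftrightarrow> (\<forall>a. \<exists>k::nat. of_nat k - a\<^sup>2 \<in> M)"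

text \<open>The set \<open>M\<^sup>n\<close> of all finite sums of terms \<open>m A\<^sup>T A\<close> with \<open>m \<in> M\<close> and \<open>A\<close> an \<open>n \<times> n\<close> matrix.\<close>

definition mat_cone :: "('a::comm_ring_1) set \<Rightarrow> ('a ^ 'n ^ 'n) set" where
  "mat_cone M = {\<Sum>i<k. mscale (m i) (transpose (A i) ** A i) |
     (k::nat) (m :: nat \<Rightarrow> 'a) (A :: nat \<Rightarrow> 'a ^ 'n ^ 'n). \<forall>i<k. m i \<in> M}"

definition psd_set :: "(('d::finite) rpoly ^ 'n ^ 'n) set \<Rightarrow> (real ^ 'd) set" where
  "psd_set \<G> = {x. \<forall>H\<in>\<G>. possemidef (meval H x)}"

definition nonneg_set :: "('d::finite) rpoly set \<Rightarrow> (real ^ 'd) set" where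
  "nonneg_set G = {x. \<forall>g\<in>G. 0 \<le> peval g x}"

definition zeros_on :: "('d::finite) rpoly \<Rightarrow> (real ^ 'd) set \<Rightarrow> (real ^ 'd) set" where
  "zeros_on f K = {p \<in> K. peval f p = 0}"

end

theory Submission
  imports Defs "HOL-Algebra.Algebraic_Closure_Type"
begin

text \<open>
  Neither Schmuedgen's theorem nor the Archimedean Positivstellensatz is needed. The core is Artin's
  theorem in the form: if \<open>G\<close> is finite and \<open>f \<ge> 0\<close> on \<open>K\<^sub>G\<close>, then \<open>b\<^sup>2 f \<in> T\<^sub>G\<close> for some \<open>b \<noteq> 0\<close>.
  Otherwise some ordering of the rational function field makes \<open>G\<close> nonnegative and \<open>f\<close> negative; it
  extends to a real closed field, and eliminating the variables one at a time yields a real point with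
  the same signs, a contradiction.

  Over the function field a symmetric \<open>F\<close> is congruent to a diagonal matrix, and where \<open>F\<close> is positive
  semidefinite the diagonal entries are nonnegative. So Artin's theorem for the entries settles the
  compact case with the set \<open>K\<^sub>G\<close>. In the Archimedean case the hypothesis on the zeros makes \<open>F\<close> positive
  semidefinite on a neighbourhood of the compact set \<open>K\<^sub>G\<close>, and there is an explicit \<open>h \<in> M\<^sub>G\<close> with
  \<open>{h \<ge> 0}\<close> inside this neighbourhood. As the preordering generated by the single polynomial \<open>h\<close> is
  contained in \<open>M\<^sub>G\<close>, Artin's theorem applied to \<open>{h}\<close> finishes the proof. The matrix in (i) is \<open>b\<close> times
  the identity.
\<close>

text \<open>No real closure is constructed. A subset \<open>T\<close> of the algebraic closure of
  the function field encodes a subfield, the differences of elements of \<open>T\<close>, together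
  with its ordering, so Zorn's lemma applies to plain inclusion. For maximal \<open>T\<close> an
  ordering of a larger subfield cannot exist, and this already gives the intermediate value
  property. The elimination compares two ordered fields through a common table of signs. The finite
  list of coefficients on which the table depends is fixed before the fields are compared; without
  this uniformity the variables could not be removed one by one. In the Archimedean case
  \<open>M_G\<close> need not be closed under products, so Artin's theorem for \<open>G\<close> ends
  in the wrong cone. For one generator \<open>h\<close> the only products are squares times
  \<open>1\<close> or \<open>h\<close>, hence the search for a single separating polynomial.
  Diagonalisation multiplies by pivots and must know that a polynomial vanishing on the set is zero.
  This can fail when the cone contains some non-zero \<open>t\<close> and \<open>-t\<close>; but
  then square multiples of every polynomial lie in the cone.\<close>

hide_const (open) up_ring.coeff up_ring.monom module.smult Polynomials.degree Polynomials.lead_coeff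
no_notation Polynomials.var (\<open>X\<index>\<close>)
no_notation fps_nth (infixl "$" 75)

section \<open>Polynomials over real closed fields\<close>

text \<open>Among ordered fields the intermediate value property for polynomials characterises the
  real closed ones, and it is the form in which sign tables use real closedness.\<close>

class real_closed_field = linordered_field +
  assumes ivt_sum: "a \<le> b \<Longrightarrow> (\<Sum>k\<le>n. c k * a ^ k) \<le> 0 \<Longrightarrow> 0 \<le> (\<Sum>k\<le>n. c k * b ^ k)
    \<Longrightarrow> \<exists>x. a \<le> x \<and> x \<le> b \<and> (\<Sum>k\<le>n. c k * x ^ k) = 0"

instance real :: real_closed_field
proof
  fix a b :: real and c :: "nat \<Rightarrow> real" and n
  assume "a \<le> b" "(\<Sum>k\<le>n. c k * a ^ k) \<le> 0" "0 \<le> (\<Sum>k\<le>n. c k * b ^ k)"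
  then show "\<exists>x. a \<le> x \<and> x \<le> b \<and> (\<Sum>k\<le>n. c k * x ^ k) = 0"
    by (intro IVT') (auto intro!: continuous_intros)
qed

lemma poly_ivt:
  fixes p :: "'a::real_closed_field poly"
  assumes "a \<le> b" "poly p a \<le> 0" "0 \<le> poly p b"
  shows "\<exists>x. a \<le> x \<and> x \<le> b \<and> poly p x = 0"
  using ivt_sum[of a b "coeff p" "degree p"] assms by (simp add: poly_altdef)

lemma poly_ivt_neg:
  fixes p :: "'a::real_closed_field poly"
  assumes "a < b" "poly p a * poly p b < 0"
  shows "\<exists>x. a < x \<and> x < b \<and> poly p x = 0"
proof -
  have "\<exists>x. a \<le> x \<and> x \<le> b \<and> poly p x = 0"
  proof (cases "poly p a < 0")
    case True
    then show ?thesis using poly_ivt[of a b p] assms by (simp add: mult_less_0_iff)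
  next
    case False
    then show ?thesis using poly_ivt[of a b "-p"] assms by (simp add: mult_less_0_iff)
  qed
  then show ?thesis using assms(2)
    by (metis less_le mult_zero_left mult_zero_right less_irrefl)
qed

lemma poly_no_root_pos:
  fixes p :: "'a::real_closed_field poly"
  assumes "a \<le> b" "\<And>x. a \<le> x \<Longrightarrow> x \<le> b \<Longrightarrow> poly p x \<noteq> 0"
  shows "poly p a * poly p b > 0"
proof -
  have "poly p a \<noteq> 0" "poly p b \<noteq> 0" using assms by auto
  moreover have "\<not> poly p a * poly p b < 0"
  proof
    assume "poly p a * poly p b < 0"
    moreover from this have "a \<noteq> b" by (auto simp: mult_less_0_iff)
    ultimately show False using poly_ivt_neg[of a b p] assms by force
  qed
  ultimately show ?thesis by (metis linorder_neqE mult_eq_0_iff)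
qed

text \<open>Rolle's theorem without completeness. If the value at \<open>y\<close> recurs, let
  \<open>z0\<close> be its next occurrence. Then \<open>p - p(y)\<close> is
  \<open>(X - y) (X - z0) g\<close> with \<open>g\<close> free of roots on \<open>[y, z0]\<close>,
  and the factors \<open>y - z0\<close> and \<open>z0 - y\<close> give the derivative opposite signs
  at the two ends.\<close>

lemma poly_inj_of_pderiv_nonzero:
  fixes p :: "'a::real_closed_field poly"
  assumes d: "\<And>x. l < x \<Longrightarrow> x < r \<Longrightarrow> poly (pderiv p) x \<noteq> 0" and yz: "l < y" "y < z" "z < r"
  shows "poly p y \<noteq> poly p z"
proof
  assume eq: "poly p y = poly p z"
  define h where "h = p - [:poly p y:]"
  have dh: "pderiv h = pderiv p" by (simp add: h_def pderiv_diff pderiv_pCons)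
  have h0: "h \<noteq> 0" using d[of y] yz dh by auto
  define Z where "Z = {x. poly h x = 0 \<and> y < x \<and> x \<le> z}"
  have "finite Z" unfolding Z_def using poly_roots_finite[OF h0] by (rule rev_finite_subset) auto
  moreover have "z \<in> Z" using eq yz by (simp add: Z_def h_def)
  ultimately have z0: "Min Z \<in> Z" and z0m: "\<And>x. x \<in> Z \<Longrightarrow> Min Z \<le> x" by (auto intro: Min_in)
  define z0 where "z0 = Min Z"
  have z0': "y < z0" "z0 \<le> z" "poly h z0 = 0" using z0 unfolding z0_def Z_def by auto
  obtain g1 where g1: "h = [:-y, 1:] * g1"
    using poly_eq_0_iff_dvd[of h y] by (auto simp: h_def dvd_def)
  have "poly g1 z0 = 0" using z0' g1 by auto
  then obtain g where g: "g1 = [:-z0, 1:] * g" using poly_eq_0_iff_dvd[of g1 z0] by (auto simp: dvd_def)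
  have dy: "poly (pderiv p) y = (y - z0) * poly g y" and dz: "poly (pderiv p) z0 = (z0 - y) * poly g z0"
    unfolding dh[symmetric] g1 g by (simp_all add: pderiv_mult pderiv_pCons del: mult_pCons_left)
  have ny: "poly (pderiv p) y \<noteq> 0" "poly (pderiv p) z0 \<noteq> 0" using d yz z0' by auto
  \<comment> \<open>A root of \<open>g\<close> at an end would be a double root of \<open>h\<close>,
    hence a zero of the derivative; a root inside would contradict the choice of
    \<open>z0\<close>.\<close>
  have "poly g x \<noteq> 0" if "y \<le> x" "x \<le> z0" for x
  proof
    assume gx: "poly g x = 0"
    then have "poly h x = 0" by (simp add: g1 g)
    moreover have "x \<noteq> y" "x \<noteq> z0" using gx ny dy dz by auto
    ultimately have "x \<in> Z" "x < z0" using that z0' by (auto simp: Z_def)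
    then show False using z0m unfolding z0_def by force
  qed
  then have "poly g y * poly g z0 > 0" using poly_no_root_pos[of y z0 g] z0' by simp
  then have "poly (pderiv p) y * poly (pderiv p) z0 < 0"
  proof -
    have "poly (pderiv p) y * poly (pderiv p) z0 = - ((z0 - y)\<^sup>2 * (poly g y * poly g z0))"
      unfolding dy dz by (simp add: power2_eq_square algebra_simps)
    moreover have "(z0 - y)\<^sup>2 > 0" using z0' by simp
    ultimately show ?thesis using \<open>poly g y * poly g z0 > 0\<close> by (simp add: mult_pos_pos)
  qed
  from poly_ivt_neg[OF z0'(1) this] obtain x where "y < x" "x < z0" "poly (pderiv p) x = 0" by blast
  then show False using d[of x] yz z0' by simp
qed

text \<open>In the open interval the difference quotient at \<open>y\<close> is a polynomial which
  is \<open>p'(y) > 0\<close> at \<open>y\<close> and has no root by injectivity, so it stays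
  positive. At the end points nothing is known about the derivative; a wrong inequality there would
  make \<open>p\<close> take an inner value twice.\<close>

lemma poly_strict_mono_of_pderiv_pos:
  fixes p :: "'a::real_closed_field poly"
  assumes d: "\<And>x. l < x \<Longrightarrow> x < r \<Longrightarrow> poly (pderiv p) x > 0" and yz: "l \<le> y" "y < z" "z \<le> r"
  shows "poly p y < poly p z"
proof -
  have inj: "poly p y \<noteq> poly p z" if "l < y" "y < z" "z < r" for y z
    using poly_inj_of_pderiv_nonzero[of l r p y z] d that by force
  have inner: "poly p y < poly p z" if yz: "l < y" "y < z" "z < r" for y z
  proof -
    have "poly (p - [:poly p y:]) y = 0" by simp
    then obtain g where g: "p - [:poly p y:] = [:-y, 1:] * g" using poly_eq_0_iff_dvd by (metis dvdE)
    then have p: "p = [:-y, 1:] * g + [:poly p y:]" by (simp add: diff_eq_eq)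
    have dy: "poly (pderiv p) y = poly g y"
      by (subst p) (simp add: pderiv_add pderiv_mult pderiv_pCons del: mult_pCons_left)
    have px: "poly p x = (x - y) * poly g x + poly p y" for x
      by (subst p) (simp add: algebra_simps)
    have gy: "poly g y > 0" using d[of y] yz dy by simp
    have "poly g x \<noteq> 0" if "y \<le> x" "x \<le> z" for x
    proof (cases "x = y")
      case False
      then have "poly p y \<noteq> poly p x" using inj[of y x] that yz by simp
      then show ?thesis using px[of x] by auto
    qed (use gy in simp)
    then have "poly g z > 0" using poly_no_root_pos[of y z g] yz gy by (simp add: zero_less_mult_iff)
    then show ?thesis using px[of z] yz by (simp add: mult_pos_pos)
  qed
  have left: "poly p y < poly p z" if yz: "l \<le> y" "y < z" "z < r" for y z
  proof (rule ccontr)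
    assume "\<not> ?thesis"
    then have le: "poly p z \<le> poly p y" by simp
    then have ly: "y = l" using inner[of y z] yz by force
    obtain y2 where y2: "y < y2" "y2 < z" using dense yz by blast
    obtain y1 where y1: "y < y1" "y1 < y2" using dense y2 by blast
    have "poly p y1 < poly p y2" "poly p y2 < poly p z" using inner y1 y2 yz by auto
    then have "poly (p - [:poly p y2:]) y * poly (p - [:poly p y2:]) y1 < 0"
      using le by (auto simp: mult_less_0_iff)
    from poly_ivt_neg[OF y1(1) this] obtain c where "y < c" "c < y1" "poly p c = poly p y2" by auto
    then show False using inj[of c y2] y1 y2 yz by auto
  qed
  show ?thesis
  proof (cases "z < r")
    case False
    then have zr: "z = r" using yz by simp
    obtain y1 where y1: "y < y1" "y1 < r" using dense yz by (metis zr)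
    obtain y2 where y2: "y1 < y2" "y2 < r" using dense y1 by blast
    obtain y3 where y3: "y2 < y3" "y3 < r" using dense y2 by blast
    have lt: "poly p y < poly p y1" "poly p y1 < poly p y2" "poly p y2 < poly p y3"
      using left[of y y1] left[of y1 y2] left[of y2 y3] y1 y2 y3 yz by auto
    have "poly p y1 < poly p r"
    proof (rule ccontr)
      assume "\<not> ?thesis"
      then have "poly (p - [:poly p y2:]) y3 * poly (p - [:poly p y2:]) r < 0"
        using lt by (auto simp: mult_less_0_iff)
      from poly_ivt_neg[OF y3(2) this] obtain c where "y3 < c" "c < r" "poly p c = poly p y2" by auto
      then show False using left[of y2 c] y1 y2 y3 yz by auto
    qed
    then show ?thesis using lt zr by simp
  qed (use left yz in blast)
qed

section \<open>Sign tables shared by two ordered fields\<close>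

definition same_sign :: "'a::linordered_field \<Rightarrow> 'b::linordered_field \<Rightarrow> bool" where
  "same_sign x y \<longleftrightarrow> (0 < x \<longleftrightarrow> 0 < y) \<and> (x < 0 \<longleftrightarrow> y < 0)"

lemma same_sign_eq_0: "same_sign x y \<Longrightarrow> x = 0 \<longleftrightarrow> y = 0"
  unfolding same_sign_def by (metis less_irrefl linorder_neqE)

lemma same_sign_sym: "same_sign x y \<longleftrightarrow> same_sign y x"
  by (auto simp: same_sign_def)

lemma same_sign_uminus_iff: "same_sign (- x) (- y) \<longleftrightarrow> same_sign x y"
  by (auto simp: same_sign_def)

lemma same_sign_mult: "same_sign x y \<Longrightarrow> same_sign x' y' \<Longrightarrow> same_sign (x * x') (y * y')"
  by (auto simp: same_sign_def mult_less_0_iff zero_less_mult_iff)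

lemma same_sign_one: "same_sign 1 1"
  by (auto simp: same_sign_def)

lemma same_sign_power: "same_sign x y \<Longrightarrow> same_sign (x ^ n) (y ^ n)"
  by (induction n) (auto intro: same_sign_mult same_sign_one)

lemma same_sign_cancel:
  assumes "same_sign (c * x) (d * y)" "same_sign c d" "c \<noteq> 0"
  shows "same_sign x y"
proof (cases "c > 0")
  case True
  then have "d > 0" using assms(2) by (simp add: same_sign_def)
  then show ?thesis using True assms(1) by (simp add: same_sign_def zero_less_mult_iff mult_less_0_iff)
next
  case False
  then have "c < 0" "d < 0" using assms(2,3) by (auto simp: same_sign_def)
  then show ?thesis using assms(1) by (auto simp: same_sign_def zero_less_mult_iff mult_less_0_iff)
qed

text \<open>
  As in the sign tables of Cohen and Hoermander, a relation \<open>K\<close> matches the roots of polynomials over two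
  fields. It is confined to \<open>[-1, 1]\<close>, so that every gap has two end points; elsewhere one passes to
  the reflected polynomials.
\<close>

definition compat :: "('a::linorder \<times> 'b::linorder) set \<Rightarrow> 'a \<Rightarrow> 'b \<Rightarrow> bool" where
  "compat K x u \<longleftrightarrow> (\<forall>w w'. (w, w') \<in> K \<longrightarrow> (x < w \<longleftrightarrow> u < w') \<and> (w < x \<longleftrightarrow> w' < u))"

lemma compatD: "compat K x u \<Longrightarrow> (w, w') \<in> K \<Longrightarrow> (x < w \<longleftrightarrow> u < w') \<and> (w < x \<longleftrightarrow> w' < u)"
  unfolding compat_def by blast

lemma compat_eqD: "compat K x u \<Longrightarrow> (x, x') \<in> K \<Longrightarrow> u = x'"
  using compatD[of K x u x x'] by (meson less_irrefl linorder_neqE)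

lemma compat_converse: "compat (K\<inverse>) u x \<longleftrightarrow> compat K x u"
  unfolding compat_def by auto

text \<open>Compatibility of \<open>K\<close> with its own pairs makes it the graph of an increasing
  bijection between two finite sets of nodes.\<close>

definition frame :: "('a::linordered_field \<times> 'b::linordered_field) set \<Rightarrow> bool" where
  "frame K \<longleftrightarrow> finite K \<and> (-1, -1) \<in> K \<and> (1, 1) \<in> K \<and>
     (\<forall>w w'. (w, w') \<in> K \<longrightarrow> compat K w w' \<and> -1 \<le> w \<and> w \<le> 1 \<and> -1 \<le> w' \<and> w' \<le> 1)"

lemma frame_converse: "frame (K\<inverse>) \<longleftrightarrow> frame K"
  unfolding frame_def by (auto simp: compat_converse)

lemma frameD: "frame K \<Longrightarrow> (w, w') \<in> K \<Longrightarrow> compat K w w'"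
  unfolding frame_def by blast

lemma frame_compat_bounds:
  assumes "frame K" "compat K x u" shows "-1 \<le> x \<longleftrightarrow> -1 \<le> u" "x \<le> 1 \<longleftrightarrow> u \<le> 1"
  using assms compatD[of K x u "-1" "-1"] compatD[of K x u 1 1] unfolding frame_def
  by (auto simp: not_less[symmetric])

text \<open>Between consecutive nodes, compatibility means no more than lying in the corresponding
  gap. Questions about compatible points thus become questions about a pair of open
  intervals.\<close>

lemma frame_gap:
  fixes K :: "('a::linordered_field \<times> 'b::linordered_field) set"
  assumes K: "frame K" and x: "-1 \<le> x" "x \<le> 1" "x \<notin> Domain K"
  obtains l l' r r' where "(l, l') \<in> K" "(r, r') \<in> K" "l < x" "x < r" "l' < r'"
    "\<And>y v. l < y \<Longrightarrow> y < r \<Longrightarrow> l' < v \<Longrightarrow> v < r' \<Longrightarrow> compat K y v"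
    "\<And>y v. compat K y v \<Longrightarrow> l < y \<Longrightarrow> y < r \<Longrightarrow> l' < v \<and> v < r'"
proof -
  define A where "A = {w \<in> Domain K. w < x}"
  define B where "B = {w \<in> Domain K. x < w}"
  have fin: "finite A" "finite B" unfolding A_def B_def using K by (auto simp: frame_def finite_Domain)
  have "-1 \<in> A" "1 \<in> B" using K x unfolding A_def B_def frame_def by (auto simp: less_le)
  then have l: "Max A \<in> A" and r: "Min B \<in> B" using fin by (auto intro!: Max_in Min_in)
  obtain l' where l': "(Max A, l') \<in> K" using l by (auto simp: A_def)
  obtain r' where r': "(Min B, r') \<in> K" using r by (auto simp: B_def)
  have lr: "Max A < x" "x < Min B" using l r by (auto simp: A_def B_def)
  have dich: "w \<le> Max A \<or> Min B \<le> w" if "w \<in> Domain K" for w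
    using that x(3) fin by (metis (mono_tags, lifting) A_def B_def Max_ge Min_le linorder_neqE mem_Collect_eq)
  show thesis
  proof (rule that[OF l' r' lr])
    show "l' < r'" using compatD[OF frameD[OF K l'] r'] lr by auto
  next
    fix y v assume yv: "Max A < y" "y < Min B" "l' < v" "v < r'"
    show "compat K y v" unfolding compat_def
    proof (intro allI impI)
      fix w w' assume w: "(w, w') \<in> K"
      then consider "w \<le> Max A" | "Min B \<le> w" using dich by blast
      then show "(y < w) = (v < w') \<and> (w < y) = (w' < v)"
      proof cases
        case 1
        then have "w' \<le> l'" using compatD[OF frameD[OF K w] l'] by (simp add: not_less[symmetric])
        then show ?thesis using 1 yv by auto
      next
        case 2
        then have "r' \<le> w'" using compatD[OF frameD[OF K w] r'] by (simp add: not_less[symmetric])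
        then show ?thesis using 2 yv by auto
      qed
    qed
  next
    fix y v assume "compat K y v" "Max A < y" "y < Min B"
    then show "l' < v \<and> v < r'" using compatD[of K y v] l' r' by auto
  qed
qed

lemma frame_extend:
  assumes K: "frame K" and x: "-1 \<le> x" "x \<le> 1"
  shows "\<exists>u. compat K x u"
proof (cases "x \<in> Domain K")
  case True
  then show ?thesis using frameD[OF K] by auto
next
  case False
  then obtain l l' r r' where "l < x" "x < r" "l' < r'"
    and c: "\<And>y v. l < y \<Longrightarrow> y < r \<Longrightarrow> l' < v \<Longrightarrow> v < r' \<Longrightarrow> compat K y v"
    by (rule frame_gap[OF K x]) blast
  then show ?thesis using dense by blast
qed

text \<open>Every point of \<open>[-1, 1]\<close> has a compatible partner on the other side, so a
  matching says that the same sign patterns occur over both fields, in the same order.\<close>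

definition matching ::
  "('a::linordered_field \<times> 'b::linordered_field) set \<Rightarrow> ('a poly \<times> 'b poly) set \<Rightarrow> bool" where
  "matching K \<Psi> \<longleftrightarrow> frame K \<and> (\<forall>p q. (p, q) \<in> \<Psi> \<longrightarrow> (p = 0 \<longleftrightarrow> q = 0)) \<and>
     (\<forall>x u p q. -1 \<le> x \<longrightarrow> x \<le> 1 \<longrightarrow> compat K x u \<longrightarrow> (p, q) \<in> \<Psi> \<longrightarrow> same_sign (poly p x) (poly q u))"

lemma matching_converse: "matching K \<Psi> \<Longrightarrow> matching (K\<inverse>) (\<Psi>\<inverse>)"
  unfolding matching_def frame_converse compat_converse converse_iff
  by (metis frame_compat_bounds same_sign_sym)

lemma infinite_poly_zero:
  fixes q :: "'b::linordered_field poly"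
  assumes "l < r" "\<And>v. l < v \<Longrightarrow> v < r \<Longrightarrow> poly q v = 0"
  shows "q = 0"
proof (rule ccontr)
  assume "q \<noteq> 0"
  then have "finite {v. poly q v = 0}" by (rule poly_roots_finite)
  then have "finite {l<..<r}" by (rule rev_finite_subset) (use assms in auto)
  then show False using assms(1) infinite_Ioo by blast
qed

text \<open>At a root inside a gap, sign agreement with all compatible points makes the partner
  polynomial vanish on a whole interval, hence identically.\<close>

lemma matching_roots:
  assumes m: "matching K \<Psi>" and p: "(p, q) \<in> \<Psi>" "p \<noteq> 0" and x: "-1 \<le> x" "x \<le> 1" "poly p x = 0"
  shows "x \<in> Domain K"
proof (rule ccontr)
  assume "x \<notin> Domain K"
  then obtain l l' r r' where lr: "l < x" "x < r" "l' < r'"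
    and c: "\<And>y v. l < y \<Longrightarrow> y < r \<Longrightarrow> l' < v \<Longrightarrow> v < r' \<Longrightarrow> compat K y v"
    using m x frame_gap[of K x] unfolding matching_def by metis
  have "poly q v = 0" if "l' < v" "v < r'" for v
  proof -
    have "same_sign (poly p x) (poly q v)" using m c[OF lr(1,2) that] x p unfolding matching_def by blast
    then show ?thesis using x(3) same_sign_eq_0 by blast
  qed
  then have "q = 0" using lr(3) infinite_poly_zero by blast
  then show False using m p unfolding matching_def by blast
qed

lemma frame_subset:
  "frame K \<Longrightarrow> K' \<subseteq> K \<Longrightarrow> (-1, -1) \<in> K' \<Longrightarrow> (1, 1) \<in> K' \<Longrightarrow> frame K'"
  unfolding frame_def compat_def by (meson finite_subset subsetD)

text \<open>The gain is in the nodes: those of \<open>K'\<close> are \<open>-1\<close>,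
  \<open>1\<close> and roots of members of \<open>\<Phi>\<close>, and at such roots the sign of a
  further polynomial can be read off from remainders. With fewer nodes more points are compatible,
  but none of them can be separated by a root of a member of \<open>\<Phi>\<close>.\<close>

lemma matching_restrict:
  fixes K :: "('a::real_closed_field \<times> 'b::real_closed_field) set"
  assumes m: "matching K \<Psi>" and sub: "\<Phi> \<subseteq> \<Psi>"
  defines "K' \<equiv> {(w, w') \<in> K. w = -1 \<or> w = 1 \<or> (\<exists>p q. (p, q) \<in> \<Phi> \<and> p \<noteq> 0 \<and> poly p w = 0)}"
  shows "matching K' \<Phi>"
  unfolding matching_def
proof (intro conjI allI impI)
  have K: "frame K" using m by (simp add: matching_def)
  then show K': "frame K'" by (rule frame_subset) (use K in \<open>auto simp: K'_def frame_def\<close>)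
  fix p q assume pq: "(p, q) \<in> \<Phi>"
  show pq0: "p = 0 \<longleftrightarrow> q = 0" using pq m sub unfolding matching_def by blast
  fix x u assume x: "-1 \<le> x" "x \<le> 1" and c: "compat K' x u"
  obtain u' where u': "compat K x u'" using frame_extend[OF K x] by blast
  have s: "same_sign (poly p x) (poly q u')" using m x u' pq sub unfolding matching_def by blast
  have c': "compat K' x u'" using u' unfolding K'_def compat_def by auto
  show "same_sign (poly p x) (poly q u)"
  proof (cases "q = 0 \<or> u = u'")
    case True
    then show ?thesis using s pq0 by (auto simp: same_sign_def)
  next
    case False
    \<comment> \<open>A root of \<open>q\<close> between \<open>u\<close> and \<open>u'\<close>
      would belong to a node of \<open>K'\<close>, yet both points have the same position as
      \<open>x\<close> relative to all nodes of \<open>K'\<close>.\<close>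
    have "poly q \<zeta> \<noteq> 0" if z: "min u u' \<le> \<zeta>" "\<zeta> \<le> max u u'" for \<zeta>
    proof
      assume z0: "poly q \<zeta> = 0"
      have "-1 \<le> \<zeta>" "\<zeta> \<le> 1"
        using z x frame_compat_bounds[OF K' c] frame_compat_bounds[OF K' c'] by (auto simp: min_def max_def split: if_splits)
      then have "\<zeta> \<in> Domain (K\<inverse>)"
        using matching_roots[OF matching_converse[OF m], of q p \<zeta>] pq sub False z0 by auto
      then obtain z where z1: "(z, \<zeta>) \<in> K" by auto
      then have "same_sign (poly p z) (poly q \<zeta>)"
        using m frameD[OF K z1] pq sub K unfolding matching_def frame_def by blast
      then have "(z, \<zeta>) \<in> K'" using z1 pq z0 False pq0 same_sign_eq_0 unfolding K'_def by blast
      then show False using compatD[OF c] compatD[OF c'] z False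
        by (metis linorder_neqE max.strict_order_iff max_def min_def not_less)
    qed
    then have "poly q (min u u') * poly q (max u u') > 0" by (intro poly_no_root_pos) auto
    then have "same_sign (poly q u) (poly q u')"
      by (auto simp: min_def max_def same_sign_def zero_less_mult_iff split: if_splits)
    then show ?thesis using s by (auto simp: same_sign_def)
  qed
qed

section \<open>One gap of a sign table\<close>

definition unique_root :: "'a::linordered_field poly \<Rightarrow> 'a \<Rightarrow> 'a \<Rightarrow> bool" where
  "unique_root p l r \<longleftrightarrow>
     (\<forall>x y. l < x \<longrightarrow> x < r \<longrightarrow> poly p x = 0 \<longrightarrow> l < y \<longrightarrow> y < r \<longrightarrow> poly p y = 0 \<longrightarrow> x = y)"

text \<open>The inner premise is compatibility with the prospective new nodes, the pairs of roots of
  \<open>p\<close> and \<open>q\<close> in the gap. It is vacuous if one of the two has no root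
  there.\<close>

definition same_sign_on_gap ::
  "'a::linordered_field poly \<Rightarrow> 'b::linordered_field poly \<Rightarrow> 'a \<Rightarrow> 'b \<Rightarrow> 'a \<Rightarrow> 'b \<Rightarrow> bool" where
  "same_sign_on_gap p q l l' r r' \<longleftrightarrow>
     (\<forall>x u. l < x \<longrightarrow> x < r \<longrightarrow> l' < u \<longrightarrow> u < r' \<longrightarrow>
       (\<forall>y v. l < y \<longrightarrow> y < r \<longrightarrow> l' < v \<longrightarrow> v < r' \<longrightarrow> poly p y = 0 \<longrightarrow> poly q v = 0
          \<longrightarrow> (x < y \<longleftrightarrow> u < v) \<and> (y < x \<longleftrightarrow> v < u)) \<longrightarrow> same_sign (poly p x) (poly q u))"

definition good_gap ::
  "'a::linordered_field poly \<Rightarrow> 'b::linordered_field poly \<Rightarrow> 'a \<Rightarrow> 'b \<Rightarrow> 'a \<Rightarrow> 'b \<Rightarrow> bool" where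
  "good_gap p q l l' r r' \<longleftrightarrow>
     unique_root p l r \<and> unique_root q l' r' \<and> same_sign_on_gap p q l l' r r'"

lemma unique_rootD:
  "unique_root p l r \<Longrightarrow> l < x \<Longrightarrow> x < r \<Longrightarrow> poly p x = 0 \<Longrightarrow> l < y \<Longrightarrow> y < r \<Longrightarrow> poly p y = 0 \<Longrightarrow> x = y"
  unfolding unique_root_def by iprover

lemma same_sign_on_gapD:
  assumes "same_sign_on_gap p q l l' r r'" "l < x" "x < r" "l' < u" "u < r'"
    "\<And>y v. l < y \<Longrightarrow> y < r \<Longrightarrow> l' < v \<Longrightarrow> v < r' \<Longrightarrow> poly p y = 0 \<Longrightarrow> poly q v = 0
       \<Longrightarrow> (x < y \<longleftrightarrow> u < v) \<and> (y < x \<longleftrightarrow> v < u)"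
  shows "same_sign (poly p x) (poly q u)"
proof -
  have "\<forall>y v. l < y \<longrightarrow> y < r \<longrightarrow> l' < v \<longrightarrow> v < r' \<longrightarrow> poly p y = 0 \<longrightarrow> poly q v = 0
          \<longrightarrow> (x < y \<longleftrightarrow> u < v) \<and> (y < x \<longleftrightarrow> v < u)"
    by (intro allI impI) (rule assms(6))
  with assms(1)[unfolded same_sign_on_gap_def, THEN spec, THEN spec, of x u] assms(2-5)
  show ?thesis by iprover
qed

lemma good_gap_uminus: "good_gap (- p) (- q) l l' r r' \<Longrightarrow> good_gap p q l l' r r'"
  unfolding good_gap_def unique_root_def same_sign_on_gap_def
  by (simp only: poly_minus neg_equal_0_iff_equal same_sign_uminus_iff)

lemma good_gap_increasing:
  fixes p :: "'a::real_closed_field poly" and q :: "'b::real_closed_field poly"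
  assumes "l < r" "l' < r'"
    and p: "\<And>x. l < x \<Longrightarrow> x < r \<Longrightarrow> poly (pderiv p) x > 0"
    and q: "\<And>x. l' < x \<Longrightarrow> x < r' \<Longrightarrow> poly (pderiv q) x > 0"
    and s: "same_sign (poly p l) (poly q l')" "same_sign (poly p r) (poly q r')"
  shows "good_gap p q l l' r r'"
proof -
  note pm = poly_strict_mono_of_pderiv_pos[of l r p, OF p]
  note qm = poly_strict_mono_of_pderiv_pos[of l' r' q, OF q]
  have pr: "\<exists>x. l < x \<and> x < r \<and> poly p x = 0" if "poly p l < 0" "poly p r > 0"
    using poly_ivt_neg[OF assms(1), of p] that by (simp add: mult_less_0_iff)
  have qr: "\<exists>x. l' < x \<and> x < r' \<and> poly q x = 0" if "poly q l' < 0" "poly q r' > 0"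
    using poly_ivt_neg[OF assms(2), of q] that by (simp add: mult_less_0_iff)
  have a: "poly p l < 0 \<and> poly p r > 0" if "l < x" "x < r" "poly p x = 0" for x
    using pm[of l x] pm[of x r] that by auto
  have b: "poly q l' < 0 \<and> poly q r' > 0" if "l' < x" "x < r'" "poly q x = 0" for x
    using qm[of l' x] qm[of x r'] that by auto
  have 1: "\<exists>u. l' < u \<and> u < r' \<and> poly q u = 0" if "l < x" "x < r" "poly p x = 0" for x
    using a[OF that] qr s by (auto simp: same_sign_def)
  have 2: "\<exists>u. l < u \<and> u < r \<and> poly p u = 0" if "l' < x" "x < r'" "poly q x = 0" for x
    using b[OF that] pr s by (auto simp: same_sign_def)
  have 3: "same_sign (poly p x) (poly q u)"
    if x: "l < x" "x < r" and u: "l' < u" "u < r'"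
      and c: "\<And>y v. l < y \<Longrightarrow> y < r \<Longrightarrow> l' < v \<Longrightarrow> v < r' \<Longrightarrow> poly p y = 0 \<Longrightarrow> poly q v = 0
          \<Longrightarrow> (x < y \<longleftrightarrow> u < v) \<and> (y < x \<longleftrightarrow> v < u)" for x u
  proof (cases "\<exists>y. l < y \<and> y < r \<and> poly p y = 0")
    case True
    then obtain y where y: "l < y" "y < r" "poly p y = 0" by blast
    from 1[OF this] obtain v where v: "l' < v" "v < r'" "poly q v = 0" by blast
    have "(x < y \<longleftrightarrow> u < v) \<and> (y < x \<longleftrightarrow> v < u)" using c y v by blast
    moreover have "poly p x < 0 \<longleftrightarrow> x < y" "0 < poly p x \<longleftrightarrow> y < x"
      using pm[of x y] pm[of y x] x y by (metis less_asym linorder_neqE less_imp_le)+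
    moreover have "poly q u < 0 \<longleftrightarrow> u < v" "0 < poly q u \<longleftrightarrow> v < u"
      using qm[of u v] qm[of v u] u v by (metis less_asym linorder_neqE less_imp_le)+
    ultimately show ?thesis by (simp add: same_sign_def)
  next
    case False
    \<comment> \<open>Without a root inside, \<open>p\<close> is nonnegative at the left end or
      nonpositive at the right end, and strict monotonicity then decides its sign in
      between.\<close>
    then have "\<not> (poly p l < 0 \<and> poly p r > 0)" using pr by blast
    moreover have "\<not> (poly q l' < 0 \<and> poly q r' > 0)" using qr 2 False by blast
    moreover have "poly p l < poly p x" "poly p x < poly p r" "poly q l' < poly q u" "poly q u < poly q r'"
      using pm[of l x] pm[of x r] qm[of l' u] qm[of u r'] x u by auto
    ultimately show ?thesis using s unfolding same_sign_def by (auto simp: not_less)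
  qed
  have 4: "x = y" if "l < x" "x < r" "poly p x = 0" "l < y" "y < r" "poly p y = 0" for x y
    using pm[of x y] pm[of y x] that by (metis less_irrefl linorder_neqE less_imp_le)
  have 5: "x = y" if "l' < x" "x < r'" "poly q x = 0" "l' < y" "y < r'" "poly q y = 0" for x y
    using qm[of x y] qm[of y x] that by (metis less_irrefl linorder_neqE less_imp_le)
  have "unique_root p l r"
    unfolding unique_root_def by (intro allI impI) (rule 4)
  moreover have "unique_root q l' r'"
    unfolding unique_root_def by (intro allI impI) (rule 5)
  moreover have "same_sign_on_gap p q l l' r r'"
    unfolding same_sign_on_gap_def
  proof (intro allI impI)
    fix x u
    assume *: "l < x" "x < r" "l' < u" "u < r'"
      and "\<forall>y v. l < y \<longrightarrow> y < r \<longrightarrow> l' < v \<longrightarrow> v < r' \<longrightarrow> poly p y = 0 \<longrightarrow> poly q v = 0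
          \<longrightarrow> (x < y \<longleftrightarrow> u < v) \<and> (y < x \<longleftrightarrow> v < u)"
    then show "same_sign (poly p x) (poly q u)" by (intro 3[OF *]) iprover
  qed
  ultimately show ?thesis by (simp add: good_gap_def)
qed

text \<open>The derivative has constant sign on the gap because all its values are compared with one
  fixed value over the other field. Negative sign is reduced to positive sign by negation; if the
  derivative vanishes, both polynomials are constant.\<close>

lemma matching_good_gap:
  fixes p :: "'a::real_closed_field poly" and q :: "'b::real_closed_field poly"
  assumes lr: "l < r" "l' < r'"
    and d: "\<And>y v. l < y \<Longrightarrow> y < r \<Longrightarrow> l' < v \<Longrightarrow> v < r' \<Longrightarrow>
       same_sign (poly (pderiv p) y) (poly (pderiv q) v)"
    and p0: "p \<noteq> 0" and q0: "q \<noteq> 0"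
    and s: "same_sign (poly p l) (poly q l')" "same_sign (poly p r) (poly q r')"
  shows "good_gap p q l l' r r'"
proof -
  obtain m where m: "l < m" "m < r" using dense lr(1) by blast
  obtain m' where m': "l' < m'" "m' < r'" using dense lr(2) by blast
  have dp: "same_sign (poly (pderiv p) y) (poly (pderiv p) m)" if "l < y" "y < r" for y
    using d[OF that m'] d[OF m m'] by (auto simp: same_sign_def)
  have dq: "same_sign (poly (pderiv q) v) (poly (pderiv p) m)" if "l' < v" "v < r'" for v
    using d[OF m that] by (auto simp: same_sign_def)
  consider "poly (pderiv p) m > 0" | "poly (pderiv p) m < 0" | "poly (pderiv p) m = 0" by fastforce
  then show ?thesis
  proof cases
    case 1
    then show ?thesis using dp dq by (intro good_gap_increasing lr s) (auto simp: same_sign_def)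
  next
    case 2
    then have "good_gap (-p) (-q) l l' r r'" using dp dq s
      by (intro good_gap_increasing lr) (auto simp: same_sign_def pderiv_minus)
    then show ?thesis by (rule good_gap_uminus)
  next
    case 3
    then have "pderiv p = 0" "pderiv q = 0"
      using infinite_poly_zero[OF lr(1), of "pderiv p"] infinite_poly_zero[OF lr(2), of "pderiv q"]
        dp dq same_sign_eq_0 by blast+
    then have "degree p = 0" "degree q = 0" by (simp_all add: pderiv_eq_0_iff)
    then obtain a b where ab: "p = [:a:]" "q = [:b:]" by (meson degree_eq_zeroE)
    then show ?thesis using p0 q0 s(1)
      by (simp add: good_gap_def unique_root_def same_sign_on_gap_def)
  qed
qed

text \<open>
  On a gap of \<open>K\<close> the derivative has the same constant sign over both fields. So \<open>p\<close> and \<open>q\<close> are monotone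
  there, and whether they have a root is decided by their signs at the end points.
\<close>

lemma matching_step:
  fixes p :: "'a::real_closed_field poly" and q :: "'b::real_closed_field poly"
  assumes m: "matching K \<Psi>" and d: "(pderiv p, pderiv q) \<in> \<Psi>" and pq0: "p = 0 \<longleftrightarrow> q = 0"
    and s: "\<And>w w'. (w, w') \<in> K \<Longrightarrow> same_sign (poly p w) (poly q w')"
  shows "\<exists>K'. matching K' (insert (p, q) \<Psi>)"
proof (cases "p = 0")
  case True
  then show ?thesis using m pq0 unfolding matching_def by (auto simp: same_sign_def)
next
  case p0: False
  then have q0: "q \<noteq> 0" using pq0 by simp
  have K: "frame K" using m by (simp add: matching_def)
  \<comment> \<open>The new nodes are the compatible pairs of roots. Roots sitting at old nodes are
    among them, so the order comparison below has to treat these separately.\<close>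
  define N where "N = {(x, u). compat K x u \<and> -1 \<le> x \<and> x \<le> 1 \<and> poly p x = 0 \<and> poly q u = 0}"
  have gap: "\<exists>l l' r r'. (l, l') \<in> K \<and> (r, r') \<in> K \<and> l < x \<and> x < r \<and> l' < r' \<and>
      (\<forall>y v. l < y \<longrightarrow> y < r \<longrightarrow> l' < v \<longrightarrow> v < r' \<longrightarrow> compat K y v) \<and>
      (\<forall>y v. compat K y v \<longrightarrow> l < y \<longrightarrow> y < r \<longrightarrow> l' < v \<and> v < r') \<and> good_gap p q l l' r r'"
    if x: "-1 \<le> x" "x \<le> 1" "x \<notin> Domain K" for x
  proof -
    obtain l l' r r' where lr: "(l, l') \<in> K" "(r, r') \<in> K" "l < x" "x < r" "l' < r'"
      and c: "\<And>y v. l < y \<Longrightarrow> y < r \<Longrightarrow> l' < v \<Longrightarrow> v < r' \<Longrightarrow> compat K y v"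
      and c': "\<And>y v. compat K y v \<Longrightarrow> l < y \<Longrightarrow> y < r \<Longrightarrow> l' < v \<and> v < r'"
      by (rule frame_gap[OF K x]) blast
    have bd: "-1 \<le> l" "r \<le> 1" using lr K unfolding frame_def by auto
    have "good_gap p q l l' r r'"
    proof (rule matching_good_gap)
      fix y v assume yv: "l < y" "y < r" "l' < v" "v < r'"
      then show "same_sign (poly (pderiv p) y) (poly (pderiv q) v)"
        using m c[OF yv] bd d yv unfolding matching_def by auto
    qed (use lr s p0 q0 in auto)
    then show ?thesis using lr c c' by blast
  qed
  \<comment> \<open>New nodes in different gaps are ordered by the old nodes, and a single gap
    contains at most one root of each polynomial.\<close>
  have cNN: "(x < y \<longleftrightarrow> u < v) \<and> (y < x \<longleftrightarrow> v < u)" if "(x, u) \<in> N" "(y, v) \<in> N" for x u y v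
  proof (cases "x \<in> Domain K")
    case True
    then obtain x' where x': "(x, x') \<in> K" by blast
    then have "u = x'" using that(1) compat_eqD unfolding N_def by blast
    then show ?thesis using compatD[of K y v x x'] x' that(2) unfolding N_def by auto
  next
    case False
    have x: "-1 \<le> x" "x \<le> 1" "compat K x u" "poly p x = 0" "poly q u = 0"
      and y: "compat K y v" "poly p y = 0" "poly q v = 0" using that by (auto simp: N_def)
    obtain l l' r r' where lr: "(l, l') \<in> K" "(r, r') \<in> K" "l < x" "x < r"
      and c': "\<And>y v. compat K y v \<Longrightarrow> l < y \<Longrightarrow> y < r \<Longrightarrow> l' < v \<and> v < r'"
      and g: "good_gap p q l l' r r'"
      using gap[OF x(1,2) False] by blast
    have u: "l' < u" "u < r'" using c' x lr by auto
    consider "y \<le> l" | "r \<le> y" | "l < y" "y < r" by fastforce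
    then show ?thesis
    proof cases
      case 1
      then have "v \<le> l'" using compatD[OF y(1) lr(1)] by auto
      then show ?thesis using 1 u lr by auto
    next
      case 2
      then have "r' \<le> v" using compatD[OF y(1) lr(2)] by auto
      then show ?thesis using 2 u lr by auto
    next
      case 3
      then have v: "l' < v" "v < r'" using c' y by auto
      have "x = y" "u = v" 
        using unique_rootD[of p l r x y] unique_rootD[of q l' r' u v] g x y 3 u v lr
        by (auto simp: good_gap_def)
      then show ?thesis by simp
    qed
  qed
  have NK: "compat K x u" if "(x, u) \<in> N" for x u using that by (simp add: N_def)
  have cN: "compat (K \<union> N) x u" if "(x, u) \<in> N" for x u
    using NK[OF that] cNN[OF that] unfolding compat_def by auto
  have cK: "compat (K \<union> N) w w'" if w: "(w, w') \<in> K" for w w'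
    using frameD[OF K w] compatD[OF NK w] unfolding compat_def by auto
  have fin: "finite N"
  proof -
    have "N \<subseteq> {x. poly p x = 0} \<times> {u. poly q u = 0}" by (auto simp: N_def)
    then show ?thesis using poly_roots_finite[OF p0] poly_roots_finite[OF q0]
      by (meson finite_SigmaI finite_subset)
  qed
  have bN: "-1 \<le> x \<and> x \<le> 1 \<and> -1 \<le> u \<and> u \<le> 1" if "(x, u) \<in> N" for x u
    using that frame_compat_bounds[OF K NK[OF that]] by (auto simp: N_def)
  have frame': "frame (K \<union> N)"
    using K cN cK fin bN unfolding frame_def[of K] frame_def[of "K \<union> N"] by auto
  have "same_sign (poly p x) (poly q u)" if x: "-1 \<le> x" "x \<le> 1" and c: "compat (K \<union> N) x u" for x u
  proof (cases "x \<in> Domain K")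
    case True
    then obtain x' where x': "(x, x') \<in> K" by blast
    then have "u = x'" using compat_eqD[OF c] by blast
    then show ?thesis using s x' by simp
  next
    case False
    have cK': "compat K x u" using c unfolding compat_def by auto
    obtain l l' r r' where lr: "(l, l') \<in> K" "(r, r') \<in> K" "l < x" "x < r"
      and c1: "\<And>y v. l < y \<Longrightarrow> y < r \<Longrightarrow> l' < v \<Longrightarrow> v < r' \<Longrightarrow> compat K y v"
      and c': "\<And>y v. compat K y v \<Longrightarrow> l < y \<Longrightarrow> y < r \<Longrightarrow> l' < v \<and> v < r'"
      and g: "good_gap p q l l' r r'"
      using gap[OF x False] by blast
    have u: "l' < u" "u < r'" using c'[OF cK'] lr by auto
    have bd: "-1 \<le> l" "r \<le> 1" using lr K unfolding frame_def by auto
    have "(x < y \<longleftrightarrow> u < v) \<and> (y < x \<longleftrightarrow> v < u)"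
      if "l < y" "y < r" "l' < v" "v < r'" "poly p y = 0" "poly q v = 0" for y v
    proof -
      have "(y, v) \<in> N" using c1 that bd unfolding N_def by auto
      then show ?thesis using compatD[OF c] by blast
    qed
    then show ?thesis 
      using g by (intro same_sign_on_gapD[OF _ lr(3,4) u]) (auto simp: good_gap_def)
  qed
  moreover have "compat K x u" if "compat (K \<union> N) x u" for x u
    using that unfolding compat_def by auto
  moreover have "same_sign (poly f x) (poly g u)"
    if "(f, g) \<in> \<Psi>" "-1 \<le> x" "x \<le> 1" "compat K x u" for f g x u
    using m that unfolding matching_def by blast
  moreover have "f = 0 \<longleftrightarrow> g = 0" if "(f, g) \<in> \<Psi>" for f g
    using m that unfolding matching_def by blast
  ultimately have "matching (K \<union> N) (insert (p, q) \<Psi>)"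
    using frame' pq0 unfolding matching_def[of "K \<union> N"] by auto
  then show ?thesis by blast
qed

section \<open>Transfer of one variable\<close>

definition rhom :: "('a::idom \<Rightarrow> 'b::idom) \<Rightarrow> bool" where
  "rhom \<phi> \<longleftrightarrow> \<phi> 1 = 1 \<and> (\<forall>a b. \<phi> (a + b) = \<phi> a + \<phi> b) \<and> (\<forall>a b. \<phi> (a * b) = \<phi> a * \<phi> b)"

lemma rhom_simps:
  assumes "rhom \<phi>"
  shows "\<phi> 1 = 1" "\<phi> (a + b) = \<phi> a + \<phi> b" "\<phi> (a * b) = \<phi> a * \<phi> b"
    "\<phi> 0 = 0" "\<phi> (- a) = - \<phi> a" "\<phi> (a - b) = \<phi> a - \<phi> b" "\<phi> (a ^ n) = \<phi> a ^ n"
    "\<phi> (of_nat n) = of_nat n" "\<phi> (sum f A) = (\<Sum>x\<in>A. \<phi> (f x))" "\<phi> (prod f A) = (\<Prod>x\<in>A. \<phi> (f x))"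
proof -
  show 1: "\<phi> 1 = 1" and add: "\<phi> (a + b) = \<phi> a + \<phi> b" and mult: "\<phi> (a * b) = \<phi> a * \<phi> b" for a b
    using assms unfolding rhom_def by auto
  have "\<phi> 0 + \<phi> 0 = \<phi> 0 + 0" by (metis add add_0 add.right_neutral)
  then show zero: "\<phi> 0 = 0" by (rule add_left_imp_eq)
  show neg: "\<phi> (- a) = - \<phi> a" for a
    using add[of a "-a"] zero by (simp add: eq_neg_iff_add_eq_0 add.commute)
  show "\<phi> (a - b) = \<phi> a - \<phi> b" using add[of a "-b"] neg by simp
  show "\<phi> (a ^ n) = \<phi> a ^ n" by (induction n) (auto simp: 1 mult)
  show "\<phi> (of_nat n) = of_nat n" by (induction n) (auto simp: 1 add zero)
  show "\<phi> (sum f A) = (\<Sum>x\<in>A. \<phi> (f x))"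
    by (induction A rule: infinite_finite_induct) (auto simp: zero add)
  show "\<phi> (prod f A) = (\<Prod>x\<in>A. \<phi> (f x))"
    by (induction A rule: infinite_finite_induct) (auto simp: 1 mult)
qed

lemma poly_eq_sum_le:
  fixes p :: "'c::idom poly"
  assumes "degree p \<le> n" shows "poly p x = (\<Sum>i\<le>n. coeff p i * x ^ i)"
  unfolding poly_altdef using assms
  by (intro sum.mono_neutral_left) (auto simp: coeff_eq_0)

context
  fixes \<phi> :: "'a::idom \<Rightarrow> 'b::idom"
  assumes hom: "rhom \<phi>"
begin

lemma coeff_map_poly_rhom [simp]: "coeff (map_poly \<phi> p) i = \<phi> (coeff p i)"
  by (rule coeff_map_poly) (simp add: rhom_simps[OF hom])

lemma map_poly_rhom_add: "map_poly \<phi> (p + q) = map_poly \<phi> p + map_poly \<phi> q"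
  by (rule poly_eqI) (simp add: rhom_simps[OF hom])

lemma map_poly_rhom_mult: "map_poly \<phi> (p * q) = map_poly \<phi> p * map_poly \<phi> q"
  by (rule poly_eqI) (simp add: rhom_simps[OF hom] coeff_mult)

lemma map_poly_rhom_smult: "map_poly \<phi> (smult c p) = smult (\<phi> c) (map_poly \<phi> p)"
  by (rule poly_eqI) (simp add: rhom_simps[OF hom])

lemma map_poly_rhom_pderiv: "map_poly \<phi> (pderiv p) = pderiv (map_poly \<phi> p)"
proof (rule poly_eqI)
  fix i
  have "\<phi> (of_nat (Suc i) * coeff p (Suc i)) = of_nat (Suc i) * \<phi> (coeff p (Suc i))"
    by (simp only: rhom_simps[OF hom])
  then show "coeff (map_poly \<phi> (pderiv p)) i = coeff (pderiv (map_poly \<phi> p)) i"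
    by (simp add: coeff_pderiv)
qed

lemma degree_map_poly_rhom: "degree (map_poly \<phi> p) \<le> degree p"
  by (intro degree_le) (simp add: rhom_simps[OF hom] coeff_eq_0)

lemma poly_map_poly_rhom: "poly (map_poly \<phi> p) x = (\<Sum>i\<le>degree p. \<phi> (coeff p i) * x ^ i)"
  using poly_eq_sum_le[OF degree_map_poly_rhom[of p]] by simp

lemma poly_map_poly_rhom_apply: "poly (map_poly \<phi> p) (\<phi> x) = \<phi> (poly p x)"
  by (simp only: poly_map_poly_rhom poly_altdef[of p] rhom_simps[OF hom])

text \<open>The exponent is the degree before \<open>\<phi>\<close> is applied, since
  \<open>\<phi>\<close> may annihilate the leading coefficient. The identity carries points outside
  \<open>[-1, 1]\<close> into this interval.\<close>

lemma map_poly_rhom_reflect: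
  fixes x :: 'b
  assumes "x * y = 1"
  shows "poly (map_poly \<phi> (reflect_poly p)) x = x ^ degree p * poly (map_poly \<phi> p) y"
proof -
  have "poly (map_poly \<phi> (reflect_poly p)) x = (\<Sum>i\<le>degree p. \<phi> (coeff (reflect_poly p) i) * x ^ i)"
    using poly_eq_sum_le[of "map_poly \<phi> (reflect_poly p)" "degree p" x]
      order_trans[OF degree_map_poly_rhom degree_reflect_poly_le] by simp
  also have "\<dots> = (\<Sum>i\<le>degree p. \<phi> (coeff p (degree p - i)) * x ^ i)"
    by (intro sum.cong) (auto simp: coeff_reflect_poly)
  also have "\<dots> = (\<Sum>i\<le>degree p. \<phi> (coeff p i) * x ^ (degree p - i))"
    by (rule sum.reindex_bij_witness[of _ "\<lambda>i. degree p - i" "\<lambda>i. degree p - i"]) auto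
  also have "\<dots> = (\<Sum>i\<le>degree p. x ^ degree p * (\<phi> (coeff p i) * y ^ i))"
  proof (intro sum.cong refl)
    fix i assume "i \<in> {..degree p}"
    then have "x ^ degree p = x ^ (degree p - i) * x ^ i" by (simp flip: power_add)
    then show "\<phi> (coeff p i) * x ^ (degree p - i) = x ^ degree p * (\<phi> (coeff p i) * y ^ i)"
      using assms by (simp add: mult_ac flip: power_mult_distrib)
  qed
  finally show ?thesis by (simp add: poly_map_poly_rhom sum_distrib_left)
qed

end

lemma degree_pderiv_le: "degree (pderiv (p :: 'b::idom poly)) \<le> degree p - 1"
  by (intro degree_le) (auto simp: coeff_pderiv coeff_eq_0)

section \<open>Pseudo-division with coefficients in a subring\<close>

definition subring_set :: "'a::idom set \<Rightarrow> bool" where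
  "subring_set R \<longleftrightarrow> 0 \<in> R \<and> 1 \<in> R \<and> (\<forall>a\<in>R. \<forall>b\<in>R. a + b \<in> R \<and> a - b \<in> R \<and> a * b \<in> R)"

definition poly_over :: "'a::idom set \<Rightarrow> 'a poly set" where
  "poly_over R = {p. \<forall>i. coeff p i \<in> R}"

context
  fixes R :: "'a::idom set"
  assumes R: "subring_set R"
begin

lemma subring_sum: "(\<And>x. x \<in> A \<Longrightarrow> f x \<in> R) \<Longrightarrow> sum f A \<in> R"
  using R by (induction A rule: infinite_finite_induct) (auto simp: subring_set_def)

lemma subring_power: "x \<in> R \<Longrightarrow> x ^ n \<in> R"
  using R by (induction n) (auto simp: subring_set_def)

lemma subring_of_nat: "of_nat n \<in> R"
  using R by (induction n) (auto simp: subring_set_def)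

lemma poly_over_add: "p \<in> poly_over R \<Longrightarrow> q \<in> poly_over R \<Longrightarrow> p + q \<in> poly_over R"
  and poly_over_diff: "p \<in> poly_over R \<Longrightarrow> q \<in> poly_over R \<Longrightarrow> p - q \<in> poly_over R"
  and poly_over_smult: "c \<in> R \<Longrightarrow> q \<in> poly_over R \<Longrightarrow> smult c q \<in> poly_over R"
  and poly_over_monom: "c \<in> R \<Longrightarrow> monom c n \<in> poly_over R"
  using R by (auto simp: poly_over_def subring_set_def)

lemma poly_over_mult: "p \<in> poly_over R \<Longrightarrow> q \<in> poly_over R \<Longrightarrow> p * q \<in> poly_over R"
  using R by (auto simp: poly_over_def coeff_mult subring_set_def intro!: subring_sum)

lemma poly_over_pderiv: "p \<in> poly_over R \<Longrightarrow> pderiv p \<in> poly_over R"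
  using R subring_of_nat unfolding poly_over_def coeff_pderiv mem_Collect_eq subring_set_def by blast

lemma poly_over_cutoff: "p \<in> poly_over R \<Longrightarrow> poly_cutoff n p \<in> poly_over R"
  using R by (auto simp: poly_over_def coeff_poly_cutoff subring_set_def)

lemma poly_over_reflect: "p \<in> poly_over R \<Longrightarrow> reflect_poly p \<in> poly_over R"
  using R by (auto simp: poly_over_def coeff_reflect_poly subring_set_def)

lemma poly_over_eval: "p \<in> poly_over R \<Longrightarrow> x \<in> R \<Longrightarrow> poly p x \<in> R"
  using R unfolding poly_altdef
  by (intro subring_sum) (auto simp: poly_over_def subring_set_def subring_power)

text \<open>Each division step first multiplies by the leading coefficient of \<open>g\<close>, so
  the remainder keeps its coefficients in \<open>R\<close>. They are therefore still polynomials in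
  the remaining variables.\<close>

lemma poly_over_prem:
  assumes g: "g \<in> poly_over R" "degree g > 0" and p: "p \<in> poly_over R"
  shows "\<exists>r. r \<in> poly_over R \<and> degree r < degree g \<and> (\<exists>k s. smult (lead_coeff g ^ k) p = g * s + r)"
  using p
proof (induction "degree p" arbitrary: p rule: less_induct)
  case less
  show ?case
  proof (cases "degree p < degree g")
    case True
    then show ?thesis using less.prems by (intro exI[of _ p] conjI exI[of _ 0]) auto
  next
    case False
    let ?m = "monom (lead_coeff p) (degree p - degree g)"
    define p' where "p' = smult (lead_coeff g) p - g * ?m"
    have "degree (g * ?m) \<le> degree p"
      using degree_mult_le[of g ?m] degree_monom_le[of "lead_coeff p" "degree p - degree g"] False by linarith
    then have "degree p' \<le> degree p" unfolding p'_def
      by (meson degree_diff_le degree_smult_le)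
    moreover have "coeff p' (degree p) = 0"
    proof -
      have "coeff (?m * g) (degree p) = lead_coeff p * lead_coeff g"
        using False by (simp add: coeff_monom_mult)
      then show ?thesis unfolding p'_def mult.commute[of g ?m] by simp
    qed
    moreover have "degree p > 0" using False g by simp
    ultimately have "degree p' < degree p"
      by (metis le_neq_implies_less leading_coeff_0_iff degree_0)
    moreover have "p' \<in> poly_over R" unfolding p'_def
      using less.prems g by (intro poly_over_diff poly_over_smult poly_over_mult poly_over_monom) (auto simp: poly_over_def)
    ultimately obtain r k s where r: "r \<in> poly_over R" "degree r < degree g"
      "smult (lead_coeff g ^ k) p' = g * s + r" using less.hyps by blast
    have "smult (lead_coeff g ^ Suc k) p = smult (lead_coeff g ^ k) (p' + g * ?m)"
      by (simp add: p'_def mult.commute)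
    also have "\<dots> = g * (s + smult (lead_coeff g ^ k) ?m) + r"
      by (simp add: smult_add_right r(3) algebra_simps)
    finally show ?thesis using r by blast
  qed
qed

end

definition prem :: "'a::idom set \<Rightarrow> 'a poly \<Rightarrow> 'a poly \<Rightarrow> 'a poly" where
  "prem R p g = (SOME r. r \<in> poly_over R \<and> degree r < degree g \<and> (\<exists>k s. smult (lead_coeff g ^ k) p = g * s + r))"

lemma prem:
  assumes "subring_set R" "g \<in> poly_over R" "degree g > 0" "p \<in> poly_over R"
  shows "prem R p g \<in> poly_over R" "degree (prem R p g) < degree g"
    "\<exists>k s. smult (lead_coeff g ^ k) p = g * s + prem R p g"
  using someI_ex[OF poly_over_prem[OF assms]] unfolding prem_def by blast+

section \<open>Sign tables determined by the signs of finitely many coefficients\<close>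

definition map_pairs :: "('a \<Rightarrow> 's) \<Rightarrow> ('a \<Rightarrow> 't) \<Rightarrow> 'a::zero poly set \<Rightarrow> ('s::zero poly \<times> 't::zero poly) set" where
  "map_pairs \<phi> \<psi> \<Psi> = (\<lambda>p. (map_poly \<phi> p, map_poly \<psi> p)) ` \<Psi>"

text \<open>A semantic form of quantifier elimination. \<open>C\<close> is chosen before
  \<open>\<phi>\<close> and \<open>\<psi>\<close>, so one finite list of elements of
  \<open>R\<close> serves for all specialisations of the coefficients.\<close>

definition transferable ::
  "'a::idom set \<Rightarrow> ('s::real_closed_field \<times> 't::real_closed_field) itself \<Rightarrow> 'a poly set \<Rightarrow> bool" where
  "transferable R t \<Psi> \<longleftrightarrow> (\<exists>C. finite C \<and> C \<subseteq> R \<and> (\<forall>\<phi> \<psi>. rhom \<phi> \<longrightarrow> rhom \<psi> \<longrightarrow>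
     (\<forall>c\<in>C. same_sign (\<phi> c :: 's) (\<psi> c :: 't)) \<longrightarrow> (\<exists>K. matching K (map_pairs \<phi> \<psi> \<Psi>))))"

lemma transferable_mono:
  fixes t :: "('s::real_closed_field \<times> 't::real_closed_field) itself" and \<Psi> :: "'a::idom poly set"
  assumes "transferable R t \<Psi>" "\<Phi> \<subseteq> \<Psi>" shows "transferable R t \<Phi>"
proof -
  have sub: "map_pairs \<phi> \<psi> \<Phi> \<subseteq> map_pairs \<phi> \<psi> \<Psi>" for \<phi> :: "'a \<Rightarrow> 's" and \<psi> :: "'a \<Rightarrow> 't"
    using assms(2) unfolding map_pairs_def by blast
  have "\<exists>K. matching K (map_pairs \<phi> \<psi> \<Phi>)" if "\<exists>K. matching K (map_pairs \<phi> \<psi> \<Psi>)"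
    for \<phi> :: "'a \<Rightarrow> 's" and \<psi> :: "'a \<Rightarrow> 't"
    using that matching_restrict[OF _ sub] by blast
  moreover obtain C where C: "finite C" "C \<subseteq> R"
    and tr: "\<forall>\<phi> \<psi>. rhom \<phi> \<longrightarrow> rhom \<psi> \<longrightarrow>
     (\<forall>c\<in>C. same_sign (\<phi> c :: 's) (\<psi> c :: 't)) \<longrightarrow> (\<exists>K. matching K (map_pairs \<phi> \<psi> \<Psi>))"
    using assms(1) unfolding transferable_def by (elim exE conjE) (rule that)
  ultimately show ?thesis unfolding transferable_def by (intro exI[of _ C] conjI allI impI) (auto simp: tr[rule_format])
qed

lemma degree_rhom_eq:
  fixes \<phi> :: "'a::idom \<Rightarrow> 's::linordered_field" and \<psi> :: "'a \<Rightarrow> 't::linordered_field"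
  assumes "rhom \<phi>" "rhom \<psi>" "\<And>i. same_sign (\<phi> (coeff p i)) (\<psi> (coeff p i))"
  shows "degree (map_poly \<phi> p) = degree (map_poly \<psi> p)" "map_poly \<phi> p = 0 \<longleftrightarrow> map_poly \<psi> p = 0"
proof -
  have c: "coeff (map_poly \<phi> p) i = 0 \<longleftrightarrow> coeff (map_poly \<psi> p) i = 0" for i
    using same_sign_eq_0[OF assms(3)] assms by simp
  show "degree (map_poly \<phi> p) = degree (map_poly \<psi> p)"
    using c by (metis coeff_eq_0 degree_le leD leI le_degree leading_coeff_0_iff linorder_neqE_nat)
  show "map_poly \<phi> p = 0 \<longleftrightarrow> map_poly \<psi> p = 0"
    using c by (metis poly_eqI coeff_0)
qed

text \<open>At a root of \<open>g\<close> the identity \<open>c^k p = g s + r\<close> reduces the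
  sign of \<open>p\<close> to those of \<open>c\<close> and of the remainder \<open>r\<close>.
  Pseudo-division has to use the leading coefficient that survives the specialisation, hence the
  remainders by all truncations of \<open>g\<close>.\<close>

lemma same_sign_at_root:
  fixes \<phi> :: "'a::idom \<Rightarrow> 's::linordered_field" and \<psi> :: "'a \<Rightarrow> 't::linordered_field"
  assumes R: "subring_set R" and hom: "rhom \<phi>" "rhom \<psi>" and pg: "p \<in> poly_over R" "g \<in> poly_over R"
    and sg: "\<And>i. same_sign (\<phi> (coeff g i)) (\<psi> (coeff g i))"
    and g0: "map_poly \<phi> g \<noteq> 0"
    and w: "poly (map_poly \<phi> g) w = 0" "poly (map_poly \<psi> g) w' = 0"
    and r: "\<And>i. i \<le> degree g \<Longrightarrow> degree (poly_cutoff (Suc i) g) > 0 \<Longrightarrow>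
      same_sign (poly (map_poly \<phi> (prem R p (poly_cutoff (Suc i) g))) w)
                (poly (map_poly \<psi> (prem R p (poly_cutoff (Suc i) g))) w')"
  shows "same_sign (poly (map_poly \<phi> p) w) (poly (map_poly \<psi> p) w')"
proof -
  define e where "e = degree (map_poly \<phi> g)"
  have e': "e = degree (map_poly \<psi> g)" using degree_rhom_eq(1)[OF hom sg] e_def by simp
  \<comment> \<open>\<open>h\<close> has the same image as \<open>g\<close> under both
    homomorphisms, and its leading coefficient is not mapped to zero.\<close>
  define h where "h = poly_cutoff (Suc e) g"
  have h1: "map_poly \<phi> h = map_poly \<phi> g"
    using coeff_eq_0[of "map_poly \<phi> g"] hom(1)
    by (intro poly_eqI) (auto simp: h_def coeff_poly_cutoff e_def rhom_simps)
  have h2: "map_poly \<psi> h = map_poly \<psi> g"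
    using coeff_eq_0[of "map_poly \<psi> g"] hom(2)
    by (intro poly_eqI) (auto simp: h_def coeff_poly_cutoff e' rhom_simps)
  have lc: "\<phi> (coeff g e) \<noteq> 0"
    using g0 hom(1) unfolding e_def by (metis coeff_map_poly_rhom leading_coeff_0_iff)
  have ge0: "coeff g e \<noteq> 0" using lc rhom_simps(4)[OF hom(1)] by auto
  have ch: "coeff h i = (if i < Suc e then coeff g i else 0)" for i by (simp add: h_def coeff_poly_cutoff)
  have dh: "degree h = e"
    using ge0 by (intro antisym degree_le le_degree) (auto simp: ch)
  have e0: "e > 0"
  proof (rule ccontr)
    assume "\<not> e > 0"
    then obtain a where "map_poly \<phi> g = [:a:]" by (metis degree_eq_zeroE e_def gr0I)
    then show False using w g0 by simp
  qed
  have h: "h \<in> poly_over R" using pg R by (simp add: h_def poly_over_cutoff)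
  obtain k s where ks: "smult (lead_coeff h ^ k) p = h * s + prem R p h"
    using prem(3)[OF R h _ pg(1)] dh e0 by auto
  have lh: "lead_coeff h = coeff g e" using dh by (simp add: ch)
  have 1: "\<phi> (coeff g e) ^ k * poly (map_poly \<phi> p) w = poly (map_poly \<phi> (prem R p h)) w"
  proof -
    have "map_poly \<phi> (smult (lead_coeff h ^ k) p) = map_poly \<phi> (h * s + prem R p h)" using ks by simp
    then have "smult (\<phi> (coeff g e) ^ k) (map_poly \<phi> p) = map_poly \<phi> g * map_poly \<phi> s + map_poly \<phi> (prem R p h)"
      using hom(1) by (simp add: map_poly_rhom_smult map_poly_rhom_add map_poly_rhom_mult lh rhom_simps h1)
    then show ?thesis using w(1) by (metis add_0 mult_zero_left poly_add poly_mult poly_smult)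
  qed
  have 2: "\<psi> (coeff g e) ^ k * poly (map_poly \<psi> p) w' = poly (map_poly \<psi> (prem R p h)) w'"
  proof -
    have "map_poly \<psi> (smult (lead_coeff h ^ k) p) = map_poly \<psi> (h * s + prem R p h)" using ks by simp
    then have "smult (\<psi> (coeff g e) ^ k) (map_poly \<psi> p) = map_poly \<psi> g * map_poly \<psi> s + map_poly \<psi> (prem R p h)"
      using hom(2) by (simp add: map_poly_rhom_smult map_poly_rhom_add map_poly_rhom_mult lh rhom_simps h2)
    then show ?thesis using w(2) by (metis add_0 mult_zero_left poly_add poly_mult poly_smult)
  qed
  have "e \<le> degree g" using degree_map_poly_rhom[OF hom(1), of g] e_def by simp
  then have "same_sign (\<phi> (coeff g e) ^ k * poly (map_poly \<phi> p) w) (\<psi> (coeff g e) ^ k * poly (map_poly \<psi> p) w')"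
    unfolding 1 2 using r[of e] dh e0 by (simp add: h_def)
  then show ?thesis
    by (rule same_sign_cancel) (use sg lc in \<open>auto intro: same_sign_power\<close>)
qed

text \<open>The table of \<open>\<Phi>\<close> and of the remainders is restricted to the nodes
  coming from \<open>\<Phi>\<close>. At a node that is a root of some \<open>g\<close> in
  \<open>\<Phi>\<close> a remainder supplies the sign of \<open>p\<close>; at \<open>-1\<close> and
  \<open>1\<close> it is prescribed through \<open>D\<close>.\<close>

lemma transferable_step:
  fixes t :: "('s::real_closed_field \<times> 't::real_closed_field) itself" and p :: "'a::idom poly"
  assumes R: "subring_set R" and fin: "finite \<Phi>" and over: "insert p \<Phi> \<subseteq> poly_over R" and d: "pderiv p \<in> \<Phi>"
    and tr: "transferable R t (\<Phi> \<union> {prem R p (poly_cutoff (Suc i) g) |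
       g i. g \<in> \<Phi> \<and> i \<le> degree g \<and> degree (poly_cutoff (Suc i) g) > 0})" (is "transferable R t ?\<Psi>")
  shows "transferable R t (insert p \<Phi>)"
proof -
  obtain C where C: "finite C" "C \<subseteq> R"
    and tr: "\<forall>\<phi> \<psi>. rhom \<phi> \<longrightarrow> rhom \<psi> \<longrightarrow>
     (\<forall>c\<in>C. same_sign (\<phi> c :: 's) (\<psi> c :: 't)) \<longrightarrow> (\<exists>K. matching K (map_pairs \<phi> \<psi> ?\<Psi>))"
    using tr unfolding transferable_def by (elim exE conjE) (rule that)
  \<comment> \<open>The coefficients control degrees and vanishing after specialisation;
    \<open>0\<close> is included because coefficients beyond the degree are also looked up. The two
    values of \<open>p\<close> give the signs at the outer nodes.\<close>
  define D where "D = C \<union> {poly p 1, poly p (-1)} \<union> (\<Union>g\<in>insert p \<Phi>. set (coeffs g)) \<union> {0}"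
  have R': "0 \<in> R" "1 \<in> R" "0 - 1 \<in> R" using R unfolding subring_set_def by auto
  have "set (coeffs g) \<subseteq> R" if "g \<in> insert p \<Phi>" for g
  proof
    fix x assume "x \<in> set (coeffs g)"
    then have "x \<in> range (coeff g)" by (simp add: range_coeff)
    then show "x \<in> R" using over that by (auto simp: poly_over_def)
  qed
  moreover have "poly p 1 \<in> R" "poly p (-1) \<in> R" using over R' poly_over_eval[OF R, of p] by auto
  ultimately have D: "finite D" "D \<subseteq> R" using C fin R' unfolding D_def by auto
  have cD: "coeff g i \<in> D" if "g \<in> insert p \<Phi>" for g i
  proof -
    have "coeff g i \<in> insert 0 (set (coeffs g))" unfolding range_coeff[symmetric] by simp
    then show ?thesis using that unfolding D_def by blast
  qed
  show ?thesis unfolding transferable_def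
  proof (intro exI[of _ D] conjI D allI impI)
    fix \<phi> :: "'a \<Rightarrow> 's" and \<psi> :: "'a \<Rightarrow> 't"
    assume hom: "rhom \<phi>" "rhom \<psi>" and s: "\<forall>c\<in>D. same_sign (\<phi> c) (\<psi> c)"
    then obtain K where K: "matching K (map_pairs \<phi> \<psi> ?\<Psi>)" using tr[rule_format, OF hom] by (auto simp: D_def)
    have fK: "frame K" using K by (simp add: matching_def)
    define K' where "K' = {(w, w') \<in> K. w = -1 \<or> w = 1 \<or>
      (\<exists>p q. (p, q) \<in> map_pairs \<phi> \<psi> \<Phi> \<and> p \<noteq> 0 \<and> poly p w = 0)}"
    have sub: "map_pairs \<phi> \<psi> \<Phi> \<subseteq> map_pairs \<phi> \<psi> ?\<Psi>" unfolding map_pairs_def by blast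
    have K': "matching K' (map_pairs \<phi> \<psi> \<Phi>)"
      unfolding K'_def by (rule matching_restrict[OF K sub])
    have Kb: "compat K w w'" "-1 \<le> w" "w \<le> 1" if "(w, w') \<in> K" for w w'
      using that fK unfolding frame_def by auto
    have sK: "same_sign (poly (map_poly \<phi> g) w) (poly (map_poly \<psi> g) w')" if "g \<in> ?\<Psi>" "(w, w') \<in> K" for g w w'
    proof -
      have "(map_poly \<phi> g, map_poly \<psi> g) \<in> map_pairs \<phi> \<psi> ?\<Psi>" using that(1) unfolding map_pairs_def by blast
      then show ?thesis using K Kb[OF that(2)] unfolding matching_def by blast
    qed
    have "\<exists>K''. matching K'' (insert (map_poly \<phi> p, map_poly \<psi> p) (map_pairs \<phi> \<psi> \<Phi>))"
    proof (rule matching_step[OF K'])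
      show "(pderiv (map_poly \<phi> p), pderiv (map_poly \<psi> p)) \<in> map_pairs \<phi> \<psi> \<Phi>"
        using d hom unfolding map_pairs_def by (auto simp flip: map_poly_rhom_pderiv)
      show "map_poly \<phi> p = 0 \<longleftrightarrow> map_poly \<psi> p = 0"
        using degree_rhom_eq(2)[OF hom, of p] s cD by blast
      fix w w' assume w: "(w, w') \<in> K'"
      then have wK: "(w, w') \<in> K" by (simp add: K'_def)
      have pm: "same_sign (poly (map_poly \<phi> p) (\<phi> c)) (poly (map_poly \<psi> p) (\<psi> c))" if "c = 1 \<or> c = -1" for c
        using that s hom by (auto simp: poly_map_poly_rhom_apply D_def)
      consider "w = 1" | "w = -1" | g where "g \<in> \<Phi>" "map_poly \<phi> g \<noteq> 0" "poly (map_poly \<phi> g) w = 0"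
        using w by (auto simp: K'_def map_pairs_def)
      then show "same_sign (poly (map_poly \<phi> p) w) (poly (map_poly \<psi> p) w')"
      proof cases
        case 1
        then have "w' = 1" using compat_eqD[OF Kb(1)[OF wK]] fK by (auto simp: frame_def)
        then show ?thesis using 1 pm[of 1] hom by (simp add: rhom_simps)
      next
        case 2
        then have "w' = -1" using compat_eqD[OF Kb(1)[OF wK]] fK by (auto simp: frame_def)
        then show ?thesis using 2 pm[of "-1"] hom by (simp add: rhom_simps)
      next
        case 3
        have w0: "poly (map_poly \<psi> g) w' = 0"
          using sK[OF _ wK, of g] 3 same_sign_eq_0 by blast
        show ?thesis
        proof (rule same_sign_at_root[OF R hom _ _ _ 3(2,3)])
          show "poly (map_poly \<psi> g) w' = 0" by (rule w0)
          show "p \<in> poly_over R" "g \<in> poly_over R" using over 3(1) by auto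
          show "same_sign (\<phi> (coeff g i)) (\<psi> (coeff g i))" for i using s cD[of g] 3(1) by simp
          fix i assume "i \<le> degree g" "0 < degree (poly_cutoff (Suc i) g)"
          then show "same_sign (poly (map_poly \<phi> (prem R p (poly_cutoff (Suc i) g))) w)
                (poly (map_poly \<psi> (prem R p (poly_cutoff (Suc i) g))) w')"
            using 3(1) by (intro sK[OF _ wK] UnI2) blast
        qed
      qed
    qed
    moreover have "insert (map_poly \<phi> p, map_poly \<psi> p) (map_pairs \<phi> \<psi> \<Phi>) = map_pairs \<phi> \<psi> (insert p \<Phi>)"
      by (simp add: map_pairs_def)
    ultimately show "\<exists>K. matching K (map_pairs \<phi> \<psi> (insert p \<Phi>))" by simp
  qed
qed

lemma transferable_constants:
  fixes t :: "('s::real_closed_field \<times> 't::real_closed_field) itself"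
  assumes "finite \<Psi>" "\<Psi> \<subseteq> poly_over R" "\<And>p. p \<in> \<Psi> \<Longrightarrow> degree p = 0"
  shows "transferable R t \<Psi>"
  unfolding transferable_def
proof (intro exI[of _ "(\<lambda>p. coeff p 0) ` \<Psi>"] conjI allI impI)
  show "finite ((\<lambda>p. coeff p 0) ` \<Psi>)" "(\<lambda>p. coeff p 0) ` \<Psi> \<subseteq> R" using assms by (auto simp: poly_over_def)
  fix \<phi> :: "'a \<Rightarrow> 's" and \<psi> :: "'a \<Rightarrow> 't"
  assume hom: "rhom \<phi>" "rhom \<psi>" and s: "\<forall>c\<in>(\<lambda>p. coeff p 0) ` \<Psi>. same_sign (\<phi> c) (\<psi> c)"
  have "frame {(-1::'s, -1::'t), (1, 1)}" by (auto simp: frame_def compat_def)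
  moreover have "\<exists>c. p = [:\<phi> c:] \<and> q = [:\<psi> c:] \<and> same_sign (\<phi> c) (\<psi> c)"
    if pq: "(p, q) \<in> map_pairs \<phi> \<psi> \<Psi>" for p q
  proof -
    obtain f where f: "f \<in> \<Psi>" "p = map_poly \<phi> f" "q = map_poly \<psi> f" using pq by (auto simp: map_pairs_def)
    obtain c where c: "f = [:c:]" using assms(3)[OF f(1)] by (meson degree_eq_zeroE)
    have "map_poly \<phi> f = [:\<phi> c:]" "map_poly \<psi> f = [:\<psi> c:]"
      using hom by (auto simp: c poly_eq_iff coeff_pCons rhom_simps split: nat.split)
    then show ?thesis using f s c by force
  qed
  moreover from this have "(p = 0 \<longleftrightarrow> q = 0) \<and> same_sign (poly p x) (poly q u)"
    if "(p, q) \<in> map_pairs \<phi> \<psi> \<Psi>" for p q x u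
    using that same_sign_eq_0 by fastforce
  ultimately have "matching {(-1::'s, -1::'t), (1, 1)} (map_pairs \<phi> \<psi> \<Psi>)"
    unfolding matching_def by simp
  then show "\<exists>K. matching K (map_pairs \<phi> \<psi> \<Psi>)" by blast
qed

text \<open>Lexicographic induction on the maximal degree and the number of polynomials attaining
  it. A polynomial \<open>p\<close> of maximal degree is traded for its derivative and its
  remainders by truncations of the other polynomials, all of smaller degree.\<close>

lemma transferable:
  fixes t :: "('s::real_closed_field \<times> 't::real_closed_field) itself" and R :: "'a::idom set"
  assumes R: "subring_set R" and "finite \<Psi>" "\<Psi> \<subseteq> poly_over R"
  shows "transferable R t \<Psi>"
proof -
  have "\<forall>\<Psi>. finite \<Psi> \<longrightarrow> \<Psi> \<subseteq> poly_over R \<longrightarrow> (\<forall>p\<in>\<Psi>. degree p \<le> n) \<longrightarrow> transferable R t \<Psi>" for n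
  proof (induction n)
    case 0
    then show ?case by (auto intro: transferable_constants)
  next
    case (Suc n)
    have main: "\<forall>A. finite A \<longrightarrow> A \<subseteq> poly_over R \<longrightarrow> (\<forall>p\<in>A. degree p \<le> n) \<longrightarrow> B \<subseteq> poly_over R \<longrightarrow>
      (\<forall>p\<in>B. degree p = Suc n) \<longrightarrow> transferable R t (A \<union> B)" if "finite B" for B
      using that
    proof (induction B rule: finite_induct)
      case empty
      then show ?case using Suc by simp
    next
      case (insert p B)
      show ?case
      proof (intro allI impI)
        fix A assume A: "finite A" "A \<subseteq> poly_over R" "\<forall>p\<in>A. degree p \<le> n"
          and B: "insert p B \<subseteq> poly_over R" "\<forall>p\<in>insert p B. degree p = Suc n"
        define \<Phi> where "\<Phi> = insert (pderiv p) A \<union> B"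
        define E where "E = {prem R p (poly_cutoff (Suc i) g) |
          g i. g \<in> \<Phi> \<and> i \<le> degree g \<and> degree (poly_cutoff (Suc i) g) > 0}"
        have \<Phi>: "finite \<Phi>" "\<Phi> \<subseteq> poly_over R" "\<forall>g\<in>\<Phi>. degree g \<le> Suc n"
          using A B insert.hyps R degree_pderiv_le[of p] by (auto simp: \<Phi>_def poly_over_pderiv)
        have dE: "h \<in> poly_over R \<and> degree h \<le> n" if "h \<in> E" for h
        proof -
          obtain g i where g: "h = prem R p (poly_cutoff (Suc i) g)" "g \<in> \<Phi>" "i \<le> degree g"
            "degree (poly_cutoff (Suc i) g) > 0" using \<open>h \<in> E\<close> unfolding E_def by blast
          have "degree (poly_cutoff (Suc i) g) \<le> degree g"
            by (intro degree_le) (auto simp: coeff_poly_cutoff coeff_eq_0)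
          then have "degree (poly_cutoff (Suc i) g) \<le> Suc n" using \<Phi>(3) g(2) by force
          moreover have "poly_cutoff (Suc i) g \<in> poly_over R"
            using g \<Phi>(2) poly_over_cutoff[OF R] by blast
          ultimately show ?thesis using prem[OF R, of "poly_cutoff (Suc i) g" p] g B by auto
        qed
        have "E \<subseteq> (\<lambda>(g, i). prem R p (poly_cutoff (Suc i) g)) ` (SIGMA g:\<Phi>. {..degree g})"
          unfolding E_def by force
        then have finE: "finite E" using \<Phi>(1) by (meson finite_SigmaI finite_atMost finite_imageI finite_subset)
        have "degree (pderiv p) \<le> n" using B degree_pderiv_le[of p] by auto
        moreover have "pderiv p \<in> poly_over R" using B poly_over_pderiv[OF R] by simp
        ultimately have "transferable R t ((insert (pderiv p) A \<union> E) \<union> B)"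
          using A B dE finE by (intro insert.IH[rule_format]) auto
        then have "transferable R t (\<Phi> \<union> E)"
          by (rule transferable_mono) (auto simp: \<Phi>_def)
        then have "transferable R t (insert p \<Phi>)"
          unfolding E_def using \<Phi> B by (intro transferable_step[OF R]) (auto simp: \<Phi>_def)
        then show "transferable R t (A \<union> insert p B)"
          by (rule transferable_mono) (auto simp: \<Phi>_def)
      qed
    qed
    show ?case
    proof (intro allI impI)
      fix \<Psi> assume \<Psi>: "finite \<Psi>" "\<Psi> \<subseteq> poly_over R" "\<forall>p\<in>\<Psi>. degree p \<le> Suc n"
      have "\<Psi> = {p\<in>\<Psi>. degree p \<le> n} \<union> {p\<in>\<Psi>. degree p = Suc n}" using \<Psi>(3) by (auto simp: le_Suc_eq)
      moreover have "transferable R t ({p\<in>\<Psi>. degree p \<le> n} \<union> {p\<in>\<Psi>. degree p = Suc n})"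
        using \<Psi> by (intro main[rule_format]) auto
      ultimately show "transferable R t \<Psi>" by simp
    qed
  qed
  from this[of "Max (degree ` \<Psi>)"] show ?thesis using assms by simp
qed

lemma one_variable_transfer:
  fixes R :: "'a::idom set"
  assumes R: "subring_set R" and \<Psi>: "finite \<Psi>" "\<Psi> \<subseteq> poly_over R"
  shows "\<exists>C. finite C \<and> C \<subseteq> R \<and> (\<forall>\<phi> \<psi>. rhom \<phi> \<longrightarrow> rhom \<psi> \<longrightarrow>
     (\<forall>c\<in>C. same_sign (\<phi> c :: 's::real_closed_field) (\<psi> c :: 't::real_closed_field)) \<longrightarrow>
     (\<forall>x. \<exists>u. \<forall>p\<in>\<Psi>. same_sign (poly (map_poly \<phi> p) x) (poly (map_poly \<psi> p) u)))"
proof -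
  \<comment> \<open>Reflection multiplies values by a power of \<open>inverse x\<close>; the
    polynomial \<open>X\<close> is added so that the sign of this factor transfers as well.\<close>
  define \<Psi>' where "\<Psi>' = insert [:0, 1:] (\<Psi> \<union> reflect_poly ` \<Psi>)"
  have "[:0, 1:] = (monom 1 (Suc 0) :: 'a poly)" by (simp add: monom_Suc monom_0)
  moreover have "1 \<in> R" using R by (simp add: subring_set_def)
  ultimately have "[:0, 1:] \<in> poly_over R" using poly_over_monom[OF R] by simp
  then have "finite \<Psi>'" "\<Psi>' \<subseteq> poly_over R" using \<Psi> R poly_over_reflect by (auto simp: \<Psi>'_def)
  then have "transferable R (TYPE('s \<times> 't)) \<Psi>'" using transferable[OF R] by blast
  then obtain C where C: "finite C" "C \<subseteq> R"
    and tr: "\<forall>\<phi> \<psi>. rhom \<phi> \<longrightarrow> rhom \<psi> \<longrightarrow>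
     (\<forall>c\<in>C. same_sign (\<phi> c :: 's) (\<psi> c :: 't)) \<longrightarrow> (\<exists>K. matching K (map_pairs \<phi> \<psi> \<Psi>'))"
    unfolding transferable_def by (elim exE conjE) (rule that)
  show ?thesis
  proof (intro exI[of _ C] conjI C allI impI)
    fix \<phi> :: "'a \<Rightarrow> 's" and \<psi> :: "'a \<Rightarrow> 't" and x
    assume hom: "rhom \<phi>" "rhom \<psi>" and s: "\<forall>c\<in>C. same_sign (\<phi> c) (\<psi> c)"
    obtain K where K: "matching K (map_pairs \<phi> \<psi> \<Psi>')" using tr[rule_format, OF hom] s by blast
    have bounded: "\<exists>u. \<forall>p\<in>\<Psi>'. same_sign (poly (map_poly \<phi> p) y) (poly (map_poly \<psi> p) u)"
      if y: "-1 \<le> y" "y \<le> 1" for y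
    proof -
      have "frame K" using K by (simp add: matching_def)
      then obtain u where u: "compat K y u" using frame_extend[OF _ y] by blast
      have "same_sign (poly (map_poly \<phi> p) y) (poly (map_poly \<psi> p) u)" if "p \<in> \<Psi>'" for p
      proof -
        have "(map_poly \<phi> p, map_poly \<psi> p) \<in> map_pairs \<phi> \<psi> \<Psi>'" using that by (simp add: map_pairs_def)
        then show ?thesis using K y u by (simp add: matching_def)
      qed
      then show ?thesis by blast
    qed
    show "\<exists>u. \<forall>p\<in>\<Psi>. same_sign (poly (map_poly \<phi> p) x) (poly (map_poly \<psi> p) u)"
    proof (cases "-1 \<le> x \<and> x \<le> 1")
      case True
      then show ?thesis using bounded[of x] by (auto simp: \<Psi>'_def)
    next
      case False
      then have x0: "x \<noteq> 0" and "\<bar>x\<bar> \<ge> 1" by auto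
      then have "inverse \<bar>x\<bar> \<le> 1" by (simp add: inverse_le_1_iff)
      then have "-1 \<le> inverse x" "inverse x \<le> 1" by (auto simp flip: abs_inverse simp: abs_le_iff)
      then obtain u where u: "\<forall>p\<in>\<Psi>'. same_sign (poly (map_poly \<phi> p) (inverse x)) (poly (map_poly \<psi> p) u)"
        using bounded[of "inverse x"] by blast
      have "map_poly \<phi> [:0, 1:] = [:0, 1:]" "map_poly \<psi> [:0, 1:] = [:0, 1:]"
        using hom by (auto simp: poly_eq_iff coeff_pCons rhom_simps split: nat.split)
      then have su: "same_sign (inverse x) u" using u by (auto simp: \<Psi>'_def)
      then have u0: "u \<noteq> 0" using x0 same_sign_eq_0 by fastforce
      have "same_sign (poly (map_poly \<phi> p) x) (poly (map_poly \<psi> p) (inverse u))" if p: "p \<in> \<Psi>" for p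
      proof -
        have "same_sign (poly (map_poly \<phi> (reflect_poly p)) (inverse x)) (poly (map_poly \<psi> (reflect_poly p)) u)"
          using u p by (auto simp: \<Psi>'_def)
        then have "same_sign (inverse x ^ degree p * poly (map_poly \<phi> p) x)
            (u ^ degree p * poly (map_poly \<psi> p) (inverse u))"
          using map_poly_rhom_reflect[OF hom(1), of "inverse x" x p]
            map_poly_rhom_reflect[OF hom(2), of u "inverse u" p] x0 u0 by simp
        then show ?thesis by (rule same_sign_cancel) (use su x0 in \<open>auto intro: same_sign_power\<close>)
      qed
      then show ?thesis by blast
    qed
  qed
qed

section \<open>Evaluation of polynomials\<close>

definition monom_eval :: "('d::finite \<Rightarrow>\<^sub>0 nat) \<Rightarrow> real ^ 'd \<Rightarrow> real" where
  "monom_eval \<alpha> x = (\<Prod>i\<in>UNIV. (x $ i) ^ Poly_Mapping.lookup \<alpha> i)"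

lemma monom_eval_add: "monom_eval (\<alpha> + \<beta>) x = monom_eval \<alpha> x * monom_eval \<beta> x"
  by (simp add: monom_eval_def lookup_add power_add prod.distrib)

lemma peval_eq_sum:
  assumes "finite A" "Poly_Mapping.keys p \<subseteq> A"
  shows "peval p x = (\<Sum>\<alpha>\<in>A. Poly_Mapping.lookup p \<alpha> * monom_eval \<alpha> x)"
  unfolding peval_def monom_eval_def using assms
  by (intro sum.mono_neutral_left) (auto simp: in_keys_iff)

lemma peval_add: "peval (p + q) x = peval p x + peval q x"
proof -
  let ?A = "Poly_Mapping.keys p \<union> Poly_Mapping.keys q"
  have "Poly_Mapping.keys (p + q) \<subseteq> ?A" by (rule Poly_Mapping.keys_add)
  then show ?thesis
    using peval_eq_sum[of ?A "p + q" x] peval_eq_sum[of ?A p x] peval_eq_sum[of ?A q x]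
    by (simp add: lookup_add algebra_simps sum.distrib)
qed

lemma peval_single: "peval (Poly_Mapping.single \<alpha> c) x = c * monom_eval \<alpha> x"
  using peval_eq_sum[of "{\<alpha>}" "Poly_Mapping.single \<alpha> c" x] by simp

lemma peval_zero [simp]: "peval 0 x = 0"
  by (simp add: peval_def)

lemma peval_pconst [simp]: "peval (pconst c) x = c"
  by (simp add: pconst_def peval_single monom_eval_def)

lemma pconst_one: "pconst 1 = 1"
  by (simp add: pconst_def)

lemma peval_one [simp]: "peval 1 x = 1"
  using peval_pconst[of 1 x] by (simp only: pconst_one)

lemma peval_sum: "peval (sum f A) x = (\<Sum>a\<in>A. peval (f a) x)"
  by (induction A rule: infinite_finite_induct) (auto simp: peval_add)

lemma poly_mapping_sum_single:
  "p = (\<Sum>k\<in>Poly_Mapping.keys p. Poly_Mapping.single k (Poly_Mapping.lookup p k))"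
  by (rule poly_mapping_eqI) (simp add: lookup_sum lookup_single when_def in_keys_iff)

lemma peval_mult: "peval (p * q) x = peval p x * peval q x"
proof -
  let ?l = Poly_Mapping.lookup
  have "p * q = (\<Sum>k\<in>Poly_Mapping.keys p. \<Sum>l\<in>Poly_Mapping.keys q.
      Poly_Mapping.single k (?l p k) * Poly_Mapping.single l (?l q l))"
    by (subst (1) poly_mapping_sum_single[of p], subst (1) poly_mapping_sum_single[of q]) (rule sum_product)
  then show ?thesis
    by (simp add: peval_sum mult_single peval_single monom_eval_add
        peval_eq_sum[OF finite_keys order_refl, of p] peval_eq_sum[OF finite_keys order_refl, of q]
        sum_product mult_ac)
qed

lemma peval_uminus [simp]: "peval (- p) x = - peval p x"
  using peval_add[of p "-p" x] by simp

lemma peval_diff [simp]: "peval (p - q) x = peval p x - peval q x"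
  using peval_add[of p "-q" x] by simp

lemma peval_power [simp]: "peval (p ^ n) x = peval p x ^ n"
  by (induction n) (auto simp: peval_mult)

lemmas peval_simps [simp] = peval_add peval_mult peval_sum

lemma continuous_on_peval [continuous_intros]: "continuous_on A (peval p)"
  unfolding peval_def by (intro continuous_intros)

text \<open>Two distinct exponents get equal weight only on a hyperplane, and finitely many
  hyperplanes form a negligible set.\<close>

lemma exists_separating_weight:
  assumes "finite (A :: ('d::finite \<Rightarrow>\<^sub>0 nat) set)"
  shows "\<exists>v::real ^ 'd. inj_on (\<lambda>\<alpha>. \<Sum>i\<in>UNIV. v $ i * real (Poly_Mapping.lookup \<alpha> i)) A"
proof -
  define D where "D \<alpha> \<beta> = (\<chi> i. real (Poly_Mapping.lookup \<alpha> i) - real (Poly_Mapping.lookup \<beta> i) :: real ^ 'd)" for \<alpha> \<beta>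
  define \<N> where "\<N> = (\<lambda>(\<alpha>, \<beta>). {v. D \<alpha> \<beta> \<bullet> v = 0}) ` {(\<alpha>, \<beta>) \<in> A \<times> A. \<alpha> \<noteq> \<beta>}"
  have "D \<alpha> \<beta> \<noteq> 0" if "\<alpha> \<noteq> \<beta>" for \<alpha> \<beta>
  proof
    assume "D \<alpha> \<beta> = 0"
    then have "\<alpha> = \<beta>" by (intro poly_mapping_eqI) (simp add: D_def vec_eq_iff)
    with that show False by simp
  qed
  then have "negligible {v. D \<alpha> \<beta> \<bullet> v = 0}" if "\<alpha> \<noteq> \<beta>" for \<alpha> \<beta>
    using that by (intro negligible_hyperplane) simp
  then have "negligible N" if "N \<in> \<N>" for N
    using that by (auto simp: \<N>_def)
  moreover have "finite \<N>"
  proof -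
    have "{(\<alpha>, \<beta>) \<in> A \<times> A. \<alpha> \<noteq> \<beta>} \<subseteq> A \<times> A" by blast
    then show ?thesis using assms unfolding \<N>_def by (meson finite_SigmaI finite_imageI finite_subset)
  qed
  ultimately have "negligible (\<Union>\<N>)" by (rule negligible_Union[rotated])
  then have "\<Union>\<N> \<noteq> UNIV" using non_negligible_UNIV by metis
  then obtain v where v: "v \<notin> \<Union>\<N>" by blast
  have "inj_on (\<lambda>\<alpha>. \<Sum>i\<in>UNIV. v $ i * real (Poly_Mapping.lookup \<alpha> i)) A"
  proof (rule inj_onI, rule ccontr)
    fix \<alpha> \<beta> assume *: "\<alpha> \<in> A" "\<beta> \<in> A" "\<alpha> \<noteq> \<beta>"
      "(\<Sum>i\<in>UNIV. v $ i * real (Poly_Mapping.lookup \<alpha> i)) = (\<Sum>i\<in>UNIV. v $ i * real (Poly_Mapping.lookup \<beta> i))"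
    moreover have "D \<alpha> \<beta> \<bullet> v = (\<Sum>i\<in>UNIV. v $ i * real (Poly_Mapping.lookup \<alpha> i))
        - (\<Sum>i\<in>UNIV. v $ i * real (Poly_Mapping.lookup \<beta> i))"
      by (simp add: D_def inner_vec_def sum_subtractf left_diff_distrib mult.commute[of "v $ _"])
    ultimately have "D \<alpha> \<beta> \<bullet> v = 0" by simp
    then show False using v * unfolding \<N>_def by blast
  qed
  then show ?thesis by blast
qed

text \<open>Along the curve \<open>x\<^sub>i = exp (v\<^sub>i t)\<close> with generic \<open>v\<close> a single monomial dominates.\<close>

lemma eventually_peval_nonzero:
  fixes p :: "('d::finite) rpoly"
  assumes p: "p \<noteq> 0" and inj: "inj_on (\<lambda>\<alpha>. \<Sum>i\<in>UNIV. v $ i * real (Poly_Mapping.lookup \<alpha> i)) (Poly_Mapping.keys p)"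
  shows "\<forall>\<^sub>F t in at_top. peval p (\<chi> i. exp (t * v $ i)) \<noteq> 0"
proof -
  define w where "w = (\<lambda>\<alpha>. \<Sum>i\<in>UNIV. v $ i * real (Poly_Mapping.lookup \<alpha> i))"
  let ?K = "Poly_Mapping.keys p" and ?l = "Poly_Mapping.lookup p"
  have fin: "finite (w ` ?K)" and ne: "w ` ?K \<noteq> {}" using p by auto
  then obtain \<beta> where \<beta>: "\<beta> \<in> ?K" "w \<beta> = Max (w ` ?K)" using Max_in[OF fin ne] by (metis imageE)
  have lt: "w \<alpha> < w \<beta>" if "\<alpha> \<in> ?K" "\<alpha> \<noteq> \<beta>" for \<alpha>
  proof -
    have "w \<alpha> \<le> w \<beta>" using that \<beta> fin by simp
    moreover have "w \<alpha> \<noteq> w \<beta>" using inj that \<beta>(1) unfolding w_def inj_on_def by blast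
    ultimately show ?thesis by simp
  qed
  have ev: "monom_eval \<alpha> (\<chi> i. exp (t * v $ i)) = exp (t * w \<alpha>)" for \<alpha> t
    by (simp add: monom_eval_def w_def sum_distrib_left exp_sum flip: exp_of_nat_mult)
       (simp add: mult_ac)
  have "((\<lambda>t. \<Sum>\<alpha>\<in>?K. ?l \<alpha> * exp (t * (w \<alpha> - w \<beta>))) \<longlongrightarrow> (\<Sum>\<alpha>\<in>?K. ?l \<alpha> * (if \<alpha> = \<beta> then 1 else 0))) at_top"
  proof (intro tendsto_sum tendsto_mult tendsto_const)
    fix \<alpha> assume a: "\<alpha> \<in> ?K"
    show "((\<lambda>t. exp (t * (w \<alpha> - w \<beta>))) \<longlongrightarrow> (if \<alpha> = \<beta> then 1 else 0)) at_top"
    proof (cases "\<alpha> = \<beta>")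
      case False
      then have "filterlim (\<lambda>t. t * (w \<alpha> - w \<beta>)) at_bot at_top"
        using lt[OF a] filterlim_tendsto_neg_mult_at_bot[OF tendsto_const[of "w \<alpha> - w \<beta>"] _ filterlim_ident]
        by (simp add: mult.commute)
      then have "((\<lambda>t. exp (t * (w \<alpha> - w \<beta>))) \<longlongrightarrow> 0) at_top"
        by (rule filterlim_compose[OF exp_at_bot])
      then show ?thesis using False by simp
    qed simp
  qed
  moreover have "(\<Sum>\<alpha>\<in>?K. ?l \<alpha> * (if \<alpha> = \<beta> then 1 else 0)) = ?l \<beta>"
    using \<beta> by (simp add: if_distrib sum.delta cong: if_cong)
  ultimately have lim: "((\<lambda>t. \<Sum>\<alpha>\<in>?K. ?l \<alpha> * exp (t * (w \<alpha> - w \<beta>))) \<longlongrightarrow> ?l \<beta>) at_top" by simp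
  have "?l \<beta> \<noteq> 0" using \<beta> by (simp add: in_keys_iff)
  from tendsto_imp_eventually_ne[OF lim this]
  show ?thesis
  proof eventually_elim
    case (elim t)
    have "peval p (\<chi> i. exp (t * v $ i)) = exp (t * w \<beta>) * (\<Sum>\<alpha>\<in>?K. ?l \<alpha> * exp (t * (w \<alpha> - w \<beta>)))"
      by (simp add: peval_eq_sum[OF finite_keys order_refl, of p] ev sum_distrib_left algebra_simps flip: exp_add)
    then show ?case using elim by simp
  qed
qed

text \<open>A weight that separates the exponents of both factors gives one curve along which both
  are eventually non-zero, so their product has a non-zero value.\<close>

lemma rpoly_no_zero_divisors:
  fixes p q :: "('d::finite) rpoly"
  assumes "p \<noteq> 0" "q \<noteq> 0" shows "p * q \<noteq> 0"
proof -
  obtain v where v: "inj_on (\<lambda>\<alpha>. \<Sum>i\<in>UNIV. (v::real^'d) $ i * real (Poly_Mapping.lookup \<alpha> i))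
      (Poly_Mapping.keys p \<union> Poly_Mapping.keys q)"
    using exists_separating_weight[of "Poly_Mapping.keys p \<union> Poly_Mapping.keys q"] by auto
  have "\<forall>\<^sub>F t in at_top. peval p (\<chi> i. exp (t * v $ i)) \<noteq> 0 \<and> peval q (\<chi> i. exp (t * v $ i)) \<noteq> 0"
    using assms by (intro eventually_conj eventually_peval_nonzero inj_on_subset[OF v]) auto
  then obtain t :: real where "peval p (\<chi> i. exp (t * v $ i)) \<noteq> 0" "peval q (\<chi> i. exp (t * v $ i)) \<noteq> 0"
    using eventually_happens'[OF trivial_limit_at_top_linorder] by blast
  then have "peval (p * q) (\<chi> i. exp (t * v $ i)) \<noteq> 0" by simp
  then show ?thesis by (metis peval_zero)
qed

lemma peval_nonzero_ex:
  fixes p :: "('d::finite) rpoly"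
  assumes "p \<noteq> 0" shows "\<exists>x. peval p x \<noteq> 0"
proof -
  obtain v where "inj_on (\<lambda>\<alpha>. \<Sum>i\<in>UNIV. (v::real^'d) $ i * real (Poly_Mapping.lookup \<alpha> i)) (Poly_Mapping.keys p)"
    using exists_separating_weight[of "Poly_Mapping.keys p"] by auto
  from eventually_peval_nonzero[OF assms this] show ?thesis
    using eventually_happens'[OF trivial_limit_at_top_linorder] by blast
qed

text \<open>
  A copy of the polynomial ring, because the library makes \<^typ>\<open>'a \<Rightarrow>\<^sub>0 real\<close> an integral domain only for
  linearly ordered exponents, and \<open>'d\<close> carries no order.
\<close>

typedef (overloaded) 'd rp = "UNIV :: ('d::finite) rpoly set"
  morphisms rpoly_of Rp by auto

setup_lifting type_definition_rp

instantiation rp :: (finite) idom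
begin
lift_definition zero_rp :: "'a rp" is 0 .
lift_definition one_rp :: "'a rp" is 1 .
lift_definition plus_rp :: "'a rp \<Rightarrow> 'a rp \<Rightarrow> 'a rp" is "(+)" .
lift_definition minus_rp :: "'a rp \<Rightarrow> 'a rp \<Rightarrow> 'a rp" is "(-)" .
lift_definition uminus_rp :: "'a rp \<Rightarrow> 'a rp" is uminus .
lift_definition times_rp :: "'a rp \<Rightarrow> 'a rp \<Rightarrow> 'a rp" is "(*)" .
instance
  by standard (transfer; simp add: algebra_simps rpoly_no_zero_divisors)+
end

lemma rpoly_of_hom [simp]:
  "rpoly_of 0 = 0" "rpoly_of 1 = 1" "rpoly_of (p + q) = rpoly_of p + rpoly_of q"
  "rpoly_of (p - q) = rpoly_of p - rpoly_of q" "rpoly_of (- p) = - rpoly_of p"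
  "rpoly_of (p * q) = rpoly_of p * rpoly_of q"
  by (transfer; simp)+

lemma Rp_hom:
  "Rp 0 = 0" "Rp 1 = 1" "Rp (p + q) = Rp p + Rp q" "Rp (p - q) = Rp p - Rp q" "Rp (- p) = - Rp p"
  "Rp (p * q) = Rp p * Rp q"
  by (simp_all flip: rpoly_of_inject add: Rp_inverse)

section \<open>Maximal cones in an algebraically closed field\<close>

text \<open>\<open>T\<close> is meant to be the nonnegative part of an ordered subfield. In an
  algebraically closed field \<open>-1\<close> is a square, so only squares of differences of
  elements of \<open>T\<close> can be required.\<close>

definition proper_cone :: "'c::field set \<Rightarrow> bool" where
  "proper_cone T \<longleftrightarrow> 1 \<in> T \<and> -1 \<notin> T \<and> (\<forall>a\<in>T. \<forall>b\<in>T. a + b \<in> T \<and> a * b \<in> T \<and> (a - b)\<^sup>2 \<in> T)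
     \<and> (\<forall>a\<in>T. inverse a \<in> T)"

definition maximal_cone :: "'c::field set \<Rightarrow> bool" where
  "maximal_cone T \<longleftrightarrow> proper_cone T \<and> (\<forall>T'. proper_cone T' \<longrightarrow> T \<subseteq> T' \<longrightarrow> T' = T)"

lemma exists_maximal_cone:
  assumes "proper_cone T0"
  shows "\<exists>T. maximal_cone T \<and> T0 \<subseteq> T"
proof -
  define A where "A = {T. proper_cone T \<and> T0 \<subseteq> T}"
  have "\<exists>M\<in>A. \<forall>X\<in>A. M \<subseteq> X \<longrightarrow> X = M"
  proof (rule subset_Zorn_nonempty)
    show "A \<noteq> {}" using assms by (auto simp: A_def)
    fix C assume C: "C \<noteq> {}" "subset.chain A C"
    have sub: "proper_cone T" "T0 \<subseteq> T" if "T \<in> C" for T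
      using C(2) that unfolding subset.chain_def A_def by auto
    have two: "\<exists>T\<in>C. a \<in> T \<and> b \<in> T" if ab: "a \<in> \<Union>C" "b \<in> \<Union>C" for a b
    proof -
      obtain S T where "S \<in> C" "a \<in> S" "T \<in> C" "b \<in> T" using ab by blast
      moreover have "S \<subseteq> T \<or> T \<subseteq> S"
        using C(2) \<open>S \<in> C\<close> \<open>T \<in> C\<close> unfolding subset.chain_def by blast
      ultimately show ?thesis by blast
    qed
    have "proper_cone (\<Union>C)" unfolding proper_cone_def
    proof (intro conjI ballI)
      show "1 \<in> \<Union>C" using C(1) sub unfolding proper_cone_def by blast
      show "- 1 \<notin> \<Union>C" using sub unfolding proper_cone_def by blast
    next
      fix a b assume "a \<in> \<Union>C" "b \<in> \<Union>C"
      then obtain T where T: "T \<in> C" "a \<in> T" "b \<in> T" using two by blast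
      then have "a + b \<in> T" "a * b \<in> T" "(a - b)\<^sup>2 \<in> T" using sub(1)[OF T(1)] unfolding proper_cone_def by auto
      then show "a + b \<in> \<Union>C" "a * b \<in> \<Union>C" "(a - b)\<^sup>2 \<in> \<Union>C" using T(1) by auto
    next
      fix a assume "a \<in> \<Union>C"
      then show "inverse a \<in> \<Union>C" using sub(1) unfolding proper_cone_def by blast
    qed
    then show "\<Union>C \<in> A" using C(1) sub(2) unfolding A_def by blast
  qed
  then obtain M where M: "M \<in> A" "\<And>X. X \<in> A \<Longrightarrow> M \<subseteq> X \<Longrightarrow> X = M" by auto
  then have "maximal_cone M" unfolding maximal_cone_def A_def by auto
  then show ?thesis using M(1) by (auto simp: A_def)
qed

definition cone_field :: "'c::field set \<Rightarrow> 'c set" where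
  "cone_field T = {x. x \<in> T \<or> - x \<in> T}"

context
  fixes T :: "'c::field set"
  assumes T: "proper_cone T"
begin

lemma cone_one: "1 \<in> T"
  and cone_neg_one: "-1 \<notin> T"
  and cone_add: "a \<in> T \<Longrightarrow> b \<in> T \<Longrightarrow> a + b \<in> T"
  and cone_mult: "a \<in> T \<Longrightarrow> b \<in> T \<Longrightarrow> a * b \<in> T"
  and cone_diff_square: "a \<in> T \<Longrightarrow> b \<in> T \<Longrightarrow> (a - b)\<^sup>2 \<in> T"
  and cone_inverse: "a \<in> T \<Longrightarrow> inverse a \<in> T"
  using T unfolding proper_cone_def by blast+

lemma cone_zero: "0 \<in> T"
  using cone_diff_square[OF cone_one cone_one] by simp

lemma cone_antisym:
  assumes "a \<in> T" "- a \<in> T" shows "a = 0"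
proof (rule ccontr)
  assume "a \<noteq> 0"
  then have "- a * inverse a = -1" by simp
  then show False using cone_mult[OF assms(2) cone_inverse[OF assms(1)]] cone_neg_one by simp
qed

lemma cone_of_nat: "of_nat n \<in> T"
  by (induction n) (auto intro: cone_zero cone_one cone_add)

lemma cone_two_neq_zero: "(2::'c) \<noteq> 0"
proof
  assume "(2::'c) = 0"
  then have "(1::'c) + 1 = 0" by simp
  then have "-1 = (1::'c)" by (metis eq_neg_iff_add_eq_0)
  then show False using cone_one cone_neg_one by metis
qed

end

text \<open>For \<open>s\<close> equal to \<open>a - b\<close> or \<open>b - a\<close>, the set
  \<open>T + s T\<close> satisfies every cone condition except possibly that \<open>-1\<close> is
  absent. By maximality \<open>s\<close> is already in \<open>T\<close> unless \<open>-1\<close>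
  appears, and its appearance for both signs would give \<open>-1\<close> in
  \<open>T\<close>.\<close>

lemma maximal_cone_total:
  fixes T :: "'c::field set"
  assumes m: "maximal_cone T" and ab: "a \<in> T" "b \<in> T"
  shows "a - b \<in> cone_field T"
proof -
  have T: "proper_cone T" using m by (simp add: maximal_cone_def)
  note ops = cone_add[OF T] cone_mult[OF T] cone_diff_square[OF T] cone_inverse[OF T] cone_one[OF T] cone_zero[OF T]
  define E where "E s = {x + s * y | x y. x \<in> T \<and> y \<in> T}" for s
  have proper: "proper_cone (E s)" if s: "s = a - b \<or> s = b - a" and n: "-1 \<notin> E s" for s
  proof -
    have s2: "s\<^sup>2 \<in> T" using s ops ab by auto
    have mult: "u * v \<in> E s" if uv: "u \<in> E s" "v \<in> E s" for u v
    proof -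
      obtain x y where u: "u = x + s * y" "x \<in> T" "y \<in> T" using uv unfolding E_def by blast
      obtain z w where v: "v = z + s * w" "z \<in> T" "w \<in> T" using uv unfolding E_def by blast
      have "u * v = (x * z + s\<^sup>2 * (y * w)) + s * (x * w + y * z)"
        unfolding u v by (simp add: algebra_simps power2_eq_square)
      moreover have "x * z + s\<^sup>2 * (y * w) \<in> T" "x * w + y * z \<in> T" using u v s2 by (auto intro!: ops)
      ultimately show ?thesis unfolding E_def by blast
    qed
    have sub: "T \<subseteq> E s" unfolding E_def using ops by force
    \<comment> \<open>Adjoining \<open>s\<close> creates no new differences, so all squares still
      lie in \<open>T\<close>; this also yields inverses, as \<open>1/u = u / u^2\<close>.\<close>
    have diff: "\<exists>p\<in>T. \<exists>q\<in>T. u - v = p - q" if uv: "u \<in> E s" "v \<in> E s" for u v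
    proof -
      obtain x y where u: "u = x + s * y" "x \<in> T" "y \<in> T" using uv unfolding E_def by blast
      obtain z w where v: "v = z + s * w" "z \<in> T" "w \<in> T" using uv unfolding E_def by blast
      obtain p q where pq: "s = p - q" "p \<in> T" "q \<in> T" using s ab by blast
      have "u - v = (x + p * y + q * w) - (z + q * y + p * w)"
        unfolding u v pq by (simp add: algebra_simps)
      moreover have "x + p * y + q * w \<in> T" "z + q * y + p * w \<in> T" using u v pq by (auto intro!: ops)
      ultimately show ?thesis by blast
    qed
    have sq: "(u - v)\<^sup>2 \<in> T" if "u \<in> E s" "v \<in> E s" for u v
      using diff[OF that] ops by auto
    have add: "u + v \<in> E s" if uv: "u \<in> E s" "v \<in> E s" for u v
    proof -
      obtain x y where u: "u = x + s * y" "x \<in> T" "y \<in> T" using uv unfolding E_def by blast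
      obtain z w where v: "v = z + s * w" "z \<in> T" "w \<in> T" using uv unfolding E_def by blast
      have "u + v = (x + z) + s * (y + w)" unfolding u v by (simp add: algebra_simps)
      then show ?thesis using u v ops unfolding E_def by blast
    qed
    have einv: "inverse u \<in> E s" if u: "u \<in> E s" for u
    proof -
      have "0 \<in> E s" using sub ops by auto
      then have "inverse (u\<^sup>2) \<in> T" using sq[OF u] ops by (metis diff_zero)
      then have "u * inverse (u\<^sup>2) \<in> E s" using mult u sub by blast
      moreover have "u * inverse (u\<^sup>2) = inverse u" by (cases "u = 0") (auto simp: power2_eq_square)
      ultimately show ?thesis by simp
    qed
    have "1 \<in> E s" using sub ops by blast
    then show ?thesis unfolding proper_cone_def
      using n add mult einv sq sub by (intro conjI ballI) (auto dest: subsetD)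
  qed
  have mem: "s \<in> T" if s: "s = a - b \<or> s = b - a" and n: "-1 \<notin> E s" for s
  proof -
    have "T \<subseteq> E s" unfolding E_def using ops by force
    then have "E s = T" using proper[OF s n] m unfolding maximal_cone_def by blast
    moreover have "s = 0 + s * 1" by simp
    ultimately show ?thesis using ops unfolding E_def by blast
  qed
  show ?thesis
  proof (cases "-1 \<in> E (a - b) \<and> -1 \<in> E (b - a)")
    case False
    then show ?thesis using mem[of "a - b"] mem[of "b - a"] by (auto simp: cone_field_def)
  next
    case True
    then obtain x y z w where x: "-1 = x + (a - b) * y" "x \<in> T" "y \<in> T" "-1 = z + (b - a) * w" "z \<in> T" "w \<in> T"
      unfolding E_def by blast
    have "1 + x = - ((a - b) * y)" "1 + z = - ((b - a) * w)"
      using x(1,4) by (auto simp: algebra_simps eq_neg_iff_add_eq_0)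
    \<comment> \<open>The right-hand side is \<open>-(a - b)^2 y w\<close>, so expanding writes
      \<open>-1\<close> as a sum of elements of \<open>T\<close>.\<close>
    then have "(1 + x) * (1 + z) = - ((a - b) * y) * - ((b - a) * w)" by simp
    then have "-1 = x + z + x * z + (a - b)\<^sup>2 * (y * w)"
      by (simp add: algebra_simps power2_eq_square eq_neg_iff_add_eq_0)
    moreover have "x + z + x * z + (a - b)\<^sup>2 * (y * w) \<in> T" using x ab by (intro ops)
    ultimately have "-1 \<in> T" by simp
    then show ?thesis using cone_neg_one[OF T] by blast
  qed
qed

text \<open>Maximality enters through sums of elements of opposite sign, which are differences of
  elements of \<open>T\<close>.\<close>

lemma
  fixes T :: "'c::field set"
  assumes m: "maximal_cone T"
  shows cone_field_add: "x \<in> cone_field T \<Longrightarrow> y \<in> cone_field T \<Longrightarrow> x + y \<in> cone_field T"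
    and cone_field_uminus: "x \<in> cone_field T \<Longrightarrow> - x \<in> cone_field T"
    and cone_field_diff: "x \<in> cone_field T \<Longrightarrow> y \<in> cone_field T \<Longrightarrow> x - y \<in> cone_field T"
    and cone_field_mult: "x \<in> cone_field T \<Longrightarrow> y \<in> cone_field T \<Longrightarrow> x * y \<in> cone_field T"
    and cone_field_inverse: "x \<in> cone_field T \<Longrightarrow> inverse x \<in> cone_field T"
    and cone_field_divide: "x \<in> cone_field T \<Longrightarrow> y \<in> cone_field T \<Longrightarrow> x / y \<in> cone_field T"
proof -
  have T: "proper_cone T" using m by (simp add: maximal_cone_def)
  note ops = cone_add[OF T] cone_mult[OF T] cone_inverse[OF T]
  show neg: "- x \<in> cone_field T" if "x \<in> cone_field T" for x
    using that by (auto simp: cone_field_def)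
  show add: "x + y \<in> cone_field T" if xy: "x \<in> cone_field T" "y \<in> cone_field T" for x y
  proof -
    consider "x \<in> T" "y \<in> T" | "x \<in> T" "- y \<in> T" | "- x \<in> T" "y \<in> T" | "- x \<in> T" "- y \<in> T"
      using xy by (auto simp: cone_field_def)
    then show ?thesis
    proof cases
      case 1 then show ?thesis using ops by (auto simp: cone_field_def)
    next
      case 2 then show ?thesis using maximal_cone_total[OF m, of x "-y"] by simp
    next
      case 3 then show ?thesis using maximal_cone_total[OF m, of y "-x"] by (simp add: add.commute)
    next
      case 4
      then have "- (x + y) \<in> T" using ops(1)[of "-x" "-y"] by simp
      then show ?thesis by (simp add: cone_field_def)
    qed
  qed
  show "x - y \<in> cone_field T" if xy: "x \<in> cone_field T" "y \<in> cone_field T" for x y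
    using add[of x "-y"] neg xy by simp
  show mult: "x * y \<in> cone_field T" if xy: "x \<in> cone_field T" "y \<in> cone_field T" for x y
    using xy ops(2)[of x y] ops(2)[of "-x" y] ops(2)[of x "-y"] ops(2)[of "-x" "-y"]
    by (auto simp: cone_field_def)
  show inv: "inverse x \<in> cone_field T" if "x \<in> cone_field T" for x
    using that ops(3)[of x] ops(3)[of "-x"] by (auto simp: cone_field_def)
  show "x / y \<in> cone_field T" if xy: "x \<in> cone_field T" "y \<in> cone_field T" for x y
    using mult[OF xy(1) inv[OF xy(2)]] by (simp add: divide_inverse)
qed

section \<open>Cones in the algebraic closure of the rational function field\<close>

type_synonym 'd clos = "'d rp fract alg_closure"

definition emb :: "('d::finite) rp \<Rightarrow> 'd clos" where
  "emb p = to_ac (Fract p 1)"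

lemma rhom_emb: "rhom emb"
proof -
  have "Fract (a + b) 1 = Fract a 1 + Fract b 1" "Fract (a * b) 1 = Fract a 1 * Fract b 1"
    for a b :: "'a rp" by simp_all
  then show ?thesis unfolding rhom_def emb_def by (metis One_fract_def to_ac_1 to_ac_add to_ac_mult)
qed

lemmas emb_simps = rhom_simps[OF rhom_emb]

lemma emb_eq_iff: "emb p = emb q \<longleftrightarrow> p = q"
  by (simp add: emb_def eq_fract)

lemma emb_eq_0_iff: "emb p = 0 \<longleftrightarrow> p = 0"
  using emb_eq_iff[of p 0] by (simp add: emb_simps)

text \<open>Square denominators do not affect signs, so these fractions are nonnegative in every
  ordering in which \<open>P\<close> is.\<close>

definition fraction_cone :: "('d::finite) rp set \<Rightarrow> 'd clos set" where
  "fraction_cone P = {emb p / (emb q)\<^sup>2 | p q. p \<in> P \<and> q \<noteq> 0}"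

lemma fraction_coneI: "p \<in> P \<Longrightarrow> q \<noteq> 0 \<Longrightarrow> x * (emb q)\<^sup>2 = emb p \<Longrightarrow> x \<in> fraction_cone P"
  unfolding fraction_cone_def
  by (rule CollectI, rule exI[of _ p], rule exI[of _ q]) (auto simp: emb_eq_0_iff field_simps)

lemma fraction_coneE:
  assumes "x \<in> fraction_cone P"
  obtains p q where "p \<in> P" "q \<noteq> 0" "x * (emb q)\<^sup>2 = emb p"
  using assms unfolding fraction_cone_def by (auto simp: emb_eq_0_iff)

text \<open>The condition on \<open>- (p\<^sup>2)\<close> says exactly that \<open>-1\<close> is not
  one of these fractions.\<close>

lemma proper_fraction_cone:
  assumes add: "\<And>p q. p \<in> P \<Longrightarrow> q \<in> P \<Longrightarrow> p + q \<in> P"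
    and mult: "\<And>p q. p \<in> P \<Longrightarrow> q \<in> P \<Longrightarrow> p * q \<in> P"
    and sq: "\<And>p. p\<^sup>2 \<in> P" and proper: "\<And>p. - (p\<^sup>2) \<in> P \<Longrightarrow> p = 0"
  shows "proper_cone (fraction_cone P)"
  unfolding proper_cone_def
proof (intro conjI ballI)
  show "1 \<in> fraction_cone P"
    using sq[of 1] by (intro fraction_coneI[of 1 _ 1]) (auto simp: emb_simps)
  show "-1 \<notin> fraction_cone P"
  proof
    assume "-1 \<in> fraction_cone P"
    then obtain p q where pq: "p \<in> P" "q \<noteq> 0" "-1 * (emb q)\<^sup>2 = emb p" by (rule fraction_coneE)
    then have "emb (- (q\<^sup>2)) = emb p" by (simp add: emb_simps)
    then have "- (q\<^sup>2) = p" by (simp add: emb_eq_iff)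
    then show False using proper pq by blast
  qed
next
  fix a b assume "a \<in> fraction_cone P" "b \<in> fraction_cone P"
  then obtain p q r s where a: "p \<in> P" "q \<noteq> 0" "a * (emb q)\<^sup>2 = emb p"
    and b: "r \<in> P" "s \<noteq> 0" "b * (emb s)\<^sup>2 = emb r" by (meson fraction_coneE)
  have e: "emb (p * s\<^sup>2) = a * (emb (q * s))\<^sup>2" "emb (r * q\<^sup>2) = b * (emb (q * s))\<^sup>2"
    by (simp_all add: emb_simps a(3)[symmetric] b(3)[symmetric] power_mult_distrib)
  show "a + b \<in> fraction_cone P"
  proof (rule fraction_coneI)
    show "p * s\<^sup>2 + r * q\<^sup>2 \<in> P" using a b by (intro add mult sq)
    show "q * s \<noteq> 0" using a b by simp
    show "(a + b) * (emb (q * s))\<^sup>2 = emb (p * s\<^sup>2 + r * q\<^sup>2)"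
      unfolding emb_simps(2) e by (simp add: distrib_right)
  qed
  show "a * b \<in> fraction_cone P"
  proof (rule fraction_coneI)
    show "p * r \<in> P" using a b by (intro mult)
    show "q * s \<noteq> 0" using a b by simp
    show "(a * b) * (emb (q * s))\<^sup>2 = emb (p * r)"
      by (simp add: emb_simps a(3)[symmetric] b(3)[symmetric] power_mult_distrib mult_ac)
  qed
  show "(a - b)\<^sup>2 \<in> fraction_cone P"
  proof (rule fraction_coneI)
    show "(p * s\<^sup>2 - r * q\<^sup>2)\<^sup>2 \<in> P" by (rule sq)
    show "(q * s)\<^sup>2 \<noteq> 0" using a b by simp
    have "emb (p * s\<^sup>2 - r * q\<^sup>2) = (a - b) * (emb (q * s))\<^sup>2"
      unfolding emb_simps(6) e by (simp add: left_diff_distrib)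
    then show "(a - b)\<^sup>2 * (emb ((q * s)\<^sup>2))\<^sup>2 = emb ((p * s\<^sup>2 - r * q\<^sup>2)\<^sup>2)"
      unfolding emb_simps(7) by (simp add: power_mult_distrib)
  qed
next
  fix a assume "a \<in> fraction_cone P"
  then obtain p q where a: "p \<in> P" "q \<noteq> 0" "a * (emb q)\<^sup>2 = emb p" by (meson fraction_coneE)
  show "inverse a \<in> fraction_cone P"
  proof (cases "p = 0")
    case True
    then have "a = 0" using a by (simp add: emb_simps emb_eq_0_iff)
    then show ?thesis using sq[of 0] by (intro fraction_coneI[of 0 _ 1]) (auto simp: emb_simps)
  next
    case False
    show ?thesis
    proof (rule fraction_coneI)
      \<comment> \<open>The inverse of \<open>p / q^2\<close> is rewritten as
        \<open>q^2 p / p^2\<close>, whose denominator is again a square.\<close>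
      show "q\<^sup>2 * p \<in> P" using a sq mult by blast
      show "p \<noteq> 0" by (rule False)
      have "a \<noteq> 0" using a False by (auto simp: emb_eq_0_iff)
      then show "inverse a * (emb p)\<^sup>2 = emb (q\<^sup>2 * p)"
        by (simp add: emb_simps a(3)[symmetric] power2_eq_square field_simps)
    qed
  qed
qed

lemma emb_in_fraction_cone: "p \<in> P \<Longrightarrow> emb p \<in> fraction_cone P"
  by (rule fraction_coneI[of p _ 1]) (auto simp: emb_simps)

text \<open>The squares ensure that the ordered subfield contains all polynomials, because
  \<open>4 p = (p + 1)^2 - (p - 1)^2\<close>.\<close>

definition admissible :: "('d::finite) clos set \<Rightarrow> bool" where
  "admissible T \<longleftrightarrow> maximal_cone T \<and> (\<forall>p. (emb p)\<^sup>2 \<in> T)"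

lemma exists_admissible:
  assumes add: "\<And>p q. p \<in> P \<Longrightarrow> q \<in> P \<Longrightarrow> p + q \<in> P"
    and mult: "\<And>p q. p \<in> P \<Longrightarrow> q \<in> P \<Longrightarrow> p * q \<in> P"
    and sq: "\<And>p. p\<^sup>2 \<in> P" and proper: "\<And>p. - (p\<^sup>2) \<in> P \<Longrightarrow> p = 0"
  shows "\<exists>T. admissible T \<and> emb ` P \<subseteq> T"
proof -
  obtain T where T: "maximal_cone T" "fraction_cone P \<subseteq> T"
    using exists_maximal_cone[OF proper_fraction_cone[OF assms]] by blast
  have "emb ` P \<subseteq> T" using emb_in_fraction_cone T by blast
  moreover have "(emb p)\<^sup>2 \<in> T" for p
  proof -
    have "emb (p\<^sup>2) \<in> T" using calculation sq by blast
    then show ?thesis by (simp only: emb_simps)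
  qed
  ultimately show ?thesis using T unfolding admissible_def by blast
qed

lemma emb_in_cone_field:
  assumes "admissible T" shows "emb p \<in> cone_field T"
proof -
  have m: "maximal_cone T" and T: "proper_cone T" using assms by (auto simp: admissible_def maximal_cone_def)
  have "(emb (p + 1))\<^sup>2 - (emb (p - 1))\<^sup>2 \<in> cone_field T"
    using assms by (intro maximal_cone_total[OF m]) (auto simp: admissible_def)
  moreover have "(emb (p + 1))\<^sup>2 - (emb (p - 1))\<^sup>2 = 4 * emb p"
    by (simp add: emb_simps power2_eq_square algebra_simps)
  moreover have "inverse (of_nat 4) \<in> cone_field T"
    using cone_inverse[OF T cone_of_nat[OF T, of 4]] by (simp add: cone_field_def)
  ultimately have "inverse (of_nat 4) * (4 * emb p) \<in> cone_field T"
    using cone_field_mult[OF m] by metis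
  moreover have "(4::'a clos) \<noteq> 0"
  proof -
    have "(4::'a clos) = 2 * 2" by simp
    then show ?thesis using cone_two_neq_zero[OF T] by (metis mult_eq_0_iff)
  qed
  ultimately show ?thesis by simp
qed

text \<open>The two equivalences together say that \<open>c\<close> has the same sign in the
  ordering as at the real point \<open>a\<close>.\<close>

definition realised :: "('d::finite) clos set \<Rightarrow> 'd rp set \<Rightarrow> bool" where
  "realised T C \<longleftrightarrow> (\<exists>a. \<forall>c\<in>C. (emb c \<in> T \<longleftrightarrow> 0 \<le> peval (rpoly_of c) a) \<and> (- emb c \<in> T \<longleftrightarrow> peval (rpoly_of c) a \<le> 0))"

text \<open>A type cannot depend on a cone that is only fixed inside a proof. This cone fails to be
  realised by points whenever some admissible cone does, so it suffices to treat it.\<close>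

definition the_cone :: "('d::finite) clos set" where
  "the_cone = (SOME T. admissible T \<and>
     ((\<exists>T' C. admissible (T' :: 'd clos set) \<and> finite C \<and> \<not> realised T' C) \<longrightarrow> (\<exists>C. finite C \<and> \<not> realised T C)))"

lemma the_cone:
  fixes T' :: "('d::finite) clos set"
  shows "admissible (the_cone :: 'd clos set)"
    and "admissible T' \<Longrightarrow> finite C \<Longrightarrow> \<not> realised T' C \<Longrightarrow> \<exists>C. finite C \<and> \<not> realised (the_cone :: 'd clos set) C"
proof -
  let ?Q = "\<lambda>T :: 'd clos set. admissible T \<and>
     ((\<exists>T' C. admissible (T' :: 'd clos set) \<and> finite C \<and> \<not> realised T' C) \<longrightarrow> (\<exists>C. finite C \<and> \<not> realised T C))"
  \<comment> \<open>The choice needs at least one admissible cone; the polynomials that are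
    nonnegative on the whole space generate one.\<close>
  define P :: "'d rp set" where "P = {p. \<forall>x. 0 \<le> peval (rpoly_of p) x}"
  have sq: "rpoly_of (p\<^sup>2) = (rpoly_of p)\<^sup>2" for p :: "'d rp" by (simp add: power2_eq_square)
  have "\<exists>T. admissible T \<and> emb ` P \<subseteq> T"
  proof (rule exists_admissible)
    fix p :: "'d rp" assume "- (p\<^sup>2) \<in> P"
    then have "\<forall>x. peval (rpoly_of p) x = 0" by (simp add: P_def sq)
    then have "rpoly_of p = 0" using peval_nonzero_ex by blast
    then show "p = 0" by (metis rpoly_of_hom(1) rpoly_of_inject)
  qed (auto simp: P_def sq)
  then have "\<exists>T. ?Q T" by meson
  then have Q: "?Q the_cone" unfolding the_cone_def by (rule someI_ex)
  from Q show "admissible (the_cone :: 'd clos set)" by (rule conjunct1)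
  assume "admissible T'" "finite C" "\<not> realised T' C"
  then have "\<exists>T' C. admissible (T' :: 'd clos set) \<and> finite C \<and> \<not> realised T' C" by blast
  then show "\<exists>C. finite C \<and> \<not> realised (the_cone :: 'd clos set) C"
    by (rule Q[THEN conjunct2, THEN mp])
qed

lemma maximal_the_cone: "maximal_cone the_cone" and proper_the_cone: "proper_cone the_cone"
  using the_cone(1) by (auto simp: admissible_def maximal_cone_def)

typedef (overloaded) 'd rcl = "cone_field (the_cone :: ('d::finite) clos set)"
  by (rule exI[of _ 0]) (simp add: cone_field_def cone_zero[OF proper_the_cone])

setup_lifting type_definition_rcl

instantiation rcl :: (finite) field
begin
lift_definition zero_rcl :: "'a rcl" is 0
  by (simp add: cone_field_def cone_zero[OF proper_the_cone])
lift_definition one_rcl :: "'a rcl" is 1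
  by (simp add: cone_field_def cone_one[OF proper_the_cone])
lift_definition plus_rcl :: "'a rcl \<Rightarrow> 'a rcl \<Rightarrow> 'a rcl" is "(+)"
  by (rule cone_field_add[OF maximal_the_cone])
lift_definition minus_rcl :: "'a rcl \<Rightarrow> 'a rcl \<Rightarrow> 'a rcl" is "(-)"
  by (rule cone_field_diff[OF maximal_the_cone])
lift_definition uminus_rcl :: "'a rcl \<Rightarrow> 'a rcl" is uminus
  by (rule cone_field_uminus[OF maximal_the_cone])
lift_definition times_rcl :: "'a rcl \<Rightarrow> 'a rcl \<Rightarrow> 'a rcl" is "(*)"
  by (rule cone_field_mult[OF maximal_the_cone])
lift_definition divide_rcl :: "'a rcl \<Rightarrow> 'a rcl \<Rightarrow> 'a rcl" is "(/)"
  by (rule cone_field_divide[OF maximal_the_cone])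
lift_definition inverse_rcl :: "'a rcl \<Rightarrow> 'a rcl" is inverse
  by (rule cone_field_inverse[OF maximal_the_cone])
instance
proof
  fix a b c :: "'a rcl"
  show "a * b * c = a * (b * c)" by transfer (rule mult.assoc)
  show "a * b = b * a" by transfer (rule mult.commute)
  show "1 * a = a" by transfer (rule mult_1)
  show "a + b + c = a + (b + c)" by transfer (rule add.assoc)
  show "a + b = b + a" by transfer (rule add.commute)
  show "0 + a = a" by transfer (rule add_0)
  show "- a + a = 0" by transfer (rule left_minus)
  show "a - b = a + - b" by transfer (rule diff_conv_add_uminus)
  show "(a + b) * c = a * c + b * c" by transfer (rule distrib_right)
  show "(0 :: 'a rcl) \<noteq> 1" by transfer (rule zero_neq_one)
  show "a \<noteq> 0 \<Longrightarrow> inverse a * a = 1" by transfer (rule left_inverse)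
  show "a div b = a * inverse b" by transfer (rule divide_inverse)
  show "inverse (0 :: 'a rcl) = 0" by transfer (rule inverse_zero)
qed
end

instantiation rcl :: (finite) linordered_field
begin
lift_definition less_eq_rcl :: "'a rcl \<Rightarrow> 'a rcl \<Rightarrow> bool" is "\<lambda>x y. y - x \<in> the_cone" .
definition less_rcl :: "'a rcl \<Rightarrow> 'a rcl \<Rightarrow> bool" where "less_rcl x y \<longleftrightarrow> x \<le> y \<and> x \<noteq> y"
definition abs_rcl :: "'a rcl \<Rightarrow> 'a rcl" where "abs_rcl x = (if x < 0 then - x else x)"
definition sgn_rcl :: "'a rcl \<Rightarrow> 'a rcl" where "sgn_rcl x = (if x = 0 then 0 else if 0 < x then 1 else -1)"
instance
proof
  fix x y z :: "'a rcl"
  show refl: "x \<le> x" by transfer (simp add: cone_zero[OF proper_the_cone])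
  show "x \<le> y \<Longrightarrow> y \<le> z \<Longrightarrow> x \<le> z"
  proof transfer
    fix x y z :: "'a clos" assume "y - x \<in> the_cone" "z - y \<in> the_cone"
    then have "(y - x) + (z - y) \<in> the_cone" by (rule cone_add[OF proper_the_cone])
    then show "z - x \<in> the_cone" by simp
  qed
  have anti: "x = y" if "x \<le> y" "y \<le> x" for x y :: "'a rcl"
    using that
  proof transfer
    fix x y :: "'a clos" assume "y - x \<in> the_cone" "x - y \<in> the_cone"
    then have "y - x = 0" using cone_antisym[OF proper_the_cone, of "y - x"] by simp
    then show "x = y" by simp
  qed
  then show "x \<le> y \<Longrightarrow> y \<le> x \<Longrightarrow> x = y" .
  show "x < y \<longleftrightarrow> x \<le> y \<and> \<not> y \<le> x" unfolding less_rcl_def using anti refl by blast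
  show "x \<le> y \<or> y \<le> x"
  proof transfer
    fix x y :: "'a clos" assume "x \<in> cone_field the_cone" "y \<in> cone_field the_cone"
    then have "y - x \<in> cone_field the_cone" by (intro cone_field_diff[OF maximal_the_cone])
    then show "y - x \<in> the_cone \<or> x - y \<in> the_cone" by (simp add: cone_field_def)
  qed
  show "x \<le> y \<Longrightarrow> z + x \<le> z + y" by transfer simp
  have mult: "0 \<le> x * y" if "0 \<le> x" "0 \<le> y" for x y :: "'a rcl"
    using that by transfer (simp add: cone_mult[OF proper_the_cone])
  show "x < y \<Longrightarrow> 0 < z \<Longrightarrow> z * x < z * y"
  proof -
    assume *: "x < y" "0 < z"
    have "0 \<le> y - x" using *(1) unfolding less_rcl_def by transfer simp
    then have "0 \<le> z * (y - x)" using mult * by (simp add: less_rcl_def)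
    then have "z * x \<le> z * y" by transfer (simp add: right_diff_distrib)
    moreover have "z * x \<noteq> z * y" using * by (auto simp: less_rcl_def)
    ultimately show "z * x < z * y" by (simp add: less_rcl_def)
  qed
  show "\<bar>x\<bar> = (if x < 0 then - x else x)" by (rule abs_rcl_def)
  show "sgn x = (if x = 0 then 0 else if 0 < x then 1 else - 1)" by (rule sgn_rcl_def)
qed
end

lemma Rep_rcl_hom: "rhom Rep_rcl"
  by (auto simp: rhom_def one_rcl.rep_eq plus_rcl.rep_eq times_rcl.rep_eq)

lemma Rep_rcl_nonneg: "0 \<le> x \<longleftrightarrow> Rep_rcl x \<in> the_cone"
  by (simp add: less_eq_rcl.rep_eq zero_rcl.rep_eq)

section \<open>Adjoining a root to the ordered field of the chosen cone\<close>

definition ev :: "('d::finite) clos \<Rightarrow> 'd rcl poly \<Rightarrow> 'd clos" where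
  "ev \<beta> h = poly (map_poly Rep_rcl h) \<beta>"

lemma ev_add: "ev \<beta> (g + h) = ev \<beta> g + ev \<beta> h"
  and ev_mult: "ev \<beta> (g * h) = ev \<beta> g * ev \<beta> h"
  by (simp_all add: ev_def map_poly_rhom_add[OF Rep_rcl_hom] map_poly_rhom_mult[OF Rep_rcl_hom])

lemma ev_const: "ev \<beta> [:c:] = Rep_rcl c"
  by (simp add: ev_def poly_map_poly_rhom[OF Rep_rcl_hom])

lemma rhom_ev: "rhom (ev \<beta>)"
  using ev_const[of \<beta> 1] by (simp add: rhom_def ev_add ev_mult one_pCons rhom_simps[OF Rep_rcl_hom])

lemmas ev_simps = rhom_simps[OF rhom_ev]

lemma ev_linear: "ev \<beta> [:a, b:] = Rep_rcl a + \<beta> * Rep_rcl b"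
proof -
  have "map_poly Rep_rcl [:a, b:] = [:Rep_rcl a, Rep_rcl b:]"
    by (rule poly_eqI) (simp add: coeff_map_poly_rhom[OF Rep_rcl_hom] coeff_pCons rhom_simps(4)[OF Rep_rcl_hom] split: nat.split)
  then show ?thesis by (simp add: ev_def)
qed

text \<open>The least candidate for a cone in the extension by \<open>\<beta>\<close> that contains
  the old one: sums of squares with nonnegative weights from the ordered field.\<close>

inductive_set wsq :: "('d::finite) clos \<Rightarrow> 'd clos set" for \<beta> where
  base: "0 \<le> t \<Longrightarrow> Rep_rcl t * (ev \<beta> h)\<^sup>2 \<in> wsq \<beta>"
| add: "x \<in> wsq \<beta> \<Longrightarrow> y \<in> wsq \<beta> \<Longrightarrow> x + y \<in> wsq \<beta>"

lemma wsq_square: "(ev \<beta> h)\<^sup>2 \<in> wsq \<beta>"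
  using wsq.base[of 1 \<beta> h] by (simp add: one_rcl.rep_eq)

lemma wsq_mult_base:
  assumes "x \<in> wsq \<beta>" "0 \<le> t" shows "x * (Rep_rcl t * (ev \<beta> h)\<^sup>2) \<in> wsq \<beta>"
  using assms(1)
proof induction
  case (base s g)
  have "Rep_rcl s * (ev \<beta> g)\<^sup>2 * (Rep_rcl t * (ev \<beta> h)\<^sup>2) = Rep_rcl (s * t) * (ev \<beta> (g * h))\<^sup>2"
    by (simp add: times_rcl.rep_eq ev_mult power_mult_distrib)
  then show ?case using wsq.base[of "s * t" \<beta> "g * h"] base assms(2) by simp
next
  case (add x y)
  then show ?case using wsq.add by (simp add: distrib_right)
qed

lemma wsq_mult:
  assumes "x \<in> wsq \<beta>" "y \<in> wsq \<beta>" shows "x * y \<in> wsq \<beta>"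
  using assms(2)
proof induction
  case (base t h)
  then show ?case by (rule wsq_mult_base[OF assms(1)])
next
  case (add y z)
  then show ?case using wsq.add by (simp add: distrib_left)
qed

lemma wsq_ev: "x \<in> wsq \<beta> \<Longrightarrow> \<exists>h. x = ev \<beta> h"
proof (induction rule: wsq.induct)
  case (base t h)
  have "Rep_rcl t * (ev \<beta> h)\<^sup>2 = ev \<beta> ([:t:] * h\<^sup>2)" by (simp only: ev_simps ev_const)
  then show ?case by blast
next
  case (add x y)
  then show ?case using ev_add by metis
qed

lemma the_cone_subset_wsq: "the_cone \<subseteq> wsq \<beta>"
proof
  fix x :: "'a clos" assume x: "x \<in> the_cone"
  then have "x \<in> cone_field the_cone" by (simp add: cone_field_def)
  then obtain t where t: "x = Rep_rcl t" by (metis Abs_rcl_inverse)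
  have "0 \<le> t" using x by (simp add: Rep_rcl_nonneg t)
  then show "x \<in> wsq \<beta>" using wsq.base[of t \<beta> 1] by (simp add: ev_simps t)
qed

text \<open>The classical argument that an ordering extends to the adjunction of a root at which a polynomial
  changes sign; by maximality the root is then already present.\<close>

lemma rcl_sign_change_root:
  fixes p :: "('d::finite) rcl poly"
  assumes "a < b" "poly p a * poly p b < 0"
  shows "\<exists>c. a < c \<and> c < b \<and> poly p c = 0"
  using assms
proof (induction "degree p" arbitrary: p a b rule: less_induct)
  case less
  show ?case
  proof (rule ccontr)
    assume no: "\<not> ?case"
    have p0: "p \<noteq> 0" using less.prems by auto
    have deg: "degree p > 0"
    proof (rule ccontr)
      assume "\<not> degree p > 0"
      then obtain c where "p = [:c:]" by (metis degree_eq_zeroE gr0I)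
      then show False using less.prems by (simp add: mult_less_0_iff)
    qed
    have "degree (map_poly Rep_rcl p) = degree p"
    proof (rule antisym[OF degree_map_poly_rhom[OF Rep_rcl_hom] le_degree])
      show "coeff (map_poly Rep_rcl p) (degree p) \<noteq> 0"
        using p0 by (simp add: coeff_map_poly_rhom[OF Rep_rcl_hom] flip: zero_rcl.rep_eq) (simp add: Rep_rcl_inject)
    qed
    then obtain \<beta> where \<beta>: "ev \<beta> p = 0"
      using alg_closed_imp_poly_has_root[of "map_poly Rep_rcl p"] deg unfolding ev_def by metis
    \<comment> \<open>A proper factor of \<open>p\<close>, or its cofactor, would inherit the sign
      change and have a root by induction. So \<open>p\<close> is, up to a scalar, the minimal
      polynomial of \<open>\<beta>\<close>.\<close>
    have minimal: "ev \<beta> h \<noteq> 0" if h: "h \<noteq> 0" "degree h < degree p" for h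
    proof
      assume "ev \<beta> h = 0"
      then have "\<exists>m. m \<noteq> 0 \<and> ev \<beta> m = 0 \<and> degree m < degree p" using h by blast
      then obtain m where m: "m \<noteq> 0" "ev \<beta> m = 0" "degree m < degree p"
        and least: "\<And>m'. degree m' < degree m \<Longrightarrow> \<not> (m' \<noteq> 0 \<and> ev \<beta> m' = 0 \<and> degree m' < degree p)"
        using exists_least_iff[of "\<lambda>n. \<exists>m. m \<noteq> 0 \<and> ev \<beta> m = 0 \<and> degree m < degree p \<and> degree m = n"] by metis
      have "p = m * (p div m) + p mod m" by simp
      then have "ev \<beta> (p mod m) = 0" using \<beta> m(2) ev_add ev_mult by (metis add_0 mult_zero_left)
      moreover have "p mod m = 0 \<or> degree (p mod m) < degree m" using degree_mod_less[OF m(1)] .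
      ultimately have "p mod m = 0" using least[of "p mod m"] m(3) by auto
      then obtain k where k: "p = m * k" by (metis mod_0_imp_dvd dvdE)
      have "degree m > 0"
      proof (rule ccontr)
        assume "\<not> degree m > 0"
        then obtain c where "m = [:c:]" by (metis degree_eq_zeroE gr0I)
        then show False using m by (simp add: ev_const flip: zero_rcl.rep_eq) (simp add: Rep_rcl_inject)
      qed
      moreover have "degree p = degree m + degree k" using p0 unfolding k by (intro degree_mult_eq) auto
      ultimately have dk: "degree k < degree p" by simp
      have "(poly m a * poly m b) * (poly k a * poly k b) < 0" using less.prems(2) by (simp add: k mult_ac)
      then have "poly m a * poly m b < 0 \<or> poly k a * poly k b < 0" by (auto simp: mult_less_0_iff)
      then have "\<exists>c. a < c \<and> c < b \<and> (poly m c = 0 \<or> poly k c = 0)"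
        using less.hyps[OF m(3) less.prems(1)] less.hyps[OF dk less.prems(1)] by blast
      then show False using no by (auto simp: k)
    qed
    have dvd: "p dvd h" if h: "ev \<beta> h = 0" for h
    proof -
      have "h = p * (h div p) + h mod p" by simp
      then have "ev \<beta> (h mod p) = 0" using \<beta> h ev_add ev_mult by (metis add_0 mult_zero_left)
      then have "h mod p = 0" using minimal[of "h mod p"] degree_mod_less[OF p0, of h] by blast
      then show ?thesis by (simp add: mod_0_imp_dvd)
    qed
    have red: "ev \<beta> (h mod p) = ev \<beta> h" for h
    proof -
      have "h = p * (h div p) + h mod p" by simp
      then show ?thesis using \<beta> ev_add ev_mult by (metis add_0 mult_zero_left)
    qed
    \<comment> \<open>Inverses in the extension come from a Euclidean descent: modulo
      \<open>p\<close>, the remainder \<open>p mod h\<close> is a multiple of \<open>h\<close> of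
      smaller degree.\<close>
    have inv': "\<exists>g. ev \<beta> (h * g) = 1" if "h \<noteq> 0" "degree h < degree p" for h
      using that
    proof (induction "degree h" arbitrary: h rule: less_induct)
      case (less h)
      show ?case
      proof (cases "p mod h = 0")
        case True
        then obtain s where s: "p = h * s" by (metis mod_0_imp_dvd dvdE)
        have "s \<noteq> 0" using p0 s by auto
        moreover have "ev \<beta> s = 0" using \<beta> minimal[OF less.prems] by (simp add: s ev_mult)
        ultimately have "\<not> degree s < degree p" using minimal by blast
        moreover have "degree p = degree h + degree s" using p0 unfolding s by (intro degree_mult_eq) auto
        ultimately obtain c where c: "h = [:c:]" by (metis add_cancel_left_left degree_eq_zeroE leI le_add_same_cancel1 le_antisym le_add2 zero_le)
        then have "h * [:inverse c:] = 1" using less.prems by (simp add: one_pCons)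
        then show ?thesis using ev_simps(1) by metis
      next
        case False
        have "degree (p mod h) < degree h" using degree_mod_less[OF less.prems(1), of p] False by blast
        then obtain g where g: "ev \<beta> ((p mod h) * g) = 1"
          using less.hyps[of "p mod h"] False less.prems by auto
        have "p mod h = p - h * (p div h)" by (simp add: minus_mult_div_eq_mod)
        then have "ev \<beta> ((p mod h) * g) = ev \<beta> (h * (- (p div h) * g))"
          using \<beta> by (simp add: ev_simps ev_mult)
        then show ?thesis using g by metis
      qed
    qed
    have inv: "\<exists>g. ev \<beta> h * ev \<beta> g = 1" if "ev \<beta> h \<noteq> 0" for h
    proof -
      have "h mod p \<noteq> 0" using that red[of h] ev_simps(4) by metis
      then have "degree (h mod p) < degree p" using degree_mod_less[OF p0, of h] by blast
      then obtain g where "ev \<beta> ((h mod p) * g) = 1" using inv' \<open>h mod p \<noteq> 0\<close> by blast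
      then show ?thesis using red[of h] by (auto simp: ev_mult)
    qed
    \<comment> \<open>Reducing each square modulo \<open>p\<close> first bounds the degree while
      keeping a representative that is nonnegative at all points of the ordered field.\<close>
    have rep: "\<exists>q. x = ev \<beta> q \<and> degree q \<le> 2 * (degree p - 1) \<and> (\<forall>c. 0 \<le> poly q c)" if "x \<in> wsq \<beta>" for x
      using that
    proof induction
      case (base t h)
      let ?q = "smult t ((h mod p)\<^sup>2)"
      have "smult t ((h mod p)\<^sup>2) = [:t:] * (h mod p)\<^sup>2" by simp
      then have "ev \<beta> ?q = Rep_rcl t * (ev \<beta> h)\<^sup>2" by (simp only: ev_simps ev_const red)
      moreover have "degree ?q \<le> 2 * (degree p - 1)"
      proof -
        have "degree (h mod p) \<le> degree p - 1" using degree_mod_less[OF p0, of h] by auto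
        then have "degree ((h mod p)\<^sup>2) \<le> 2 * (degree p - 1)"
          using degree_power_le[of "h mod p" 2] by (simp add: mult.commute)
        then show ?thesis using degree_smult_le order_trans by blast
      qed
      ultimately show ?case using base by (intro exI[of _ ?q]) auto
    next
      case (add x y)
      then obtain q r where "x = ev \<beta> q" "degree q \<le> 2 * (degree p - 1)" "\<forall>c. 0 \<le> poly q c"
        "y = ev \<beta> r" "degree r \<le> 2 * (degree p - 1)" "\<forall>c. 0 \<le> poly r c" by blast
      then show ?case by (intro exI[of _ "q + r"]) (auto simp: ev_add intro: degree_add_le)
    qed
    \<comment> \<open>Otherwise \<open>1 + q = p g\<close> with \<open>q\<close> nonnegative and
      \<open>g\<close> of smaller degree than \<open>p\<close>. The product is positive, so
      \<open>g\<close> changes sign together with \<open>p\<close> and has a root by induction,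
      where \<open>1 + q\<close> would vanish.\<close>
    have neg: "-1 \<notin> wsq \<beta>"
    proof
      assume "-1 \<in> wsq \<beta>"
      from rep[OF this] obtain q where q: "-1 = ev \<beta> q" "degree q \<le> 2 * (degree p - 1)" "\<forall>c. 0 \<le> poly q c"
        by blast
      have "ev \<beta> (1 + q) = 0" using q(1) by (simp add: ev_simps flip: q(1))
      then obtain g where g: "1 + q = p * g" using dvd by (metis dvdE)
      have pos: "poly (1 + q) c > 0" for c using q(3) by (simp add: add_pos_nonneg)
      have "(poly p a * poly p b) * (poly g a * poly g b) = poly (1 + q) a * poly (1 + q) b"
        unfolding g by (simp add: mult_ac)
      also have "\<dots> > 0" using pos by simp
      finally have gab: "poly g a * poly g b < 0" using less.prems(2)
        by (metis less_asym zero_less_mult_iff)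
      have "1 + q \<noteq> 0" using pos[of a] by (metis less_irrefl poly_0)
      then have "degree (1 + q) = degree p + degree g" unfolding g by (intro degree_mult_eq) auto
      moreover have "degree (1 + q) \<le> 2 * (degree p - 1)" using q(2) by (intro degree_add_le) auto
      ultimately have "degree g < degree p" using deg by simp
      from less.hyps[OF this less.prems(1) gab] obtain c where "poly g c = 0" by blast
      then have "poly (1 + q) c = 0" by (simp add: g)
      then show False using pos[of c] by simp
    qed
    have proper: "proper_cone (wsq \<beta>)" unfolding proper_cone_def
    proof (intro conjI ballI)
      show "1 \<in> wsq \<beta>" using wsq_square[of \<beta> 1] by (simp add: ev_simps)
      show "-1 \<notin> wsq \<beta>" by (rule neg)
    next
      fix x y assume xy: "x \<in> wsq \<beta>" "y \<in> wsq \<beta>"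
      then show "x + y \<in> wsq \<beta>" "x * y \<in> wsq \<beta>" by (rule wsq.add, rule wsq_mult)
      obtain g h where "x = ev \<beta> g" "y = ev \<beta> h" using wsq_ev xy by blast
      then have "(x - y)\<^sup>2 = (ev \<beta> (g - h))\<^sup>2" by (simp add: ev_simps)
      then show "(x - y)\<^sup>2 \<in> wsq \<beta>" by (simp only: wsq_square)
    next
      fix x assume x: "x \<in> wsq \<beta>"
      show "inverse x \<in> wsq \<beta>"
      proof (cases "x = 0")
        case True then show ?thesis using x by simp
      next
        case False
        obtain h where h: "x = ev \<beta> h" using wsq_ev x by blast
        then obtain g where g: "x * ev \<beta> g = 1" using inv[of h] False by blast
        then have "inverse x = x * (ev \<beta> g)\<^sup>2"
          using False by (simp add: power2_eq_square inverse_unique mult.assoc[symmetric])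
        then show ?thesis using wsq_mult[OF x wsq_square[of \<beta> g]] by simp
      qed
    qed
    have W: "wsq \<beta> = the_cone"
      using maximal_the_cone proper the_cone_subset_wsq unfolding maximal_cone_def by blast
    have two: "(2 :: 'd clos) \<noteq> 0" by (rule cone_two_neq_zero[OF proper])
    \<comment> \<open>The identity \<open>b = ((b + 1)/2)^2 - ((b - 1)/2)^2\<close> writes
      \<open>\<beta>\<close> as a difference of cone elements.\<close>
    have "(ev \<beta> [:1/2, 1/2:])\<^sup>2 - (ev \<beta> [:-1/2, 1/2:])\<^sup>2 \<in> cone_field the_cone"
      using wsq_square[of \<beta>] unfolding W by (intro maximal_cone_total[OF maximal_the_cone])
    moreover have "(ev \<beta> [:1/2, 1/2:])\<^sup>2 - (ev \<beta> [:-1/2, 1/2:])\<^sup>2 = \<beta>"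
    proof -
      have r: "Rep_rcl (1/2) = (1/2 :: 'd clos)" "Rep_rcl (-1/2) = (-1/2 :: 'd clos)"
      proof -
        have "(2 :: 'd rcl) = 1 + 1" by simp
        then have "Rep_rcl (2 :: 'd rcl) = 2" by (simp only: plus_rcl.rep_eq one_rcl.rep_eq) simp
        then show "Rep_rcl (1/2) = (1/2 :: 'd clos)" "Rep_rcl (-1/2) = (-1/2 :: 'd clos)"
          by (simp_all add: divide_rcl.rep_eq one_rcl.rep_eq uminus_rcl.rep_eq)
      qed
      define h where "h = (1/2 :: 'd clos)"
      have h: "2 * h = 1" "-1/2 = -h" using two by (simp_all add: h_def)
      have "(ev \<beta> [:1/2, 1/2:])\<^sup>2 - (ev \<beta> [:-1/2, 1/2:])\<^sup>2 = (h + \<beta> * h)\<^sup>2 - (-h + \<beta> * h)\<^sup>2"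
        by (simp only: ev_linear r h(2)) (simp only: h_def)
      also have "\<dots> = (2 * h) * (2 * h) * \<beta>" by (simp add: power2_eq_square algebra_simps)
      also have "\<dots> = \<beta>" by (simp only: h mult_1)
      finally show ?thesis .
    qed
    ultimately have "\<beta> \<in> cone_field the_cone" by simp
    then obtain c where c: "\<beta> = Rep_rcl c" by (metis Abs_rcl_inverse)
    \<comment> \<open>Once \<open>\<beta>\<close> is in the field, its minimal polynomial is linear.
      Thus \<open>p\<close> is a scalar multiple of \<open>X - c\<close>, and the sign change puts
      \<open>c\<close> between \<open>a\<close> and \<open>b\<close>.\<close>
    have "ev \<beta> [:-c, 1:] = 0" by (simp add: ev_linear c uminus_rcl.rep_eq one_rcl.rep_eq)
    then have "p dvd [:-c, 1:]" by (rule dvd)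
    then obtain k where k: "[:-c, 1:] = p * k" by (metis dvdE)
    have "degree [:-c, 1:] = degree p + degree k"
      unfolding k using k by (intro degree_mult_eq) (auto simp: p0)
    then have "degree k = 0" using deg by simp
    then obtain e where e: "k = [:e:]" by (meson degree_eq_zeroE)
    have "poly [:-c, 1:] a * poly [:-c, 1:] b = e\<^sup>2 * (poly p a * poly p b)"
      unfolding k e by (simp add: power2_eq_square mult_ac)
    moreover have "e \<noteq> 0" using k e by auto
    ultimately have "poly [:-c, 1:] a * poly [:-c, 1:] b < 0"
      using less.prems(2) mult_pos_neg[of "e\<^sup>2" "poly p a * poly p b"] by simp
    then have "(a - c) * (b - c) < 0" by simp
    then have "a < c" "c < b" using less.prems(1) by (auto simp: mult_less_0_iff)
    moreover have "poly p c = 0"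
    proof -
      have "poly (p * k) c = 0" by (simp flip: k)
      then show ?thesis using \<open>e \<noteq> 0\<close> by (simp add: e)
    qed
    ultimately show False using no by blast
  qed
qed

instance rcl :: (finite) real_closed_field
proof
  fix a b :: "'a rcl" and c :: "nat \<Rightarrow> 'a rcl" and n
  assume ab: "a \<le> b" and s: "(\<Sum>k\<le>n. c k * a ^ k) \<le> 0" "0 \<le> (\<Sum>k\<le>n. c k * b ^ k)"
  define p where "p = (\<Sum>k\<le>n. monom (c k) k)"
  have p: "poly p x = (\<Sum>k\<le>n. c k * x ^ k)" for x by (simp add: p_def poly_sum poly_monom)
  show "\<exists>x. a \<le> x \<and> x \<le> b \<and> (\<Sum>k\<le>n. c k * x ^ k) = 0"
  proof (cases "poly p a = 0 \<or> poly p b = 0")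
    case True
    then show ?thesis using ab p by auto
  next
    case False
    then have "poly p a < 0" "poly p b > 0" using s by (auto simp: p less_le)
    then have "poly p a * poly p b < 0" "a < b" using ab by (auto simp: mult_neg_pos intro: le_neq_trans)
    then obtain x where "a < x" "x < b" "poly p x = 0" using rcl_sign_change_root by blast
    then show ?thesis using p by (intro exI[of _ x]) auto
  qed
qed

section \<open>Artin's theorem\<close>

definition Xvar :: "'d::finite \<Rightarrow> 'd rp" where
  "Xvar i = Rp (Poly_Mapping.single (Poly_Mapping.single i 1) 1)"

definition Cst :: "real \<Rightarrow> ('d::finite) rp" where
  "Cst c = Rp (pconst c)"

lemma pconst_add: "pconst (a + b) = pconst a + pconst b"
  by (simp add: pconst_def single_add)

lemma pconst_mult: "pconst (a * b) = pconst a * pconst b"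
  by (simp add: pconst_def mult_single)

lemma Cst_add: "Cst (a + b) = Cst a + Cst b"
  and Cst_mult: "Cst (a * b) = Cst a * Cst b"
  and Cst_one: "Cst 1 = 1"
  and Cst_zero: "Cst 0 = 0"
  by (simp_all add: Cst_def pconst_add pconst_mult Rp_hom pconst_one) (simp add: pconst_def Rp_hom)

text \<open>Polynomials in the variables from \<open>V\<close> form a subring of one fixed ring, so
  the induction over the variables stays within a single type.\<close>

inductive_set vars_ring :: "('d::finite) set \<Rightarrow> 'd rp set" for V where
  const: "Cst c \<in> vars_ring V"
| var: "i \<in> V \<Longrightarrow> Xvar i \<in> vars_ring V"
| add: "p \<in> vars_ring V \<Longrightarrow> q \<in> vars_ring V \<Longrightarrow> p + q \<in> vars_ring V"
| mult: "p \<in> vars_ring V \<Longrightarrow> q \<in> vars_ring V \<Longrightarrow> p * q \<in> vars_ring V"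

lemma subring_vars_ring: "subring_set (vars_ring V)"
proof -
  have "p - q \<in> vars_ring V" if pq: "p \<in> vars_ring V" "q \<in> vars_ring V" for p q
  proof -
    have "Cst (-1) + 1 = (0 :: 'a rp)" using Cst_add[of "-1" 1] by (simp add: Cst_one Cst_zero)
    then have "Cst (-1) = (-1 :: 'a rp)" by (simp add: eq_neg_iff_add_eq_0)
    then have "p - q = p + Cst (-1) * q" by simp
    then show ?thesis using pq vars_ring.intros by metis
  qed
  moreover have "0 \<in> vars_ring V" "1 \<in> vars_ring V"
    using vars_ring.const[of 0 V] vars_ring.const[of 1 V] by (simp_all add: Cst_one Cst_zero)
  ultimately show ?thesis unfolding subring_set_def by (auto intro: vars_ring.add vars_ring.mult)
qed

lemma vars_ring_UNIV: "p \<in> vars_ring UNIV"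
proof -
  let ?R = "vars_ring (UNIV :: 'a set)"
  let ?s = "\<lambda>\<alpha>. Rp (Poly_Mapping.single \<alpha> (1::real)) :: 'a rp"
  have s_add: "?s (\<alpha> + \<beta>) = ?s \<alpha> * ?s \<beta>" for \<alpha> \<beta>
    by (simp add: mult_single flip: Rp_hom(6))
  have s_zero: "?s 0 \<in> ?R" using vars_ring.const[of 1 UNIV] by (simp add: Cst_def pconst_def)
  have pow: "?s (Poly_Mapping.single i n) \<in> ?R" for i n
  proof (induction n)
    case (Suc n)
    have "?s (Poly_Mapping.single i (Suc n)) = ?s (Poly_Mapping.single i n) * Xvar i"
      using s_add[of "Poly_Mapping.single i n" "Poly_Mapping.single i 1"]
      by (simp add: Xvar_def flip: single_add)
    then show ?case using Suc vars_ring.var[of i UNIV] vars_ring.mult by auto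
  qed (use s_zero in simp)
  have mono: "?s \<alpha> \<in> ?R" for \<alpha>
  proof -
    have "?s (\<Sum>i\<in>A. Poly_Mapping.single i (Poly_Mapping.lookup \<alpha> i)) \<in> ?R" for A
    proof (induction A rule: infinite_finite_induct)
      case (insert i A)
      then show ?case using vars_ring.mult[OF pow insert.IH] by (simp add: s_add)
    qed (use s_zero in simp_all)
    then show ?thesis using poly_mapping_sum_single[of \<alpha>] by metis
  qed
  have sing: "Rp (Poly_Mapping.single \<alpha> c) \<in> ?R" for \<alpha> c
  proof -
    have "Poly_Mapping.single \<alpha> c = pconst c * Poly_Mapping.single \<alpha> 1" by (simp add: pconst_def mult_single)
    then have "Rp (Poly_Mapping.single \<alpha> c) = Cst c * ?s \<alpha>" by (simp add: Cst_def Rp_hom)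
    then show ?thesis using vars_ring.mult[OF vars_ring.const mono] by simp
  qed
  have "Rp (\<Sum>k\<in>A. Poly_Mapping.single k (Poly_Mapping.lookup (rpoly_of p) k)) \<in> ?R" for A
  proof (induction A rule: infinite_finite_induct)
    case (insert i A)
    then show ?case using vars_ring.add[OF sing insert.IH] by (simp add: Rp_hom)
  qed (use vars_ring.const[of 0 UNIV] in \<open>simp_all add: Cst_zero Rp_hom\<close>)
  then have "Rp (rpoly_of p) \<in> ?R" using poly_mapping_sum_single[of "rpoly_of p"] by metis
  then show ?thesis by (simp add: rpoly_of_inverse)
qed

definition pe :: "real ^ 'd \<Rightarrow> ('d::finite) rp \<Rightarrow> real" where
  "pe a p = peval (rpoly_of p) a"

lemma rhom_pe: "rhom (pe a)"
  by (simp add: rhom_def pe_def)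

lemmas pe_simps = rhom_simps[OF rhom_pe]

lemma pe_Cst: "pe a (Cst c) = c"
  by (simp add: pe_def Cst_def Rp_inverse)

lemma pe_Xvar: "pe a (Xvar i) = a $ i"
proof -
  have "monom_eval (Poly_Mapping.single i 1) a = (\<Prod>j\<in>UNIV. if j = i then a $ j else 1)"
    unfolding monom_eval_def by (intro prod.cong) (auto simp: lookup_single when_def)
  then show ?thesis by (simp add: pe_def Xvar_def Rp_inverse peval_single)
qed

lemma pe_update:
  assumes "p \<in> vars_ring V" "v \<notin> V"
  shows "pe (\<chi> i. if i = v then u else a $ i) p = pe a p"
  using assms(1) by induction (use assms(2) in \<open>auto simp: pe_Cst pe_Xvar pe_simps\<close>)

lemma vars_ring_insert:
  assumes "f \<in> vars_ring (insert v V)"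
  shows "\<exists>F. F \<in> poly_over (vars_ring V) \<and> f = poly F (Xvar v)"
proof -
  note R = subring_vars_ring[of V]
  have const_over: "[:c:] \<in> poly_over (vars_ring V)" if "c \<in> vars_ring V" for c
    using poly_over_monom[OF R that, of 0] by (simp add: monom_0)
  show ?thesis using assms
  proof induction
    case (const c)
    show ?case using const_over[OF vars_ring.const]
      by (intro exI[of _ "[:Cst c:]"]) auto
  next
    case (var i)
    show ?case
    proof (cases "i = v")
      case True
      have "monom 1 (Suc 0) \<in> poly_over (vars_ring V)"
        using R by (intro poly_over_monom[OF R]) (simp add: subring_set_def)
      then show ?thesis using True by (intro exI[of _ "monom 1 (Suc 0)"]) (simp add: poly_monom)
    next
      case False
      then show ?thesis using var const_over[OF vars_ring.var] by (intro exI[of _ "[:Xvar i:]"]) auto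
    qed
  next
    case (add p q)
    then show ?case by (metis poly_add poly_over_add[OF R])
  next
    case (mult p q)
    then show ?case by (metis poly_mult poly_over_mult[OF R])
  qed
qed

definition to_rcl :: "('d::finite) rp \<Rightarrow> 'd rcl" where
  "to_rcl p = Abs_rcl (emb p)"

lemma Rep_to_rcl: "Rep_rcl (to_rcl p) = emb p"
  unfolding to_rcl_def by (rule Abs_rcl_inverse) (rule emb_in_cone_field[OF the_cone(1)])

lemma rhom_to_rcl: "rhom to_rcl"
  unfolding rhom_def
  by (auto simp: Rep_to_rcl one_rcl.rep_eq plus_rcl.rep_eq times_rcl.rep_eq emb_simps simp flip: Rep_rcl_inject)

lemma to_rcl_nonneg: "0 \<le> to_rcl p \<longleftrightarrow> emb p \<in> the_cone" "to_rcl p \<le> 0 \<longleftrightarrow> - emb p \<in> the_cone"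
  by (simp_all add: less_eq_rcl.rep_eq zero_rcl.rep_eq Rep_to_rcl)

lemma to_rcl_eq_0: "to_rcl p = 0 \<longleftrightarrow> p = 0"
  by (metis Rep_to_rcl emb_eq_0_iff rhom_simps(4)[OF rhom_to_rcl] Rep_rcl_inject)

text \<open>Positive real constants are squares, so their sign is the same in every
  ordering.\<close>

lemma same_sign_const: "same_sign (to_rcl (Cst c :: 'd::finite rp)) c"
proof -
  have pos: "0 < to_rcl (Cst c :: 'd rp)" if "c > 0" for c
  proof -
    have "Cst c = Cst (sqrt c) * Cst (sqrt c)" using that by (simp flip: Cst_mult)
    then have "to_rcl (Cst c :: 'd rp) = to_rcl (Cst (sqrt c)) * to_rcl (Cst (sqrt c))"
      using rhom_simps(3)[OF rhom_to_rcl] by metis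
    then have "0 \<le> to_rcl (Cst c :: 'd rp)" by simp
    moreover have "(Cst c :: 'd rp) \<noteq> 0" using that pe_Cst[of _ c] pe_simps(4) by (metis less_irrefl)
    ultimately show ?thesis by (simp add: less_le to_rcl_eq_0)
  qed
  have neg: "to_rcl (Cst c :: 'd rp) = - to_rcl (Cst (- c))" for c
  proof -
    have "(Cst c :: 'd rp) + Cst (- c) = 0" using Cst_add[of c "-c"] by (simp add: Cst_zero)
    then have "(Cst c :: 'd rp) = - Cst (- c)" by (simp add: eq_neg_iff_add_eq_0)
    then show ?thesis using rhom_simps(5)[OF rhom_to_rcl] by metis
  qed
  consider "c > 0" | "c = 0" | "c < 0" by linarith
  then show ?thesis
  proof cases
    case 1 then show ?thesis using pos[of c] by (simp add: same_sign_def)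
  next
    case 2 then show ?thesis by (simp add: same_sign_def Cst_zero rhom_simps[OF rhom_to_rcl])
  next
    case 3 then show ?thesis using pos[of "-c"] neg[of c] by (simp add: same_sign_def)
  qed
qed

text \<open>The images of the variables form a point over the ordered field where polynomials have
  the signs given by the cone. Its coordinates are replaced by real ones in turn: the coefficient
  signs that control one replacement involve fewer variables and are realised by induction.\<close>

lemma vars_ring_realised:
  assumes "finite V" "finite C" "C \<subseteq> vars_ring V"
  shows "\<exists>a. \<forall>c\<in>C. same_sign (to_rcl c) (pe a c)"
  using assms
proof (induction V arbitrary: C rule: finite_induct)
  case empty
  have "\<exists>r. c = Cst r" if "c \<in> vars_ring {}" for c :: "'a rp"
    using that by induction (auto simp: Cst_add[symmetric] Cst_mult[symmetric])
  then have "same_sign (to_rcl c) (pe 0 c)" if "c \<in> C" for c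
    using that empty.prems same_sign_const pe_Cst by (metis subsetD)
  then show ?case by blast
next
  case (insert v V)
  let ?R = "vars_ring V"
  have "\<forall>f\<in>C. \<exists>F. F \<in> poly_over ?R \<and> f = poly F (Xvar v)"
    using insert.prems vars_ring_insert by blast
  then obtain F where F: "\<And>f. f \<in> C \<Longrightarrow> F f \<in> poly_over ?R \<and> f = poly (F f) (Xvar v)" by metis
  have "finite (F ` C)" "F ` C \<subseteq> poly_over ?R" using insert.prems F by auto
  from one_variable_transfer[OF subring_vars_ring this]
  obtain D where D: "finite D" "D \<subseteq> ?R" and tr: "\<forall>\<phi> \<psi>. rhom \<phi> \<longrightarrow> rhom \<psi> \<longrightarrow>
     (\<forall>c\<in>D. same_sign (\<phi> c :: 'a rcl) (\<psi> c :: real)) \<longrightarrow>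
     (\<forall>x. \<exists>u. \<forall>p\<in>F ` C. same_sign (poly (map_poly \<phi> p) x) (poly (map_poly \<psi> p) u))"
    by (elim exE conjE) (rule that)
  obtain a where a: "\<forall>c\<in>D. same_sign (to_rcl c) (pe a c)" using insert.IH[OF D] by blast
  obtain u where u: "\<forall>p\<in>F ` C. same_sign (poly (map_poly to_rcl p) (to_rcl (Xvar v))) (poly (map_poly (pe a) p) u)"
    using tr[rule_format, OF rhom_to_rcl rhom_pe, of a "to_rcl (Xvar v)"] a by blast
  define a' where "a' = (\<chi> i. if i = v then u else a $ i)"
  have "same_sign (to_rcl f) (pe a' f)" if f: "f \<in> C" for f
  proof -
    have "poly (map_poly to_rcl (F f)) (to_rcl (Xvar v)) = to_rcl f"
      using F[OF f] by (simp add: poly_map_poly_rhom_apply[OF rhom_to_rcl])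
    \<comment> \<open>The coefficients do not involve \<open>v\<close>, so the new coordinate
      \<open>u\<close> leaves their values unchanged.\<close>
    moreover have "map_poly (pe a) (F f) = map_poly (pe a') (F f)"
    proof (rule poly_eqI)
      fix i
      have "coeff (F f) i \<in> ?R" using F[OF f] by (simp add: poly_over_def)
      then show "coeff (map_poly (pe a) (F f)) i = coeff (map_poly (pe a') (F f)) i"
        using pe_update[of _ V v u a] insert.hyps
        by (simp add: coeff_map_poly_rhom[OF rhom_pe] a'_def)
    qed
    moreover have "poly (map_poly (pe a') (F f)) u = pe a' f"
    proof -
      have "pe a' (Xvar v) = u" by (simp add: pe_Xvar a'_def)
      then show ?thesis using F[OF f] poly_map_poly_rhom_apply[OF rhom_pe, of a' "F f" "Xvar v"] by simp
    qed
    ultimately show ?thesis using u f by (metis imageI)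
  qed
  then show ?case by blast
qed

lemma admissible_realised:
  fixes C :: "('d::finite) rp set"
  assumes "admissible T" "finite C" shows "realised T C"
proof (rule ccontr)
  assume "\<not> realised T C"
  from the_cone(2)[OF assms this] obtain C' :: "'d rp set" where C': "finite C'" "\<not> realised the_cone C'" by blast
  obtain a where a: "\<forall>c\<in>C'. same_sign (to_rcl c) (pe a c)"
    using vars_ring_realised[of UNIV C'] C' vars_ring_UNIV by auto
  have "realised the_cone C'"
    unfolding realised_def to_rcl_nonneg[symmetric] pe_def[symmetric]
    using a by (intro exI[of _ a]) (simp add: same_sign_def not_less[symmetric])
  then show False using C' by blast
qed

theorem nonneg_imp_square_multiple_in_preordering:
  fixes G :: "('d::finite) rpoly set" and f :: "'d rpoly"
  assumes fin: "finite G" and nonneg: "\<And>x. x \<in> nonneg_set G \<Longrightarrow> 0 \<le> peval f x"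
  shows "\<exists>b. b \<noteq> 0 \<and> b\<^sup>2 * f \<in> ring_preordering hull G"
proof (rule ccontr)
  assume contra: "\<not> ?thesis"
  define T where "T = ring_preordering hull G"
  have T_add: "p + q \<in> T" and T_mult: "p * q \<in> T" if "p \<in> T" "q \<in> T" for p q
    using ring_preordering_hull[of G] that unfolding T_def ring_preordering_def by simp_all
  have Tsq: "r\<^sup>2 \<in> T" for r using ring_preordering_hull[of G] unfolding T_def ring_preordering_def by simp
  \<comment> \<open>These are the polynomials in the preordering that \<open>T\<close> generates in
    the rational function field; square denominators have been cleared.\<close>
  define Q where "Q = {p :: 'd rp. \<exists>b. b \<noteq> 0 \<and> b\<^sup>2 * rpoly_of p \<in> T}"
  have rp2: "rpoly_of (p\<^sup>2) = (rpoly_of p)\<^sup>2" for p :: "'d rp" by (simp add: power2_eq_square)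
  have rp0: "rpoly_of p = 0 \<longleftrightarrow> p = 0" for p :: "'d rp" by (metis rpoly_of_hom(1) rpoly_of_inject)
  have Q_I: "p \<in> Q" if "b \<noteq> 0" "b\<^sup>2 * rpoly_of p \<in> T" for b p using that by (auto simp: Q_def)
  have Q_E: "\<exists>b. b \<noteq> 0 \<and> b\<^sup>2 * rpoly_of p \<in> T" if "p \<in> Q" for p using that by (simp add: Q_def)
  have Q_add: "p + q \<in> Q" if pq: "p \<in> Q" "q \<in> Q" for p q
  proof -
    obtain b c where b: "b \<noteq> 0" "b\<^sup>2 * rpoly_of p \<in> T" and c: "c \<noteq> 0" "c\<^sup>2 * rpoly_of q \<in> T"
      using Q_E pq by metis
    have "c\<^sup>2 * (b\<^sup>2 * rpoly_of p) + b\<^sup>2 * (c\<^sup>2 * rpoly_of q) \<in> T" by (intro T_add T_mult Tsq b c)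
    then have "(b * c)\<^sup>2 * rpoly_of (p + q) \<in> T" by (simp add: algebra_simps power_mult_distrib)
    then show ?thesis by (rule Q_I[OF rpoly_no_zero_divisors[OF b(1) c(1)]])
  qed
  have Q_mult: "p * q \<in> Q" if pq: "p \<in> Q" "q \<in> Q" for p q
  proof -
    obtain b c where b: "b \<noteq> 0" "b\<^sup>2 * rpoly_of p \<in> T" and c: "c \<noteq> 0" "c\<^sup>2 * rpoly_of q \<in> T"
      using Q_E pq by metis
    have "(b\<^sup>2 * rpoly_of p) * (c\<^sup>2 * rpoly_of q) \<in> T" by (intro T_mult b c)
    then have "(b * c)\<^sup>2 * rpoly_of (p * q) \<in> T" by (simp add: algebra_simps power_mult_distrib)
    then show ?thesis by (rule Q_I[OF rpoly_no_zero_divisors[OF b(1) c(1)]])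
  qed
  have Q_T: "p \<in> Q" if "rpoly_of p \<in> T" for p
    using that by (intro Q_I[of 1]) auto
  have Q_sq: "p\<^sup>2 \<in> Q" for p using Q_T[of "p\<^sup>2"] Tsq rp2 by simp
  have Q_cancel: "p \<in> Q" if s: "s \<noteq> 0" "s\<^sup>2 * p \<in> Q" for s p
  proof -
    obtain b where b: "b \<noteq> 0" "b\<^sup>2 * rpoly_of (s\<^sup>2 * p) \<in> T" using Q_E s(2) by metis
    then have "(b * rpoly_of s)\<^sup>2 * rpoly_of p \<in> T" by (simp add: rp2 power_mult_distrib mult.assoc)
    moreover have "b * rpoly_of s \<noteq> 0" using b s(1) rp0 by (intro rpoly_no_zero_divisors) auto
    ultimately show ?thesis by (intro Q_I[of "b * rpoly_of s"])
  qed
  define F where "F = Rp f"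
  have FQ: "F \<notin> Q" using contra Q_E[of F] by (auto simp: F_def T_def Rp_inverse)
  \<comment> \<open>Adjoining \<open>-F\<close> to \<open>Q\<close>: the aim is an ordering in which
    \<open>Q\<close> is nonnegative and \<open>F\<close> is nonpositive.\<close>
  define P where "P = {s - t * F | s t. s \<in> Q \<and> t \<in> Q}"
  have Q0: "0 \<in> Q" and Q1: "1 \<in> Q" using Q_sq[of 0] Q_sq[of 1] by auto
  have P_I: "s - t * F \<in> P" if "s \<in> Q" "t \<in> Q" for s t using that by (auto simp: P_def)
  have QP: "Q \<subseteq> P" using P_I[OF _ Q0] by auto
  have "\<exists>A. admissible A \<and> emb ` P \<subseteq> A"
  proof (rule exists_admissible)
    fix p q assume "p \<in> P" "q \<in> P"
    then obtain s t u v where p: "p = s - t * F" "s \<in> Q" "t \<in> Q" and q: "q = u - v * F" "u \<in> Q" "v \<in> Q"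
      unfolding P_def by blast
    have "p + q = (s + u) - (t + v) * F" unfolding p q by (simp add: algebra_simps)
    moreover have "(s + u) - (t + v) * F \<in> P" by (intro P_I Q_add p q)
    ultimately show "p + q \<in> P" by (simp only:)
    have "p * q = (s * u + F\<^sup>2 * (t * v)) - (s * v + t * u) * F"
      unfolding p q by (simp add: algebra_simps power2_eq_square)
    moreover have "s * u + F\<^sup>2 * (t * v) \<in> Q" "s * v + t * u \<in> Q"
      using p q by (auto intro!: Q_add Q_mult Q_sq)
    ultimately show "p * q \<in> P" using P_I by (simp only:)
  next
    fix p show "p\<^sup>2 \<in> P" using Q_sq QP by blast
  next
    fix p assume "- (p\<^sup>2) \<in> P"
    then obtain s t where st: "- (p\<^sup>2) = s - t * F" "s \<in> Q" "t \<in> Q" unfolding P_def by blast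
    show "p = 0"
    proof (rule ccontr)
      assume p: "p \<noteq> 0"
      have tF: "t * F = s + p\<^sup>2" using st(1) by (simp add: algebra_simps eq_neg_iff_add_eq_0)
      show False
      \<comment> \<open>If \<open>t\<close> is non-zero, multiplying \<open>t F = s + p^2\<close> by
        \<open>t\<close> puts \<open>t^2 F\<close>, hence \<open>F\<close>, into \<open>Q\<close>.
        If \<open>t = 0\<close>, then \<open>-p^2\<close> lies in \<open>Q\<close>, and
        \<open>4 F = (F + 1)^2 - (F - 1)^2\<close>, scaled by \<open>p^2\<close>, again puts
        \<open>F\<close> into \<open>Q\<close>.\<close>
      proof (cases "t = 0")
        case False
        have "t\<^sup>2 * F = t * (s + p\<^sup>2)" by (simp add: power2_eq_square mult.assoc tF)
        then have "t\<^sup>2 * F \<in> Q" using st Q_add Q_mult Q_sq by metis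
        then show False using Q_cancel[OF False] FQ by blast
      next
        case True
        then have "- (p\<^sup>2) \<in> Q" using st by simp
        then have "p\<^sup>2 * (F + 1)\<^sup>2 + - (p\<^sup>2) * (F - 1)\<^sup>2 \<in> Q" by (intro Q_add Q_mult Q_sq)
        moreover have "p\<^sup>2 * (F + 1)\<^sup>2 + - (p\<^sup>2) * (F - 1)\<^sup>2 = (2 * p)\<^sup>2 * F"
          by (simp add: power2_eq_square algebra_simps)
        moreover have "2 * p \<noteq> 0"
        proof -
          have "(2 :: 'd rp) = Cst 2" using Cst_add[of 1 1] by (simp add: Cst_one)
          then have "(2 :: 'd rp) \<noteq> 0" using pe_Cst[of _ 2] pe_simps(4) by (metis zero_neq_numeral)
          then show ?thesis using p by simp
        qed
        ultimately show False using Q_cancel[of "2 * p" F] FQ by metis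
      qed
    qed
  qed
  then obtain A where A: "admissible A" "emb ` P \<subseteq> A" by blast
  have "realised A (insert F (Rp ` G))" using fin by (intro admissible_realised[OF A(1)]) auto
  then obtain a where a': "\<forall>c\<in>insert F (Rp ` G).
      (emb c \<in> A \<longleftrightarrow> 0 \<le> peval (rpoly_of c) a) \<and> (- emb c \<in> A \<longleftrightarrow> peval (rpoly_of c) a \<le> 0)"
    unfolding realised_def by (elim exE) (rule that)
  note a = bspec[OF a']
  have "0 \<le> peval g a" if g: "g \<in> G" for g
  proof -
    have "g \<in> T" using g unfolding T_def by (simp add: hull_inc)
    then have "emb (Rp g) \<in> A" using Q_T[of "Rp g"] QP A(2) by (auto simp: Rp_inverse)
    then show ?thesis using a[of "Rp g"] g by (simp add: Rp_inverse)
  qed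
  \<comment> \<open>At \<open>a\<close> the generators are nonnegative, so \<open>f\<close> is, and
    \<open>F\<close> lies in the cone along with \<open>-F\<close>. Then \<open>F = 0\<close>, which
    belongs to \<open>Q\<close>.\<close>
  then have "0 \<le> peval f a" using nonneg by (simp add: nonneg_set_def)
  then have 1: "emb F \<in> A" using a[of F] by (simp add: F_def Rp_inverse)
  have "0 - 1 * F \<in> P" by (rule P_I[OF Q0 Q1])
  then have "emb (- F) \<in> A" using A(2) by auto
  then have 2: "- emb F \<in> A" by (simp add: emb_simps)
  have "proper_cone A" using A(1) by (simp add: admissible_def maximal_cone_def)
  then have "emb F = 0" by (rule cone_antisym[OF _ 1 2])
  then have "F = 0" by (simp add: emb_eq_0_iff)
  then show False using FQ Q0 by simp
qed

section \<open>Diagonalisation\<close>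

lemma mscale_nth [simp]: "mscale c A $ i $ j = c * A $ i $ j"
  by (simp add: mscale_def map_matrix_def)

lemma meval_nth [simp]: "meval F x $ i $ j = peval (F $ i $ j) x"
  by (simp add: meval_def map_matrix_def)

lemma mscale_add: "mscale c (A + B) = mscale c A + mscale (c :: 'a::comm_ring_1) B"
  by (simp add: vec_eq_iff algebra_simps)

lemma mscale_mscale: "mscale c (mscale d A) = mscale (c * d :: 'a::comm_ring_1) A"
  by (simp add: vec_eq_iff mult.assoc)

lemma mscale_sum: "mscale c (\<Sum>i\<in>I. f i) = (\<Sum>i\<in>I. mscale (c :: 'a::comm_ring_1) (f i))"
  by (simp add: vec_eq_iff sum_distrib_left)

definition outer :: "'a::comm_ring_1 ^ 'n \<Rightarrow> 'a ^ 'n ^ 'n" where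
  "outer v = (\<chi> i j. v $ i * v $ j)"

lemma outer_nth [simp]: "outer v $ i $ j = v $ i * v $ j"
  by (simp add: outer_def)

text \<open>The vector is placed in one row of a zero matrix, because the cone is defined with
  square factors.\<close>

lemma outer_eq_gram:
  fixes v :: "'a::comm_ring_1 ^ 'n::finite"
  shows "\<exists>A :: 'a ^ 'n ^ 'n. outer v = transpose A ** A"
proof -
  fix i0 :: 'n
  define A :: "'a ^ 'n ^ 'n" where "A = (\<chi> i j. if i = i0 then v $ j else 0)"
  have "outer v = transpose A ** A"
    by (simp add: vec_eq_iff matrix_matrix_mult_def transpose_def A_def if_distrib cong: if_cong)
  then show ?thesis by blast
qed

lemma mat_coneE:
  fixes P :: "'a::comm_ring_1 ^ 'n ^ 'n"
  assumes "P \<in> mat_cone M"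
  obtains k and n :: "nat \<Rightarrow> 'a" and B :: "nat \<Rightarrow> 'a ^ 'n ^ 'n"
    where "P = (\<Sum>i<k::nat. mscale (n i) (transpose (B i) ** B i))" "\<And>i. i < k \<Longrightarrow> n i \<in> M"
  using assms unfolding mat_cone_def by (elim CollectE exE conjE) (erule that, blast)

lemma mat_cone_zero: "0 \<in> mat_cone M"
  unfolding mat_cone_def by (rule CollectI, rule exI[of _ 0]) simp

lemma mat_cone_add_gram:
  fixes P :: "'a::comm_ring_1 ^ 'n ^ 'n" and A :: "'a ^ 'n ^ 'n"
  assumes P: "P \<in> mat_cone M" and m: "m \<in> M"
  shows "P + mscale m (transpose A ** A) \<in> mat_cone M"
proof -
  obtain k and n :: "nat \<Rightarrow> 'a" and B :: "nat \<Rightarrow> 'a ^ 'n ^ 'n"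
    where P: "P = (\<Sum>i<k. mscale (n i) (transpose (B i) ** B i))" "\<And>i. i < k \<Longrightarrow> n i \<in> M"
    using P by (rule mat_coneE) (erule that, blast)
  have "(\<Sum>i<Suc k. mscale ((n(k := m)) i) (transpose ((B(k := A)) i) ** (B(k := A)) i)) =
      P + mscale m (transpose A ** A)"
    unfolding P by simp
  moreover have "\<forall>i<Suc k. (n(k := m)) i \<in> M" using P(2) m by (auto simp: less_Suc_eq)
  ultimately show ?thesis unfolding mat_cone_def
    by (intro CollectI exI[of _ "Suc k"] exI[of _ "n(k := m)"] exI[of _ "B(k := A)"]) simp
qed

lemma mat_cone_add:
  fixes P :: "'a::comm_ring_1 ^ 'n ^ 'n"
  assumes P: "P \<in> mat_cone M" and Q: "Q \<in> mat_cone M"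
  shows "P + Q \<in> mat_cone M"
proof -
  obtain k and n :: "nat \<Rightarrow> 'a" and B :: "nat \<Rightarrow> 'a ^ 'n ^ 'n"
    where Q: "Q = (\<Sum>i<k. mscale (n i) (transpose (B i) ** B i))" "\<And>i. i < k \<Longrightarrow> n i \<in> M"
    using Q by (rule mat_coneE) (erule that, blast)
  have "P + (\<Sum>i<j. mscale (n i) (transpose (B i) ** B i)) \<in> mat_cone M" if "j \<le> k" for j
    using that
  proof (induction j)
    case (Suc j)
    then show ?case using mat_cone_add_gram[of _ M "n j" "B j"] Q(2) by (simp add: add.assoc[symmetric])
  qed (simp add: P)
  then show ?thesis using Q(1) by simp
qed

lemma mat_cone_sum: "(\<And>i. i \<in> I \<Longrightarrow> f i \<in> mat_cone M) \<Longrightarrow> sum f I \<in> mat_cone M"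
  by (induction I rule: infinite_finite_induct) (auto simp: mat_cone_zero mat_cone_add)

lemma mat_cone_outer: "m \<in> M \<Longrightarrow> mscale m (outer v) \<in> mat_cone M"
  using outer_eq_gram[of v] mat_cone_add_gram[OF mat_cone_zero, of m M] by auto

lemma mat_cone_mscale_square:
  fixes P :: "'a::comm_ring_1 ^ 'n ^ 'n"
  assumes M: "quadratic_module M" and P: "P \<in> mat_cone M"
  shows "mscale (c\<^sup>2) P \<in> mat_cone M"
proof -
  obtain k and n :: "nat \<Rightarrow> 'a" and B :: "nat \<Rightarrow> 'a ^ 'n ^ 'n"
    where P: "P = (\<Sum>i<k. mscale (n i) (transpose (B i) ** B i))" "\<And>i. i < k \<Longrightarrow> n i \<in> M"
    using P by (rule mat_coneE) (erule that, blast)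
  have "mscale (c\<^sup>2) P = (\<Sum>i<k. mscale (c\<^sup>2 * n i) (transpose (B i) ** B i))"
    unfolding P by (simp add: mscale_sum mscale_mscale)
  moreover have "\<forall>i<k. c\<^sup>2 * n i \<in> M" using M P(2) by (simp add: quadratic_module_def)
  ultimately show ?thesis unfolding mat_cone_def
    by (intro CollectI exI[of _ k] exI[of _ "\<lambda>i. c\<^sup>2 * n i"] exI[of _ B]) simp
qed

section \<open>Positive semidefinite matrices and elimination of a row\<close>

lemma transpose_eq_nth: "transpose A = A \<Longrightarrow> A $ i $ j = A $ j $ i"
proof -
  assume "transpose A = A"
  then have "A $ i $ j = transpose A $ i $ j" by simp
  then show ?thesis by (simp add: transpose_def)
qed

lemma sym_nth: "A \<in> sym_matrices \<Longrightarrow> A $ i $ j = A $ j $ i"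
  unfolding sym_matrices_def by (rule transpose_eq_nth) simp

lemma transpose_meval:
  assumes "F \<in> sym_matrices" shows "transpose (meval F x) = meval F x"
  using sym_nth[OF assms] by (simp add: vec_eq_iff transpose_def)

lemma quadratic_form_sum:
  fixes A :: "real ^ 'n ^ 'n"
  shows "v \<bullet> (A *v w) = (\<Sum>i\<in>UNIV. \<Sum>j\<in>UNIV. v $ i * (A $ i $ j * w $ j))"
  by (simp add: inner_vec_def matrix_vector_mult_def sum_distrib_left)

lemma possemidef_diag_nonneg: "possemidef A \<Longrightarrow> 0 \<le> A $ i $ i"
proof -
  assume "possemidef A"
  then have "0 \<le> axis i 1 \<bullet> (A *v axis i 1)" by (simp add: possemidef_def)
  then show ?thesis by (simp add: inner_axis' matrix_vector_mult_basis column_def)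
qed

lemma possemidef_zero_diag:
  assumes A: "possemidef A" and z: "A $ i $ i = 0" shows "A $ i $ j = 0"
proof (rule ccontr)
  assume n: "A $ i $ j \<noteq> 0"
  have sym: "A $ j $ i = A $ i $ j"
    using A transpose_eq_nth unfolding possemidef_def by blast
  \<comment> \<open>\<open>s\<close> solves \<open>2 s A_ij + A_jj = -1\<close>, which is the value
    of the form at \<open>s e_i + e_j\<close>.\<close>
  define s where "s = - (A $ j $ j + 1) / (2 * A $ i $ j)"
  define v :: "real ^ 'a" where "v = s *\<^sub>R axis i 1 + axis j 1"
  have Aax: "A *v axis k 1 = column k A" for k by (rule matrix_vector_mult_basis)
  have "v \<bullet> (A *v v) = s * (s * A $ i $ i + A $ i $ j) + (s * A $ j $ i + A $ j $ j)"
    by (simp add: v_def matrix_vector_right_distrib matrix_vector_mult_scaleR Aax inner_add_left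
        inner_add_right inner_axis' column_def algebra_simps)
  also have "\<dots> = 2 * (s * A $ i $ j) + A $ j $ j" by (simp add: z sym)
  also have "\<dots> = -1" using n by (simp add: s_def field_simps)
  finally show False using A by (simp add: possemidef_def) (metis neg_0_le_iff_le not_one_le_zero)
qed

text \<open>\<open>B\<close> is the Schur complement of the entry \<open>A_ii\<close>, multiplied by
  its square so that no division occurs. The form of \<open>B\<close> at \<open>v\<close> is the
  form of \<open>A\<close> at a multiple of \<open>v\<close> corrected along
  \<open>e_i\<close>.\<close>

lemma possemidef_schur:
  fixes A B :: "real ^ 'n::finite ^ 'n"
  assumes A: "possemidef A"
    and B: "\<And>j k. B $ j $ k = A $ i $ i * (A $ i $ i * A $ j $ k - A $ i $ j * A $ i $ k)"
  shows "possemidef B"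
proof -
  have sym: "A $ j $ k = A $ k $ j" for j k
    using A transpose_eq_nth unfolding possemidef_def by blast
  have "0 \<le> v \<bullet> (B *v v)" for v
  proof -
    define a where "a = A $ i $ i"
    define f where "f = (\<Sum>j\<in>UNIV. A $ i $ j * v $ j)"
    define w where "w = a *\<^sub>R v - f *\<^sub>R axis i 1"
    have Ai: "axis i 1 \<bullet> (A *v v) = f" by (simp add: inner_axis' f_def matrix_vector_mult_def)
    have vA: "v \<bullet> (A *v axis i 1) = f"
      by (simp add: matrix_vector_mult_basis column_def inner_vec_def f_def sym[of i] mult.commute)
    have aa: "axis i 1 \<bullet> (A *v axis i 1) = a"
      by (simp add: matrix_vector_mult_basis column_def inner_axis' a_def)
    have "w \<bullet> (A *v w) = a * (a * (v \<bullet> (A *v v)) - f * f)"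
      by (simp add: w_def matrix_vector_mult_diff_distrib matrix_vector_mult_scaleR inner_diff_left inner_diff_right Ai vA aa algebra_simps)
    also have "\<dots> = v \<bullet> (B *v v)"
    proof -
      have "f * f = (\<Sum>j\<in>UNIV. \<Sum>k\<in>UNIV. v $ j * (A $ i $ j * A $ i $ k * v $ k))"
        unfolding f_def sum_product by (simp add: mult_ac)
      then show ?thesis
        unfolding quadratic_form_sum[of v A] quadratic_form_sum[of v B] B a_def
        by (simp add: sum_distrib_left algebra_simps flip: sum_subtractf)
    qed
    finally show ?thesis using A by (metis possemidef_def)
  qed
  moreover have "transpose B = B" by (simp add: vec_eq_iff transpose_def B sym mult.commute)
  ultimately show ?thesis by (simp add: possemidef_def)
qed

lemma two_neq_zero_rpoly: "(2 :: ('d::finite) rpoly) \<noteq> 0"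
proof
  assume "(2 :: 'd rpoly) = 0"
  then have "peval (1 + 1 :: 'd rpoly) 0 = 0" by (simp only: one_add_one peval_zero)
  moreover have "peval (1 + 1 :: 'd rpoly) 0 = 1 + 1" by (simp only: peval_add peval_one)
  ultimately show False by simp
qed

lemma quadratic_module_add: "quadratic_module M \<Longrightarrow> p \<in> M \<Longrightarrow> q \<in> M \<Longrightarrow> p + q \<in> M"
  and quadratic_module_mult_square: "quadratic_module M \<Longrightarrow> p \<in> M \<Longrightarrow> a\<^sup>2 * p \<in> M"
  by (simp_all add: quadratic_module_def)

text \<open>This is \<open>4 x = (x + 1)^2 - (x - 1)^2\<close> at \<open>x = t q\<close>, weighted
  by \<open>t\<close>. No positivity of \<open>q\<close> is involved.\<close>

lemma support_absorbs:
  fixes M :: "('d::finite) rpoly set"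
  assumes M: "quadratic_module M" and t: "t \<in> M" "- t \<in> M"
  shows "(2 * t)\<^sup>2 * q \<in> M"
proof -
  have "(t * q + 1)\<^sup>2 * t + (t * q - 1)\<^sup>2 * (- t) \<in> M"
    by (intro quadratic_module_add quadratic_module_mult_square M t)
  moreover have "(t * q + 1)\<^sup>2 * t + (t * q - 1)\<^sup>2 * (- t) = (2 * t)\<^sup>2 * q"
    by (simp add: power2_eq_square algebra_simps)
  ultimately show ?thesis by simp
qed

text \<open>Writes a symmetric matrix in terms of rank one squares with coefficients of arbitrary
  sign, to be absorbed by a non-trivial support. The factor \<open>2\<close> arises because each
  pair of indices occurs in both orders.\<close>

lemma polarisation:
  fixes F :: "'a::comm_ring_1 ^ 'n::finite ^ 'n"
  assumes "F \<in> sym_matrices"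
  shows "mscale 2 F = (\<Sum>i\<in>UNIV. \<Sum>j\<in>UNIV. mscale (F $ i $ j) (outer (axis i 1 + axis j 1))
     + mscale (- F $ i $ j) (outer (axis i 1)) + mscale (- F $ i $ j) (outer (axis j 1)))"
proof -
  have eq: "(\<Sum>i\<in>UNIV. \<Sum>j\<in>UNIV. F $ i $ j * ((axis i 1 + axis j 1) $ k * (axis i 1 + axis j 1) $ l)
     + - F $ i $ j * (axis i 1 $ k * axis i 1 $ l) + - F $ i $ j * (axis j 1 $ k * axis j 1 $ l))
     = F $ k $ l + F $ l $ k" for k l
  proof -
    have "F $ i $ j * ((axis i 1 + axis j 1) $ k * (axis i 1 + axis j 1) $ l)
       + - F $ i $ j * (axis i 1 $ k * axis i 1 $ l) + - F $ i $ j * (axis j 1 $ k * axis j 1 $ l)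
       = (if j = l then if i = k then F $ i $ j else 0 else 0) + (if j = k then if i = l then F $ i $ j else 0 else 0)" for i j
      by (simp add: axis_def algebra_simps)
    then show ?thesis by (simp add: sum.distrib)
  qed
  show ?thesis
    unfolding vec_eq_iff
  proof (intro allI)
    fix k l
    have "mscale 2 F $ k $ l = F $ k $ l + F $ l $ k"
      by (simp only: mscale_nth mult_2 sym_nth[OF assms, of l k])
    then show "mscale 2 F $ k $ l = (\<Sum>i\<in>UNIV. \<Sum>j\<in>UNIV. mscale (F $ i $ j) (outer (axis i 1 + axis j 1))
       + mscale (- F $ i $ j) (outer (axis i 1)) + mscale (- F $ i $ j) (outer (axis j 1))) $ k $ l"
      by (simp only: sum_component vector_add_component[of "mscale _ _"]
          vector_add_component[of "mscale _ _ + mscale _ _"] vector_add_component[of "mscale _ _ $ _"]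
          vector_add_component[of "(mscale _ _ + mscale _ _) $ _"] vector_add_component[of "mscale _ _ $ _ + mscale _ _ $ _"]
          mscale_nth outer_nth eq)
  qed
qed

text \<open>\<open>H\<close> abstracts Artin's theorem, so that \<open>M\<close> may be a mere
  quadratic module. If \<open>M\<close> contains \<open>t\<close> and \<open>-t\<close> for some
  non-zero \<open>t\<close>, every symmetric matrix has a square multiple in the cone. Otherwise
  rows are eliminated by Schur complements, with \<open>H\<close> applied to each pivot.\<close>

lemma square_multiple_in_mat_cone:
  fixes F :: "('d::finite) rpoly ^ 'n::finite ^ 'n"
  assumes M: "quadratic_module M"
    and H: "\<And>f. (\<And>x. x \<in> Q \<Longrightarrow> 0 \<le> peval f x) \<Longrightarrow> \<exists>b. b \<noteq> 0 \<and> b\<^sup>2 * f \<in> M"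
    and F: "F \<in> sym_matrices" and psd: "\<And>x. x \<in> Q \<Longrightarrow> possemidef (meval F x)"
  shows "\<exists>b. b \<noteq> 0 \<and> mscale (b\<^sup>2) F \<in> mat_cone M"
proof (cases "\<exists>t. t \<noteq> 0 \<and> t \<in> M \<and> - t \<in> M")
  case True
  then obtain t where t: "t \<noteq> 0" "t \<in> M" "- t \<in> M" by blast
  have two: "2 * t \<noteq> 0" using t(1) two_neq_zero_rpoly by (intro rpoly_no_zero_divisors)
  have abs: "mscale ((2 * t)\<^sup>2) (mscale q (outer v)) \<in> mat_cone M" for q v
    unfolding mscale_mscale by (intro mat_cone_outer support_absorbs[OF M t(2,3)])
  have "mscale ((2 * t)\<^sup>2) (mscale 2 (mscale 2 F)) \<in> mat_cone M"
    unfolding polarisation[OF F] mscale_sum mscale_add mscale_mscale[of 2]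
    by (intro mat_cone_sum mat_cone_add abs)
  moreover have "mscale ((2 * t)\<^sup>2) (mscale 2 (mscale 2 F)) = mscale ((2 * (2 * t))\<^sup>2) F"
    unfolding mscale_mscale by (simp add: power2_eq_square mult_ac)
  moreover have "2 * (2 * t) \<noteq> 0" by (rule rpoly_no_zero_divisors[OF two_neq_zero_rpoly two])
  ultimately show ?thesis by metis
next
  case False
  \<comment> \<open>Both \<open>e\<close> and \<open>-e\<close> are nonnegative on \<open>Q\<close>,
    so some non-zero multiple of \<open>e\<close> would lie in the trivial support. A zero pivot
    therefore forces its whole row to vanish as polynomials.\<close>
  have zero: "e = 0" if e: "\<And>x. x \<in> Q \<Longrightarrow> peval e x = 0" for e
  proof (rule ccontr)
    assume e0: "e \<noteq> 0"
    obtain b where b: "b \<noteq> 0" "b\<^sup>2 * e \<in> M" using H[of e] e by auto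
    obtain c where c: "c \<noteq> 0" "c\<^sup>2 * (- e) \<in> M" using H[of "- e"] e by auto
    have "c\<^sup>2 * (b\<^sup>2 * e) \<in> M" "b\<^sup>2 * (c\<^sup>2 * (- e)) \<in> M" 
      by (intro quadratic_module_mult_square M b c)+
    then have "(c * b)\<^sup>2 * e \<in> M" "- ((c * b)\<^sup>2 * e) \<in> M" by (simp_all add: power_mult_distrib mult_ac)
    moreover have "(c * b)\<^sup>2 * e \<noteq> 0"
      unfolding power2_eq_square using b c e0 by (intro rpoly_no_zero_divisors)
    ultimately show False using False by blast
  qed
  \<comment> \<open>\<open>I\<close> contains the indices of the rows and columns that have not been
    eliminated; the induction removes one pivot index at a time.\<close>
  have "\<forall>F. F \<in> sym_matrices \<longrightarrow> (\<forall>x\<in>Q. possemidef (meval F x)) \<longrightarrow>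
      (\<forall>i j. i \<notin> I \<or> j \<notin> I \<longrightarrow> F $ i $ j = 0) \<longrightarrow> (\<exists>b. b \<noteq> 0 \<and> mscale (b\<^sup>2) F \<in> mat_cone M)"
    if "finite I" for I :: "'n set"
    using that
  proof (induction I rule: finite_induct)
    case empty
    show ?case
    proof (intro allI impI)
      fix F :: "'d rpoly ^ 'n ^ 'n" assume "\<forall>i j. i \<notin> {} \<or> j \<notin> {} \<longrightarrow> F $ i $ j = 0"
      then have "mscale (1\<^sup>2) F = 0" by (simp add: vec_eq_iff)
      then show "\<exists>b. b \<noteq> 0 \<and> mscale (b\<^sup>2) F \<in> mat_cone M"
        by (intro exI[of _ 1]) (simp add: mat_cone_zero)
    qed
  next
    case (insert i I)
    show ?case
    proof (intro allI impI)
      fix F :: "'d rpoly ^ 'n ^ 'n"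
      assume F: "F \<in> sym_matrices" and psd: "\<forall>x\<in>Q. possemidef (meval F x)"
        and supp: "\<forall>j k. j \<notin> insert i I \<or> k \<notin> insert i I \<longrightarrow> F $ j $ k = 0"
      define a where "a = F $ i $ i"
      show "\<exists>b. b \<noteq> 0 \<and> mscale (b\<^sup>2) F \<in> mat_cone M"
      proof (cases "a = 0")
        case True
        have "F $ i $ j = 0" for j
        proof (rule zero)
          fix x assume "x \<in> Q"
          then have "possemidef (meval F x)" using psd by blast
          moreover have "meval F x $ i $ i = 0" using True by (simp add: a_def)
          ultimately have "meval F x $ i $ j = 0" by (rule possemidef_zero_diag)
          then show "peval (F $ i $ j) x = 0" by simp
        qed
        then have "F $ i $ j = 0" "F $ j $ i = 0" for j using sym_nth[OF F, of j i] by simp_all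
        then have "\<forall>j k. j \<notin> I \<or> k \<notin> I \<longrightarrow> F $ j $ k = 0"
          using supp by (metis insertE)
        then show ?thesis using insert.IH F psd by blast
      next
        case False
        define F' :: "'d rpoly ^ 'n ^ 'n" where "F' = (\<chi> j k. a * (a * F $ j $ k - F $ i $ j * F $ i $ k))"
        have "F' \<in> sym_matrices"
          unfolding sym_matrices_def mem_Collect_eq vec_eq_iff
        proof (intro allI)
          fix j k
          have "a * F $ k $ j - F $ i $ k * F $ i $ j = a * F $ j $ k - F $ i $ j * F $ i $ k"
            by (simp only: sym_nth[OF F, of k j] mult.commute[of "F $ i $ k"])
          then show "transpose F' $ j $ k = F' $ j $ k" by (simp only: transpose_def F'_def vec_lambda_beta)
        qed
        moreover have "\<forall>x\<in>Q. possemidef (meval F' x)"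
        proof
          fix x assume "x \<in> Q"
          then have "possemidef (meval F x)" using psd by blast
          then show "possemidef (meval F' x)"
            by (rule possemidef_schur[of _ _ i]) (simp add: F'_def a_def)
        qed
        moreover have "\<forall>j k. j \<notin> I \<or> k \<notin> I \<longrightarrow> F' $ j $ k = 0"
        proof (intro allI impI)
          fix j k assume jk: "j \<notin> I \<or> k \<notin> I"
          have "a * F $ j $ k - F $ i $ j * F $ i $ k = 0"
          proof (cases "j = i \<or> k = i")
            case True
            then show ?thesis using sym_nth[OF F, of j i] by (auto simp: a_def mult.commute)
          next
            case False
            then have "F $ j $ k = 0" "F $ i $ j = 0 \<or> F $ i $ k = 0" using supp jk by auto
            then show ?thesis by auto
          qed
          then show "F' $ j $ k = 0" by (simp add: F'_def)
        qed
        ultimately obtain c where c: "c \<noteq> 0" "mscale (c\<^sup>2) F' \<in> mat_cone M" using insert.IH by blast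
        have "0 \<le> peval a x" if "x \<in> Q" for x
          using psd that possemidef_diag_nonneg[of "meval F x" i] by (simp add: a_def)
        then obtain b where b: "b \<noteq> 0" "b\<^sup>2 * a \<in> M" using H by blast
        have "c\<^sup>2 * (b\<^sup>2 * a) \<in> M" by (intro quadratic_module_mult_square M b)
        \<comment> \<open>From \<open>F' = a (a F - r r^T)\<close>, with \<open>r\<close> the pivot
          row, one gets \<open>a^2 F = a r r^T + F'\<close>. The factors \<open>b^2\<close> and
          \<open>c^2\<close> move the two summands into the cone.\<close>
        then have "mscale (c\<^sup>2 * (b\<^sup>2 * a)) (outer (F $ i)) + mscale (b\<^sup>2) (mscale (c\<^sup>2) F') \<in> mat_cone M"
          by (intro mat_cone_add mat_cone_outer mat_cone_mscale_square[OF M] c)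
        moreover have "mscale (c\<^sup>2 * (b\<^sup>2 * a)) (outer (F $ i)) + mscale (b\<^sup>2) (mscale (c\<^sup>2) F')
            = mscale ((a * (b * c))\<^sup>2) F"
          by (simp add: vec_eq_iff F'_def power2_eq_square algebra_simps)
        moreover have "a * (b * c) \<noteq> 0" using False b c by (intro rpoly_no_zero_divisors)
        ultimately show ?thesis by metis
      qed
    qed
  qed
  from this[of UNIV] show ?thesis using F psd by auto
qed

section \<open>The Archimedean case\<close>

lemma peval_quad_form: "peval (quad_form F v) x = v \<bullet> (meval F x *v v)"
  by (simp add: quad_form_def quadratic_form_sum mult.assoc)

text \<open>Compactness of the unit sphere gives a lower bound \<open>m |v|^2\<close> for the form
  at \<open>x0\<close>, and the form changes by at most \<open>D x\<close> times
  \<open>|v|^2\<close>.\<close>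

lemma posdef_imp_nearby_possemidef:
  fixes F :: "('d::finite) rpoly ^ 'n::finite ^ 'n"
  assumes F: "F \<in> sym_matrices" and pos: "\<And>v. v \<noteq> 0 \<Longrightarrow> 0 < v \<bullet> (meval F x0 *v v)"
  shows "\<exists>N. open N \<and> x0 \<in> N \<and> (\<forall>x\<in>N. possemidef (meval F x))"
proof -
  let ?g = "\<lambda>v. v \<bullet> (meval F x0 *v v)"
  have "continuous_on (sphere 0 1) ?g"
    unfolding quadratic_form_sum by (intro continuous_intros)
  moreover have "compact (sphere (0 :: real ^ 'n) 1)" by simp
  moreover obtain u :: "real ^ 'n" where u: "norm u = 1" using vector_choose_size[of 1] by auto
  then have "sphere (0 :: real ^ 'n) 1 \<noteq> {}" by (auto simp: dist_norm)
  ultimately obtain w where w: "w \<in> sphere 0 1" "\<And>v. v \<in> sphere 0 1 \<Longrightarrow> ?g w \<le> ?g v"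
    using continuous_attains_inf[of "sphere 0 1" ?g] by blast
  define m where "m = ?g w"
  have "w \<noteq> 0" using w(1) by auto
  then have m: "m > 0" unfolding m_def by (rule pos)
  have lower: "m * (norm v)\<^sup>2 \<le> ?g v" for v
  proof (cases "v = 0")
    case False
    define s where "s = v /\<^sub>R norm v"
    have "s \<in> sphere 0 1" using False by (simp add: s_def dist_norm)
    then have "m \<le> ?g s" unfolding m_def by (rule w(2))
    also have "?g s = ?g v / (norm v)\<^sup>2"
      by (simp add: s_def matrix_vector_mult_scaleR power2_eq_square field_simps)
    finally show ?thesis using False by (simp add: field_simps)
  qed simp
  define D where "D x = (\<Sum>i\<in>UNIV. \<Sum>j\<in>UNIV. \<bar>peval (F $ i $ j) x - peval (F $ i $ j) x0\<bar>)" for x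
  have contD: "continuous_on UNIV D" unfolding D_def by (intro continuous_intros)
  define N where "N = {x. D x < m}"
  have "open N" unfolding N_def using open_Collect_less[OF contD continuous_on_const] by simp
  moreover have "x0 \<in> N" using m by (simp add: N_def D_def)
  moreover have "possemidef (meval F x)" if x: "x \<in> N" for x
  proof -
    have "0 \<le> v \<bullet> (meval F x *v v)" for v
    proof -
      have "\<bar>v \<bullet> (meval F x *v v) - ?g v\<bar> =
          \<bar>\<Sum>i\<in>UNIV. \<Sum>j\<in>UNIV. v $ i * ((peval (F $ i $ j) x - peval (F $ i $ j) x0) * v $ j)\<bar>"
        unfolding quadratic_form_sum by (simp add: algebra_simps flip: sum_subtractf)
      also have "\<dots> \<le> (\<Sum>i\<in>UNIV. \<Sum>j\<in>UNIV. \<bar>v $ i * ((peval (F $ i $ j) x - peval (F $ i $ j) x0) * v $ j)\<bar>)"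
        by (intro order_trans[OF sum_abs] sum_mono sum_abs)
      also have "\<dots> \<le> (\<Sum>i\<in>UNIV. \<Sum>j\<in>UNIV. \<bar>peval (F $ i $ j) x - peval (F $ i $ j) x0\<bar> * (norm v)\<^sup>2)"
      proof (intro sum_mono)
        fix i j
        have "\<bar>v $ i\<bar> * \<bar>v $ j\<bar> \<le> norm v * norm v" by (intro mult_mono component_le_norm_cart) auto
        then have "\<bar>peval (F $ i $ j) x - peval (F $ i $ j) x0\<bar> * (\<bar>v $ i\<bar> * \<bar>v $ j\<bar>)
            \<le> \<bar>peval (F $ i $ j) x - peval (F $ i $ j) x0\<bar> * (norm v)\<^sup>2"
          by (intro mult_left_mono) (auto simp: power2_eq_square)
        then show "\<bar>v $ i * ((peval (F $ i $ j) x - peval (F $ i $ j) x0) * v $ j)\<bar>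
            \<le> \<bar>peval (F $ i $ j) x - peval (F $ i $ j) x0\<bar> * (norm v)\<^sup>2"
          by (simp add: abs_mult mult_ac)
      qed
      also have "\<dots> = D x * (norm v)\<^sup>2" by (simp add: D_def sum_distrib_right)
      also have "\<dots> \<le> m * (norm v)\<^sup>2" using x by (intro mult_right_mono) (auto simp: N_def)
      finally show ?thesis using lower[of v] by linarith
    qed
    then show ?thesis using transpose_meval[OF F] by (simp add: possemidef_def)
  qed
  ultimately show ?thesis by blast
qed

section \<open>Separation by a single element of an Archimedean module\<close>

definition coord :: "'d \<Rightarrow> ('d::finite) rpoly" where
  "coord i = Poly_Mapping.single (Poly_Mapping.single i 1) 1"

lemma peval_coord [simp]: "peval (coord i) x = x $ i"
  using pe_Xvar[of x i] by (simp add: pe_def Xvar_def coord_def Rp_inverse)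

definition one_plus_norm2 :: "('d::finite) rpoly" where
  "one_plus_norm2 = 1 + (\<Sum>i\<in>UNIV. (coord i)\<^sup>2)"

lemma peval_one_plus_norm2 [simp]: "peval one_plus_norm2 x = 1 + (norm x)\<^sup>2"
  by (simp add: one_plus_norm2_def norm_vec_def L2_set_def sum_nonneg)

lemma polynomial_growth:
  fixes p :: "('d::finite) rpoly"
  shows "\<exists>c e. 0 \<le> c \<and> (\<forall>x. \<bar>peval p x\<bar> \<le> c * (1 + (norm x)\<^sup>2) ^ e)"
proof -
  define deg where "deg = (\<lambda>\<alpha> :: 'd \<Rightarrow>\<^sub>0 nat. \<Sum>i\<in>UNIV. Poly_Mapping.lookup \<alpha> i)"
  \<comment> \<open>Any common bound for the degrees of the monomials works; a sum also covers the
    zero polynomial.\<close>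
  define e where "e = (\<Sum>\<alpha>\<in>Poly_Mapping.keys p. deg \<alpha>)"
  have mono: "\<bar>monom_eval \<alpha> x\<bar> \<le> (1 + (norm x)\<^sup>2) ^ deg \<alpha>" for \<alpha> :: "'d \<Rightarrow>\<^sub>0 nat" and x
  proof -
    have "\<bar>x $ i\<bar> \<le> 1 + (norm x)\<^sup>2" for i
    proof -
      have "\<bar>x $ i\<bar> \<le> norm x" by (rule component_le_norm_cart)
      also have "\<dots> \<le> 1 + (norm x)\<^sup>2"
      proof -
        have "2 * norm x \<le> 1 + (norm x)\<^sup>2"
          using zero_le_power2[of "norm x - 1"] by (simp add: power2_eq_square algebra_simps)
        then show ?thesis using norm_ge_zero[of x] by linarith
      qed
      finally show ?thesis .
    qed
    then have "(\<Prod>i\<in>UNIV. \<bar>x $ i\<bar> ^ Poly_Mapping.lookup \<alpha> i) \<le> (\<Prod>i\<in>UNIV. (1 + (norm x)\<^sup>2) ^ Poly_Mapping.lookup \<alpha> i)"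
      by (intro prod_mono conjI power_mono) auto
    then show ?thesis by (simp add: monom_eval_def abs_prod power_abs deg_def power_sum)
  qed
  have "\<bar>peval p x\<bar> \<le> (\<Sum>\<alpha>\<in>Poly_Mapping.keys p. \<bar>Poly_Mapping.lookup p \<alpha>\<bar>) * (1 + (norm x)\<^sup>2) ^ e" for x
  proof -
    have "\<bar>peval p x\<bar> \<le> (\<Sum>\<alpha>\<in>Poly_Mapping.keys p. \<bar>Poly_Mapping.lookup p \<alpha> * monom_eval \<alpha> x\<bar>)"
      unfolding peval_eq_sum[OF finite_keys order_refl, of p] by (rule sum_abs)
    also have "\<dots> \<le> (\<Sum>\<alpha>\<in>Poly_Mapping.keys p. \<bar>Poly_Mapping.lookup p \<alpha>\<bar> * (1 + (norm x)\<^sup>2) ^ e)"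
    proof (intro sum_mono)
      fix \<alpha> assume a: "\<alpha> \<in> Poly_Mapping.keys p"
      have "deg \<alpha> \<le> e" unfolding e_def using a by (intro member_le_sum) auto
      then have "(1 + (norm x)\<^sup>2) ^ deg \<alpha> \<le> (1 + (norm x)\<^sup>2) ^ e" by (intro power_increasing) auto
      then have "\<bar>monom_eval \<alpha> x\<bar> \<le> (1 + (norm x)\<^sup>2) ^ e" using mono[of \<alpha> x] by linarith
      then show "\<bar>Poly_Mapping.lookup p \<alpha> * monom_eval \<alpha> x\<bar> \<le> \<bar>Poly_Mapping.lookup p \<alpha>\<bar> * (1 + (norm x)\<^sup>2) ^ e"
        by (simp add: abs_mult mult_left_mono)
    qed
    finally show ?thesis by (simp add: sum_distrib_right)
  qed
  then show ?thesis by (meson abs_ge_zero sum_nonneg)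
qed

text \<open>Bernoulli's inequality \<open>1 + n u <= (1 + u)^n\<close> bounds
  \<open>(1 + n u) (1 - u)^n\<close> by \<open>(1 - u^2)^n\<close>, hence by
  \<open>1\<close>.\<close>

lemma damped_term_bound:
  fixes u :: real
  assumes "0 \<le> u" "u \<le> 1" "n > 0" shows "u * (1 - u) ^ n \<le> 1 / n"
proof -
  have "(1 + n * u) * (1 - u) ^ n \<le> (1 + u) ^ n * (1 - u) ^ n"
    using assms Bernoulli_inequality[of u n] by (intro mult_right_mono) auto
  also have "\<dots> = (1 - u\<^sup>2) ^ n" by (simp add: power2_eq_square algebra_simps flip: power_mult_distrib)
  also have "\<dots> \<le> 1" using assms by (intro power_le_one) (auto simp: power_le_one)
  finally have "(1 - u) ^ n + n * u * (1 - u) ^ n \<le> 1" by (simp add: algebra_simps)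
  moreover have "0 \<le> (1 - u) ^ n" using assms by simp
  ultimately have "n * (u * (1 - u) ^ n) \<le> 1" by (simp add: mult.assoc)
  then show ?thesis using assms by (simp add: field_simps)
qed

lemma quadratic_module_zero: "quadratic_module M \<Longrightarrow> 0 \<in> M"
  using quadratic_module_mult_square[of M 1 0] by (simp add: quadratic_module_def)

lemma quadratic_module_sum:
  "quadratic_module M \<Longrightarrow> (\<And>i. i \<in> I \<Longrightarrow> f i \<in> M) \<Longrightarrow> sum f I \<in> M"
  by (induction I rule: infinite_finite_induct) (auto intro: quadratic_module_zero quadratic_module_add)

lemma archimedean_ball:
  fixes M :: "('d::finite) rpoly set"
  assumes M: "quadratic_module M" and arch: "archimedean M"
  shows "\<exists>N \<ge> 0. pconst (N + 1) - one_plus_norm2 \<in> M"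
proof -
  have pc: "of_nat k = (pconst (real k) :: 'd rpoly)" for k
    by (induction k) (simp_all add: pconst_add pconst_one, simp add: pconst_def)
  have "\<forall>i :: 'd. \<exists>k::nat. of_nat k - (coord i)\<^sup>2 \<in> M"
    using arch unfolding archimedean_def by blast
  then obtain k :: "'d \<Rightarrow> nat" where k: "\<And>i. of_nat (k i) - (coord i)\<^sup>2 \<in> M" by metis
  have "(\<Sum>i\<in>UNIV. of_nat (k i) - (coord i)\<^sup>2) \<in> M" by (intro quadratic_module_sum[OF M] k)
  moreover have "(\<Sum>i\<in>UNIV. of_nat (k i) - (coord i)\<^sup>2) = pconst (real (\<Sum>i\<in>UNIV. k i) + 1) - one_plus_norm2"
    by (simp add: sum_subtractf one_plus_norm2_def pconst_add pconst_one flip: of_nat_sum pc)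
  ultimately show ?thesis by (intro exI[of _ "real (\<Sum>i\<in>UNIV. k i)"]) (simp add: sum_nonneg)
qed

text \<open>The polynomial is \<open>\<Sum>\<^sub>g g (1 - g / C)\<^sup>2\<^sup>k + (N - \<parallel>x\<parallel>\<^sup>2) ((1 + \<parallel>x\<parallel>\<^sup>2) / (N + 2))\<^sup>2\<^sup>m\<close>: the even powers
  damp the nonnegative values of the generators, and \<open>m\<close> large controls it far away.\<close>

lemma archimedean_separation:
  fixes G :: "('d::finite) rpoly set" and U :: "(real ^ 'd) set"
  assumes fin: "finite G" and M: "quadratic_module M" and GM: "G \<subseteq> M" and arch: "archimedean M"
    and U: "open U" "nonneg_set G \<subseteq> U"
  shows "\<exists>h\<in>M. nonneg_set {h} \<subseteq> U"
proof -
  obtain N where N: "N \<ge> 0" "pconst (N + 1) - one_plus_norm2 \<in> M" using archimedean_ball[OF M arch] by blast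
  define a where "a = N + 1"
  have a: "a \<ge> 1" using N by (simp add: a_def)
  define g0 :: "'d rpoly" where "g0 = pconst a - one_plus_norm2"
  have g0: "g0 \<in> M" using N by (simp add: g0_def a_def)
  \<comment> \<open>With \<open>y = 1 + |x|^2\<close>, the ball polynomial \<open>a - y\<close> is
    positive only for \<open>y < a\<close>. Extending the ball to \<open>y <= a + 2\<close> makes
    \<open>y / (a + 1)\<close> exceed the constant \<open>r > 1\<close> outside it.\<close>
  define B where "B = cball (0 :: real ^ 'd) (sqrt (a + 1))"
  have B: "x \<in> B \<longleftrightarrow> 1 + (norm x)\<^sup>2 \<le> a + 2" for x
    unfolding B_def using a real_sqrt_le_iff[of "(norm x)\<^sup>2" "a + 1"] by (simp add: dist_norm add.commute)
  have cB: "compact B" by (simp add: B_def)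
  have cD: "compact (B - U)" using cB U(1) by (rule compact_diff)
  have "\<exists>\<eta>>0. \<forall>x\<in>B - U. \<exists>g\<in>G. peval g x \<le> - \<eta>"
  proof (cases "B - U = {}")
    case True
    then show ?thesis by (intro exI[of _ 1]) auto
  next
    case False
    \<comment> \<open>The sum of the negative parts is negative on the compact set
      \<open>B - U\<close>, so its maximum there is too. At each point some generator is at most the
      average; halving this average makes the contradiction below strict.\<close>
    define s where "s x = (\<Sum>g\<in>G. min (peval g x) 0)" for x
    have "continuous_on (B - U) s" unfolding s_def by (intro continuous_intros)
    then obtain z where z: "z \<in> B - U" "\<And>x. x \<in> B - U \<Longrightarrow> s x \<le> s z"
      using continuous_attains_sup[OF cD False] by blast
    have "z \<notin> nonneg_set G" using z(1) U(2) by blast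
    then obtain g' where g': "g' \<in> G" "peval g' z < 0" by (auto simp: nonneg_set_def not_le)
    have "(\<Sum>g\<in>G - {g'}. min (peval g z) 0) \<le> 0" by (intro sum_nonpos) simp
    moreover have "s z = min (peval g' z) 0 + (\<Sum>g\<in>G - {g'}. min (peval g z) 0)"
      unfolding s_def by (rule sum.remove[OF fin g'(1)])
    ultimately have sz: "s z < 0" using g'(2) by linarith
    have card: "card G > 0" using g' fin by (auto simp: card_gt_0_iff)
    define \<eta> where "\<eta> = - s z / (2 * card G)"
    have \<eta>: "\<eta> > 0" using sz card by (simp add: \<eta>_def divide_neg_pos)
    moreover have "\<exists>g\<in>G. peval g x \<le> - \<eta>" if x: "x \<in> B - U" for x
    proof (rule ccontr)
      assume "\<not> ?thesis"
      then have "- \<eta> \<le> min (peval g x) 0" if "g \<in> G" for g using that \<eta> by force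
      then have "card G * (- \<eta>) \<le> s x" unfolding s_def by (rule sum_bounded_below)
      also have "\<dots> \<le> s z" using z(2) x by blast
      finally show False using sz card by (simp add: \<eta>_def field_simps)
    qed
    ultimately show ?thesis by blast
  qed
  then obtain \<eta> where \<eta>: "\<eta> > 0" "\<And>x. x \<in> B - U \<Longrightarrow> \<exists>g\<in>G. peval g x \<le> - \<eta>" by blast
  obtain C where C: "C > 0" "\<And>g x. g \<in> G \<Longrightarrow> x \<in> B \<Longrightarrow> \<bar>peval g x\<bar> \<le> C"
  proof -
    have "compact ((\<lambda>x. \<Sum>g\<in>G. \<bar>peval g x\<bar>) ` B)"
      by (intro compact_continuous_image cB continuous_intros)
    then obtain C where C: "\<And>y. y \<in> (\<lambda>x. \<Sum>g\<in>G. \<bar>peval g x\<bar>) ` B \<Longrightarrow> norm y \<le> C" "C > 0"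
      using compact_imp_bounded bounded_pos by metis
    have "\<bar>peval g x\<bar> \<le> C" if "g \<in> G" "x \<in> B" for g x
    proof -
      have "\<bar>peval g x\<bar> \<le> (\<Sum>g\<in>G. \<bar>peval g x\<bar>)" using that fin by (intro member_le_sum) auto
      also have "\<dots> \<le> C" using C(1)[of "\<Sum>g\<in>G. \<bar>peval g x\<bar>"] that(2) by auto
      finally show ?thesis .
    qed
    then show thesis using that C(2) by blast
  qed
  \<comment> \<open>Each damped term contributes at most \<open>C / (2 k)\<close> when its generator
    is nonnegative; this \<open>k\<close> keeps the total at most \<open>\<eta> / 2\<close>.\<close>
  obtain k :: nat where k: "k > 0" "2 * (card G * C / \<eta>) < k"
    using reals_Archimedean2[of "max 1 (2 * (card G * C / \<eta>))"] by (metis max_less_iff_conj of_nat_0_less_iff zero_less_one less_trans)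
  define q where "q = (\<Sum>g\<in>G. (((1 - pconst (1 / C) * g) ^ k)\<^sup>2) * g)"
  have qM: "q \<in> M" unfolding q_def using GM by (intro quadratic_module_sum[OF M] quadratic_module_mult_square[OF M]) auto
  define tm where "tm g x = (1 - peval g x / C) ^ (2 * k) * peval g x" for g :: "'d rpoly" and x
  have q: "peval q x = (\<Sum>g\<in>G. tm g x)" for x
    by (simp add: q_def tm_def power_mult mult.commute[of 2 k])
  \<comment> \<open>Where a generator is negative the damping factor is an even power of a number
    above \<open>1\<close>, so the value only becomes more negative.\<close>
  have neg_term: "tm g x \<le> peval g x" if "peval g x < 0" for g x
  proof -
    have "1 \<le> (1 - peval g x / C) ^ (2 * k)" using that C(1) by (intro one_le_power) (simp add: divide_neg_pos less_imp_le)
    then show ?thesis using that mult_right_mono_neg[of 1 "(1 - peval g x / C) ^ (2 * k)" "peval g x"] by (simp add: tm_def)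
  qed
  have pos_term: "tm g x \<le> C / (2 * k)" if g: "g \<in> G" "x \<in> B" for g x
  proof (cases "peval g x < 0")
    case True
    then show ?thesis using neg_term[OF True] C(1) by (smt (verit) divide_nonneg_nonneg of_nat_0_le_iff)
  next
    case False
    define u where "u = peval g x / C"
    have "0 \<le> u" "u \<le> 1" using False C(2)[OF g] C(1) by (auto simp: u_def)
    then have "u * (1 - u) ^ (2 * k) \<le> 1 / real (2 * k)" using k(1) by (intro damped_term_bound) auto
    then have "C * (u * (1 - u) ^ (2 * k)) \<le> C * (1 / real (2 * k))" using C(1) by (intro mult_left_mono) auto
    then show ?thesis using C(1) by (simp add: tm_def u_def mult.commute)
  qed
  have q_neg: "peval q x \<le> - \<eta> / 2" if x: "x \<in> B - U" for x
  proof -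
    obtain g where g: "g \<in> G" "peval g x \<le> - \<eta>" using \<eta>(2)[OF x] by blast
    have "peval q x = tm g x + (\<Sum>g\<in>G - {g}. tm g x)" unfolding q by (rule sum.remove[OF fin g(1)])
    also have "\<dots> \<le> - \<eta> + card G * (C / (2 * k))"
    proof (rule add_mono)
      show "tm g x \<le> - \<eta>" using neg_term[of g x] g(2) \<eta>(1) by linarith
      have "(\<Sum>g\<in>G - {g}. tm g x) \<le> card (G - {g}) * (C / (2 * k))"
        using x pos_term by (intro sum_bounded_above) auto
      also have "\<dots> \<le> card G * (C / (2 * k))"
        using C(1) fin by (intro mult_right_mono) (auto intro: card_mono)
      finally show "(\<Sum>g\<in>G - {g}. tm g x) \<le> card G * (C / (2 * k))" .
    qed
    also have "card G * (C / (2 * k)) \<le> \<eta> / 2"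
    proof -
      have "2 * (card G * C) < k * \<eta>" using k(2) \<eta>(1) by (simp add: field_simps)
      then have "card G * C \<le> k * \<eta>" using C(1) by (smt (verit) mult_nonneg_nonneg of_nat_0_le_iff)
      then show ?thesis using k(1) by (simp add: field_simps)
    qed
    finally show ?thesis by simp
  qed
  obtain c e where ce: "0 \<le> c" "\<And>x. \<bar>peval q x\<bar> \<le> c * (1 + (norm x)\<^sup>2) ^ e"
    using polynomial_growth[of q] by blast
  define r where "r = (a + 2) / (a + 1)"
  have r: "r > 1" using a by (simp add: r_def)
  \<comment> \<open>\<open>m1\<close> and the summand \<open>e\<close> in \<open>m\<close> let
    \<open>z^(2 m)\<close> beat the growth of \<open>q\<close> outside \<open>B\<close>, since
    \<open>c y^e = c (a + 1)^e z^e < r^m1 z^e\<close>. Where \<open>y <= a\<close>, the choice of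
    \<open>m2\<close> keeps the ball term below \<open>\<eta> / 2\<close>.\<close>
  obtain m1 where m1: "c * (a + 1) ^ e < r ^ m1" using real_arch_pow[OF r] by blast
  have "a / (a + 1) < 1" "0 < \<eta> / (2 * a)" using a \<eta>(1) by auto
  then obtain m2 where m2: "(a / (a + 1)) ^ m2 < \<eta> / (2 * a)" using real_arch_pow_inv by blast
  define m where "m = m1 + m2 + e"
  define h where "h = q + (((pconst (1 / (a + 1)) * one_plus_norm2) ^ m)\<^sup>2) * g0"
  have hM: "h \<in> M" unfolding h_def
    by (intro quadratic_module_add[OF M qM] quadratic_module_mult_square[OF M] g0)
  have "peval h x < 0" if xU: "x \<notin> U" for x
  proof -
    define y where "y = 1 + (norm x)\<^sup>2"
    define z where "z = y / (a + 1)"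
    have y1: "y \<ge> 1" by (simp add: y_def)
    have z0: "z > 0" using y1 a by (simp add: z_def)
    have h: "peval h x = peval q x + z ^ (2 * m) * (a - y)"
      by (simp add: h_def g0_def y_def z_def power_mult mult.commute[of 2 m])
    show ?thesis
    proof (cases "y \<le> a + 2")
      case True
      then have "peval q x \<le> - \<eta> / 2" using q_neg xU B by (auto simp: y_def)
      moreover have "z ^ (2 * m) * (a - y) < \<eta> / 2"
      proof (cases "y \<le> a")
        case True
        have "z ^ (2 * m) * (a - y) \<le> (a / (a + 1)) ^ (2 * m) * a"
          using True y1 a z0 by (intro mult_mono power_mono) (auto simp: z_def divide_right_mono)
        also have "\<dots> \<le> (a / (a + 1)) ^ m2 * a"
          using a by (intro mult_right_mono power_decreasing) (auto simp: m_def)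
        also have "\<dots> < \<eta> / 2" using m2 a by (simp add: field_simps)
        finally show ?thesis .
      next
        case False
        then have "z ^ (2 * m) * (a - y) \<le> 0" using z0 by (intro mult_nonneg_nonpos) auto
        then show ?thesis using \<eta>(1) by linarith
      qed
      ultimately show ?thesis using h by linarith
    next
      case False
      then have y2: "y > a + 2" by simp
      have zr: "z \<ge> r" using y2 a by (simp add: z_def r_def divide_right_mono)
      have "c * y ^ e = (c * (a + 1) ^ e) * z ^ e" using a by (simp add: z_def power_divide)
      also have "\<dots> < r ^ m1 * z ^ e" using m1 z0 by (intro mult_strict_right_mono) auto
      also have "\<dots> \<le> z ^ m1 * z ^ e" using zr r z0 by (intro mult_right_mono power_mono) auto
      also have "\<dots> = z ^ (m1 + e)" by (simp add: power_add)
      also have "\<dots> \<le> z ^ (2 * m)" using zr r by (intro power_increasing) (auto simp: m_def)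
      finally have "c * y ^ e < z ^ (2 * m)" .
      moreover have "peval q x \<le> c * y ^ e" using ce(2)[of x] by (simp add: y_def)
      moreover have "z ^ (2 * m) * (a - y) \<le> z ^ (2 * m) * (- 1)" using y2 z0 by (intro mult_left_mono) auto
      ultimately show ?thesis using h by linarith
    qed
  qed
  then have "nonneg_set {h} \<subseteq> U" unfolding nonneg_set_def by force
  then show ?thesis using hM by blast
qed

text \<open>The set \<open>\<Sigma> + h \<Sigma>\<close>, with \<open>\<Sigma>\<close> the
  preordering generated by the empty set, is closed under products because \<open>h^2\<close> is a
  square. For two generators their product could leave \<open>M\<close>.\<close>

lemma preordering_hull_single_subset:
  fixes M :: "'a::comm_ring_1 set"
  assumes M: "quadratic_module M" and h: "h \<in> M"
  shows "ring_preordering hull {h} \<subseteq> M"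
proof -
  define \<Sigma> where "\<Sigma> = (ring_preordering hull {} :: 'a set)"
  have \<Sigma>: "p + q \<in> \<Sigma>" "p * q \<in> \<Sigma>" "r\<^sup>2 \<in> \<Sigma>" if "p \<in> \<Sigma>" "q \<in> \<Sigma>" for p q r
    using ring_preordering_hull[of "{}"] that unfolding \<Sigma>_def ring_preordering_def by auto
  have \<Sigma>sq: "r\<^sup>2 \<in> \<Sigma>" for r
    using ring_preordering_hull[of "{}"] unfolding \<Sigma>_def ring_preordering_def by auto
  \<comment> \<open>The multipliers of \<open>M\<close> form a preordering, so they contain the
    smallest one; no explicit sums of squares are handled.\<close>
  have "\<Sigma> \<subseteq> {s. \<forall>p\<in>M. s * p \<in> M}"
    unfolding \<Sigma>_def
  proof (rule hull_minimal)
    show "ring_preordering {s. \<forall>p\<in>M. s * p \<in> M}"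
      unfolding ring_preordering_def
      using quadratic_module_add[OF M] quadratic_module_mult_square[OF M]
      by (auto simp: distrib_right mult.assoc)
  qed simp
  then have \<Sigma>M: "s * p \<in> M" if "s \<in> \<Sigma>" "p \<in> M" for s p using that by blast
  define W where "W = {s + h * t | s t. s \<in> \<Sigma> \<and> t \<in> \<Sigma>}"
  have W_I: "s + h * t \<in> W" if "s \<in> \<Sigma>" "t \<in> \<Sigma>" for s t using that by (auto simp: W_def)
  have \<Sigma>0: "0 \<in> \<Sigma>" and \<Sigma>1: "1 \<in> \<Sigma>" using \<Sigma>sq[of 0] \<Sigma>sq[of 1] by auto
  have "ring_preordering hull {h} \<subseteq> W"
  proof (rule hull_minimal)
    show "{h} \<subseteq> W" using W_I[OF \<Sigma>0 \<Sigma>1] by simp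
    show "ring_preordering W" unfolding ring_preordering_def
    proof (intro conjI ballI allI)
      fix p q assume "p \<in> W" "q \<in> W"
      then obtain s t u v where p: "p = s + h * t" "s \<in> \<Sigma>" "t \<in> \<Sigma>" and q: "q = u + h * v" "u \<in> \<Sigma>" "v \<in> \<Sigma>"
        unfolding W_def by blast
      have "p + q = (s + u) + h * (t + v)" unfolding p q by (simp add: algebra_simps)
      moreover have "(s + u) + h * (t + v) \<in> W" using p q \<Sigma> by (intro W_I) auto
      ultimately show "p + q \<in> W" by (simp only:)
      have "p * q = (s * u + h\<^sup>2 * (t * v)) + h * (s * v + t * u)"
        unfolding p q by (simp add: algebra_simps power2_eq_square)
      moreover have "(s * u + h\<^sup>2 * (t * v)) + h * (s * v + t * u) \<in> W"
        using p q \<Sigma> \<Sigma>sq by (intro W_I) auto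
      ultimately show "p * q \<in> W" by (simp only:)
    next
      fix p show "p\<^sup>2 \<in> W" using W_I[OF \<Sigma>sq \<Sigma>0] by simp
    qed
  qed
  moreover have "W \<subseteq> M"
  proof
    fix w assume "w \<in> W"
    then obtain s t where w: "w = s + h * t" "s \<in> \<Sigma>" "t \<in> \<Sigma>" unfolding W_def by blast
    have "1 \<in> M" using M by (simp add: quadratic_module_def)
    then have "s * 1 + t * h \<in> M" by (intro quadratic_module_add[OF M] \<Sigma>M w h)
    then show "w \<in> M" by (simp add: w mult.commute)
  qed
  ultimately show ?thesis by blast
qed

lemma ring_preordering_imp_quadratic_module: "ring_preordering T \<Longrightarrow> quadratic_module T"
  unfolding ring_preordering_def quadratic_module_def by (metis power_one)

lemma conjugate_by_scalar:
  fixes F :: "'a::comm_ring_1 ^ 'n::finite ^ 'n"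
  shows "mat b ** F ** transpose (mat b) = mscale (b\<^sup>2) F"
proof -
  have "(if P then b else 0) * c = (if P then b * c else 0)" "c * (if P then b else 0) = (if P then b * c else 0)"
    for P and c :: 'a by (simp_all add: mult.commute)
  then have "mat b ** A = mscale b A" "A ** mat b = mscale b A" for A :: "'a ^ 'n ^ 'n"
    by (simp_all add: vec_eq_iff matrix_matrix_mult_def mat_def)
  then show ?thesis by (simp add: mscale_mscale power2_eq_square)
qed

lemma compact_case:
  fixes F :: "('d::finite) rpoly ^ 'n::finite ^ 'n"
  assumes "finite G" and "F \<in> sym_matrices" and "\<forall>x\<in>nonneg_set G. possemidef (meval F x)"
  shows "\<exists>b. b \<noteq> 0 \<and> mscale (b\<^sup>2) F \<in> mat_cone (ring_preordering hull G)"
proof (rule square_multiple_in_mat_cone[where Q = "nonneg_set G"])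
  show "quadratic_module (ring_preordering hull G)"
    by (intro ring_preordering_imp_quadratic_module ring_preordering_hull)
qed (use assms nonneg_imp_square_multiple_in_preordering in blast)+

text \<open>At a point of \<open>K_G\<close> outside its interior no form \<open>v^T F v\<close>
  with \<open>v\<close> non-zero vanishes, so \<open>F\<close> is positive definite there and
  positive semidefinite nearby. Around an interior point, \<open>K_G\<close> itself is the
  neighbourhood.\<close>

lemma archimedean_case:
  fixes F :: "('d::finite) rpoly ^ 'n::finite ^ 'n"
  assumes fin: "finite G" and F: "F \<in> sym_matrices" and psd: "\<forall>x\<in>nonneg_set G. possemidef (meval F x)"
    and zeros: "\<And>v. v \<noteq> 0 \<Longrightarrow> zeros_on (quad_form F v) (nonneg_set G) \<subseteq> interior (nonneg_set G)"
    and arch: "archimedean (quadratic_module hull G)"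
  shows "\<exists>b. b \<noteq> 0 \<and> mscale (b\<^sup>2) F \<in> mat_cone (quadratic_module hull G)"
proof -
  let ?K = "nonneg_set G" and ?M = "quadratic_module hull G"
  define U where "U = interior {x. possemidef (meval F x)}"
  have "?K \<subseteq> U"
  proof
    fix x assume x: "x \<in> ?K"
    show "x \<in> U"
    proof (cases "x \<in> interior ?K")
      case True
      moreover have "interior ?K \<subseteq> U" unfolding U_def using psd by (intro interior_mono) auto
      ultimately show ?thesis by blast
    next
      case False
      have "0 < v \<bullet> (meval F x *v v)" if v: "v \<noteq> 0" for v
      proof -
        have "peval (quad_form F v) x \<noteq> 0"
          using zeros[OF v] False x unfolding zeros_on_def by blast
        moreover have "0 \<le> v \<bullet> (meval F x *v v)" using psd x by (simp add: possemidef_def)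
        ultimately show ?thesis by (simp add: peval_quad_form)
      qed
      from posdef_imp_nearby_possemidef[OF F this]
      obtain N where "open N" "x \<in> N" "\<forall>x\<in>N. possemidef (meval F x)" by blast
      then show ?thesis unfolding U_def by (intro interiorI[of N]) auto
    qed
  qed
  moreover have "open U" by (simp add: U_def)
  moreover have "G \<subseteq> ?M" by (rule hull_subset)
  ultimately obtain h where h: "h \<in> ?M" "nonneg_set {h} \<subseteq> U"
    using archimedean_separation[OF fin quadratic_module_hull _ arch] by blast
  show ?thesis
  proof (rule square_multiple_in_mat_cone[where Q = "nonneg_set {h}"])
    show "quadratic_module ?M" by (rule quadratic_module_hull)
    show "\<exists>b. b \<noteq> 0 \<and> b\<^sup>2 * f \<in> ?M" if "\<And>x. x \<in> nonneg_set {h} \<Longrightarrow> 0 \<le> peval f x" for f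
      using nonneg_imp_square_multiple_in_preordering[of "{h}" f] that
        preordering_hull_single_subset[OF quadratic_module_hull h(1)] by auto
    show "F \<in> sym_matrices" by (rule F)
    fix x assume "x \<in> nonneg_set {h}"
    then have "x \<in> U" using h(2) by blast
    then show "possemidef (meval F x)" using interior_subset unfolding U_def by blast
  qed
qed

theorem theorem6p7:
  fixes \<G> :: "(('d::finite) rpoly ^ ('n::finite) ^ 'n) set"
    and G :: "'d rpoly set"
    and F :: "'d rpoly ^ 'n ^ 'n"
  assumes "finite \<G>" and "\<G> \<subseteq> sym_matrices" and "finite G"
    and "psd_set \<G> = nonneg_set G"
    and "(mat_cone (quadratic_module hull G) :: ('d rpoly ^ 'n ^ 'n) set)
           \<subseteq> mat_quadratic_module hull \<G>"
    and "(mat_cone (ring_preordering hull G) :: ('d rpoly ^ 'n ^ 'n) set) \<subseteq> mat_preordering hull \<G>"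
    and "F \<in> sym_matrices"
    and "\<forall>x\<in>psd_set \<G>. possemidef (meval F x)"
    and "\<forall>v. v \<noteq> 0 \<longrightarrow> finite (zeros_on (quad_form F v) (psd_set \<G>)) \<and>
           zeros_on (quad_form F v) (psd_set \<G>) \<subseteq> interior (psd_set \<G>)"
    and "\<forall>v. v \<noteq> 0 \<longrightarrow> (\<forall>p \<in> zeros_on (quad_form F v) (psd_set \<G>).
           posdef (hessian (peval (quad_form F v)) p))"
  shows "(compact (psd_set \<G>) \<longrightarrow>
            (\<exists>X :: 'd rpoly ^ 'n ^ 'n.
               X ** F ** transpose X \<in> mat_cone (ring_preordering hull G) \<and>
               (mat_cone (ring_preordering hull G) :: ('d rpoly ^ 'n ^ 'n) set)
                 \<subseteq> mat_preordering hull \<G>) \<and>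
            (\<exists>b :: 'd rpoly. b \<noteq> 0 \<and>
               mscale (b\<^sup>2) F \<in> mat_cone (ring_preordering hull G) \<and>
               (mat_cone (ring_preordering hull G) :: ('d rpoly ^ 'n ^ 'n) set)
                 \<subseteq> mat_preordering hull \<G>)) \<and>
         (archimedean (quadratic_module hull G) \<longrightarrow>
            (\<exists>X :: 'd rpoly ^ 'n ^ 'n.
               X ** F ** transpose X \<in> mat_cone (quadratic_module hull G) \<and>
               (mat_cone (quadratic_module hull G) :: ('d rpoly ^ 'n ^ 'n) set)
                 \<subseteq> mat_quadratic_module hull \<G>) \<and>
            (\<exists>b :: 'd rpoly. b \<noteq> 0 \<and>
               mscale (b\<^sup>2) F \<in> mat_cone (quadratic_module hull G) \<and>
               (mat_cone (quadratic_module hull G) :: ('d rpoly ^ 'n ^ 'n) set)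
                 \<subseteq> mat_quadratic_module hull \<G>))"
proof -
  note cone_subset = assms(5,6) and K = assms(4)
  have psd: "\<forall>x\<in>nonneg_set G. possemidef (meval F x)" using assms(8) by (simp add: K)
  have zeros: "zeros_on (quad_form F v) (nonneg_set G) \<subseteq> interior (nonneg_set G)" if "v \<noteq> 0" for v
    using assms(9) that by (simp add: K)
  have X: "\<exists>X :: 'd rpoly ^ 'n ^ 'n. X ** F ** transpose X \<in> C" if "mscale (b\<^sup>2) F \<in> C" for b C
    using that by (intro exI[of _ "mat b"]) (simp only: conjugate_by_scalar)
  show ?thesis
  proof (intro conjI impI)
    obtain b where b: "b \<noteq> 0" "mscale (b\<^sup>2) F \<in> mat_cone (ring_preordering hull G)"
      using compact_case[OF assms(3,7) psd] by blast
    then show "\<exists>X :: 'd rpoly ^ 'n ^ 'n. X ** F ** transpose X \<in> mat_cone (ring_preordering hull G) \<and>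
        (mat_cone (ring_preordering hull G) :: ('d rpoly ^ 'n ^ 'n) set) \<subseteq> mat_preordering hull \<G>"
      using X[OF b(2)] cone_subset by blast
    show "\<exists>b :: 'd rpoly. b \<noteq> 0 \<and> mscale (b\<^sup>2) F \<in> mat_cone (ring_preordering hull G) \<and>
        (mat_cone (ring_preordering hull G) :: ('d rpoly ^ 'n ^ 'n) set) \<subseteq> mat_preordering hull \<G>"
      using b cone_subset by blast
  next
    assume "archimedean (quadratic_module hull G)"
    then obtain b where b: "b \<noteq> 0" "mscale (b\<^sup>2) F \<in> mat_cone (quadratic_module hull G)"
      using archimedean_case[OF assms(3,7) psd zeros] by blast
    then show "\<exists>X :: 'd rpoly ^ 'n ^ 'n. X ** F ** transpose X \<in> mat_cone (quadratic_module hull G) \<and>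
        (mat_cone (quadratic_module hull G) :: ('d rpoly ^ 'n ^ 'n) set) \<subseteq> mat_quadratic_module hull \<G>"
      using X[OF b(2)] cone_subset by blast
    show "\<exists>b :: 'd rpoly. b \<noteq> 0 \<and> mscale (b\<^sup>2) F \<in> mat_cone (quadratic_module hull G) \<and>
        (mat_cone (quadratic_module hull G) :: ('d rpoly ^ 'n ^ 'n) set) \<subseteq> mat_quadratic_module hull \<G>"
      using b cone_subset by blast
  qed
qed

end
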